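(* Let $X$ be a compact Kähler manifold with $c_1(X)>0$ of complex dimension $n=1$. Then the Futaki invariant of $X$ vanishes.
   Context: Conventions: the Kähler form of a metric $g=(g_{\bar k j})$ is $\omega=\frac{\sqrt{-1}}{2}g_{\bar k j}\,dz^j\wedge d\bar z^k$; the Ricci curvature is $R_{\bar k j}=-\partial_j\partial_{\bar k}\log\det g$, so that $\frac{\sqrt{-1}}{2}R_{\bar k j}dz^j\wedge d\bar z^k\in\pi c_1(X)$. Futaki invariant (with $n=\dim_{\mathbf C}X$): for a Kähler metric $g$ with $\omega\in\pi c_1(X)$ let $u$ be a real function with $g_{\bar k j}-R_{\bar k j}=\partial_j\partial_{\bar k}u$. The Futaki invariant is the linear functional on the space of holomorphic vector fields $V=V^j\partial_j$ given, up to an irrelevant nonzero normalization constant, by $\mathrm{Fut}(V)=-\int_X V^j\partial_j u\;\omega^n$; it is independent of the choice of $g$ with $\omega\in\pi c_1(X)$. It vanishes if $\mathrm{Fut}(V)=0$ for all holomorphic vector fields $V$. *)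

theory Defs
  imports "HOL-Analysis.Analysis" "HOL-Complex_Analysis.Complex_Analysis"
begin

text \<open>Only meaningful for open sets, where the Frechet derivative does not depend on values of the
  function outside the set.\<close>

primrec Ck_on :: "nat \<Rightarrow> ('a::real_normed_vector \<Rightarrow> 'b::real_normed_vector) \<Rightarrow> 'a set \<Rightarrow> bool" where
  "Ck_on 0 f S \<longleftrightarrow> continuous_on S f"
| "Ck_on (Suc k) f S \<longleftrightarrow>
     f differentiable_on S \<and> (\<forall>v. Ck_on k (\<lambda>x. frechet_derivative f (at x) v) S)"

definition smooth_on :: "('a::real_normed_vector \<Rightarrow> 'b::real_normed_vector) \<Rightarrow> 'a set \<Rightarrow> bool" where
  "smooth_on f S \<longleftrightarrow> (\<forall>k. Ck_on k f S)"

definition dz :: "(complex \<Rightarrow> complex) \<Rightarrow> complex \<Rightarrow> complex" where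
  "dz f z = (frechet_derivative f (at z) 1 - \<i> * frechet_derivative f (at z) \<i>) / 2"

definition dzbar :: "(complex \<Rightarrow> complex) \<Rightarrow> complex \<Rightarrow> complex" where
  "dzbar f z = (frechet_derivative f (at z) 1 + \<i> * frechet_derivative f (at z) \<i>) / 2"

text \<open>A chart is a pair of its domain and its coordinate function; only the values of the
  coordinate function on the domain matter.\<close>

type_synonym 'a chart = "'a set \<times> ('a \<Rightarrow> complex)"

abbreviation chart_dom :: "'a chart \<Rightarrow> 'a set" where
  "chart_dom \<equiv> fst"

abbreviation coord :: "'a chart \<Rightarrow> 'a \<Rightarrow> complex" where
  "coord \<equiv> snd"

definition chart_range :: "'a chart \<Rightarrow> complex set" where
  "chart_range c = coord c ` chart_dom c"

definition chart_inv :: "'a chart \<Rightarrow> complex \<Rightarrow> 'a" where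
  "chart_inv c = inv_into (chart_dom c) (coord c)"

definition overlap :: "'a chart \<Rightarrow> 'a chart \<Rightarrow> complex set" where
  "overlap c d = coord c ` (chart_dom c \<inter> chart_dom d)"

definition transition :: "'a chart \<Rightarrow> 'a chart \<Rightarrow> complex \<Rightarrow> complex" where
  "transition c d = coord d \<circ> chart_inv c"

text \<open>The manifold is the whole type; it is not required to be connected.\<close>

definition complex_atlas :: "'a::{t2_space, second_countable_topology} chart set \<Rightarrow> bool" where
  "complex_atlas \<A> \<longleftrightarrow>
     (\<Union>c\<in>\<A>. chart_dom c) = UNIV \<and>
     (\<forall>c\<in>\<A>. open (chart_dom c) \<and> open (chart_range c) \<and>
        homeomorphism (chart_dom c) (chart_range c) (coord c) (chart_inv c)) \<and>
     (\<forall>c\<in>\<A>. \<forall>d\<in>\<A>. transition c d holomorphic_on overlap c d)"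

text \<open>Tensor fields are families of coefficient functions, one for each chart \<open>c\<close>, defined on the
  open set \<open>chart_range c\<close> of the complex plane and related by the usual transformation laws.\<close>

definition smooth_function :: "'a chart set \<Rightarrow> ('a \<Rightarrow> real) \<Rightarrow> bool" where
  "smooth_function \<A> u \<longleftrightarrow> (\<forall>c\<in>\<A>. smooth_on (u \<circ> chart_inv c) (chart_range c))"

text \<open>\<open>V c\<close> is the component of \<open>V = V\<^sup>z \<partial>\<^sub>z\<close> in the chart \<open>c\<close>.\<close>

definition holomorphic_vector_field :: "'a chart set \<Rightarrow> ('a chart \<Rightarrow> complex \<Rightarrow> complex) \<Rightarrow> bool" where
  "holomorphic_vector_field \<A> V \<longleftrightarrow>
     (\<forall>c\<in>\<A>. V c holomorphic_on chart_range c) \<and>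
     (\<forall>c\<in>\<A>. \<forall>d\<in>\<A>. \<forall>z\<in>overlap c d.
        V d (transition c d z) = deriv (transition c d) z * V c z)"

text \<open>\<open>a\<close> represents the real 1-form \<open>a dz + cnj a d(cnj z)\<close>.\<close>

definition real_1_form :: "'a chart set \<Rightarrow> ('a chart \<Rightarrow> complex \<Rightarrow> complex) \<Rightarrow> bool" where
  "real_1_form \<A> a \<longleftrightarrow>
     (\<forall>c\<in>\<A>. smooth_on (a c) (chart_range c)) \<and>
     (\<forall>c\<in>\<A>. \<forall>d\<in>\<A>. \<forall>z\<in>overlap c d.
        a c z = a d (transition c d z) * deriv (transition c d) z)"

text \<open>\<open>s\<close> represents the real 2-form \<open>(\<i>/2) s dz \<and> d(cnj z) = s dx \<and> dy\<close>. In complex dimension one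
  every real 2-form is of type (1,1) and closed.\<close>

definition real_2_form :: "'a chart set \<Rightarrow> ('a chart \<Rightarrow> complex \<Rightarrow> complex) \<Rightarrow> bool" where
  "real_2_form \<A> s \<longleftrightarrow>
     (\<forall>c\<in>\<A>. smooth_on (s c) (chart_range c) \<and> (\<forall>z\<in>chart_range c. s c z \<in> \<real>)) \<and>
     (\<forall>c\<in>\<A>. \<forall>d\<in>\<A>. \<forall>z\<in>overlap c d.
        s c z = s d (transition c d z) * of_real ((cmod (deriv (transition c d) z))\<^sup>2))"

text \<open>Since \<open>d(a dz + cnj a d(cnj z)) = (dz (cnj a) - dzbar a) dz \<and> d(cnj z)\<close>, the condition below
  says that the 2-form given by \<open>s\<close> is the exterior derivative of the 1-form given by \<open>a\<close>.\<close>

definition exact_2_form :: "'a chart set \<Rightarrow> ('a chart \<Rightarrow> complex \<Rightarrow> complex) \<Rightarrow> bool" where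
  "exact_2_form \<A> s \<longleftrightarrow>
     (\<exists>a. real_1_form \<A> a \<and>
        (\<forall>c\<in>\<A>. \<forall>z\<in>chart_range c.
           \<i> / 2 * s c z = dz (\<lambda>w. cnj (a c w)) z - dzbar (a c) z))"

text \<open>The metric is the 1 by 1 matrix \<open>g c\<close>, so that \<open>det g = g\<close>. The condition that the Kaehler form
  \<open>\<omega> = (\<i>/2) g dz \<and> d(cnj z)\<close> be closed is empty in dimension one,
  so Hermitian and Kaehler metrics are the same thing.\<close>

definition kaehler_form :: "('a chart \<Rightarrow> complex \<Rightarrow> real) \<Rightarrow> 'a chart \<Rightarrow> complex \<Rightarrow> complex" where
  "kaehler_form g = (\<lambda>c z. of_real (g c z))"

definition kaehler_metric :: "'a chart set \<Rightarrow> ('a chart \<Rightarrow> complex \<Rightarrow> real) \<Rightarrow> bool" where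
  "kaehler_metric \<A> g \<longleftrightarrow>
     real_2_form \<A> (kaehler_form g) \<and> (\<forall>c\<in>\<A>. \<forall>z\<in>chart_range c. g c z > 0)"

definition ricci :: "('a chart \<Rightarrow> complex \<Rightarrow> real) \<Rightarrow> 'a chart \<Rightarrow> complex \<Rightarrow> complex" where
  "ricci g c z = - dz (dzbar (\<lambda>w. of_real (ln (g c w)))) z"

text \<open>The de Rham class \<open>\<pi> c\<^sub>1(X)\<close>, as a set of real 2-forms: those cohomologous to the Ricci form of
  a Hermitian metric. Any two Hermitian metrics \<open>h\<close>, \<open>h'\<close> give the same class, since their Ricci
  forms differ by the exact form \<open>(\<i>/2) \<partial>\<partial>bar log (h'/h)\<close>.\<close>

definition pi_c1 :: "'a chart set \<Rightarrow> ('a chart \<Rightarrow> complex \<Rightarrow> complex) set" where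
  "pi_c1 \<A> = {s. real_2_form \<A> s \<and>
     (\<exists>h. kaehler_metric \<A> h \<and> exact_2_form \<A> (\<lambda>c z. s c z - ricci h c z))}"

definition c1_positive :: "'a chart set \<Rightarrow> bool" where
  "c1_positive \<A> \<longleftrightarrow> (\<exists>g. kaehler_metric \<A> g \<and> kaehler_form g \<in> pi_c1 \<A>)"

definition compact_kaehler_curve :: "'a::{t2_space, second_countable_topology} chart set \<Rightarrow> bool" where
  "compact_kaehler_curve \<A> \<longleftrightarrow>
     complex_atlas \<A> \<and> compact (UNIV :: 'a set) \<and> (\<exists>g. kaehler_metric \<A> g)"

text \<open>Integration against \<open>\<omega> = g dx \<and> dy\<close> is integration against the Borel measure with density \<open>g\<close>
  with respect to Lebesgue measure in every chart. The transformation law of \<open>g\<close> makes the local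
  measures agree on overlaps, and as countably many charts cover the manifold, there is exactly
  one such measure.\<close>

definition volume_measure ::
    "'a::{t2_space, second_countable_topology} chart set \<Rightarrow> ('a chart \<Rightarrow> complex \<Rightarrow> real) \<Rightarrow> 'a measure" where
  "volume_measure \<A> g = (THE \<mu>. sets \<mu> = sets borel \<and>
     (\<forall>c\<in>\<A>. \<forall>B\<in>sets borel. B \<subseteq> chart_dom c \<longrightarrow>
        emeasure \<mu> B = (\<integral>\<^sup>+z\<in>coord c ` B. ennreal (g c z) \<partial>lborel)))"

text \<open>The function \<open>V\<^sup>z \<partial>\<^sub>z u\<close>; by the transformation laws its value at \<open>p\<close> does not depend on the chart.\<close>

definition vf_apply ::
    "'a chart set \<Rightarrow> ('a chart \<Rightarrow> complex \<Rightarrow> complex) \<Rightarrow> ('a \<Rightarrow> real) \<Rightarrow> 'a \<Rightarrow> complex" where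
  "vf_apply \<A> V u p =
     (let c = (SOME c. c \<in> \<A> \<and> p \<in> chart_dom c)
      in V c (coord c p) * dz (\<lambda>w. of_real (u (chart_inv c w))) (coord c p))"

definition ricci_potential ::
    "'a chart set \<Rightarrow> ('a chart \<Rightarrow> complex \<Rightarrow> real) \<Rightarrow> ('a \<Rightarrow> real) \<Rightarrow> bool" where
  "ricci_potential \<A> g u \<longleftrightarrow> smooth_function \<A> u \<and>
     (\<forall>c\<in>\<A>. \<forall>z\<in>chart_range c.
        of_real (g c z) - ricci g c z = dz (dzbar (\<lambda>w. of_real (u (chart_inv c w)))) z)"

definition Fut ::
    "'a::{t2_space, second_countable_topology} chart set \<Rightarrow> ('a chart \<Rightarrow> complex \<Rightarrow> real) \<Rightarrow>
     ('a \<Rightarrow> real) \<Rightarrow> ('a chart \<Rightarrow> complex \<Rightarrow> complex) \<Rightarrow> complex" where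
  "Fut \<A> g u V = - (\<integral>p. vf_apply \<A> V u p \<partial>(volume_measure \<A> g))"

text \<open>As the Futaki invariant is independent of the choice of \<open>g\<close> and \<open>u\<close>, its vanishing is stated
  for all choices.\<close>

definition futaki_invariant_vanishes ::
    "'a::{t2_space, second_countable_topology} chart set \<Rightarrow> bool" where
  "futaki_invariant_vanishes \<A> \<longleftrightarrow>
     (\<forall>g u V. kaehler_metric \<A> g \<longrightarrow> kaehler_form g \<in> pi_c1 \<A> \<longrightarrow> ricci_potential \<A> g u \<longrightarrow>
        holomorphic_vector_field \<A> V \<longrightarrow> Fut \<A> g u V = 0)"

end

theory Submission
  imports Defs
begin

text \<open>Write \<open>p = \<partial>\<^sub>z (u - log g)\<close> in each chart; the equation for the Ricci potential says
  \<open>\<partial>\<^bsub>zbar\<^esub> p = g\<close>. The function \<open>\<theta> = V p - V'\<close> satisfies \<open>\<partial>\<^bsub>zbar\<^esub> \<theta> = g V\<close>, hence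
  \<open>V u\<^sub>z g = \<theta> g + \<partial>\<^sub>z (V g) = \<partial>\<^bsub>zbar\<^esub> ((\<theta>\<^sup>2 - Q) / (2 V)) + \<partial>\<^sub>z (V g)\<close> for every locally constant
  function \<open>Q\<close>. The coefficients \<open>(\<theta>\<^sup>2 - Q) / (2 V)\<close> define a (1,0)-form, which extends smoothly across the zeros of \<open>V\<close>
  if \<open>Q = V'\<^sup>2\<close> there, and then the integral vanishes by Stokes' theorem. So it remains
  to see that \<open>V'\<^sup>2\<close> takes the same value at all zeros of \<open>V\<close> in one component of the surface.
  If \<open>p\<close> is a simple zero, normalized so that \<open>V' = 1\<close>, the orbit of the complex flow of \<open>V\<close> near
  \<open>p\<close> is parametrized injectively by \<open>exp s\<close>, and its closure is the component. At another zero \<open>q\<close> in the closure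
  the function \<open>h = exp (- s)\<close> is bounded and injective, so it extends to a local coordinate at \<open>q\<close> with \<open>V h' = - h\<close>,
  whence \<open>V' = - 1\<close> at \<open>q\<close>.\<close>

section \<open>Change of variables for holomorphic maps\<close>

text \<open>The coefficient \<open>p\<close> is not a (1,0)-form: because \<open>g\<close> is a
  density, \<open>p\<close> behaves like a connection coefficient and is shifted by
  \<open>\<phi>'' / \<phi>'\<close> under a change of chart \<open>\<phi>\<close>. The derivative
  \<open>V'\<close> is shifted by \<open>V\<close> times the same amount, which is why precisely the
  combination \<open>\<theta>\<close> is a function. As \<open>V\<close> is holomorphic, division by
  \<open>V\<close> commutes with the zbar-derivative, so \<open>\<theta> g\<close>, being
  \<open>\<theta>\<close> times its own zbar-derivative over \<open>V\<close>, integrates to half a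
  square; \<open>Q\<close> is the constant of integration. Since \<open>\<theta> = - V'\<close> at a
  zero, the choice of \<open>Q\<close> is forced there. So the problem is localized at the zeros of
  \<open>V\<close>, and the obstacle is global: zeros far apart have to be compared. The model is
  \<open>z d/dz\<close> on the sphere, with \<open>V' = 1\<close> at 0 and \<open>V' = - 1\<close>
  at infinity: only the squares agree. The complex flow reproduces this picture without classifying
  the surface. The function \<open>h\<close> is bounded near \<open>q\<close> because times with
  very negative real part belong to points near \<open>p\<close>. \<open>Q\<close> is only locally
  constant because the surface may be disconnected.\<close>

text \<open>The library proves the change of variables formula for \<open>real^'n\<close> only.\<close>

definition complex_of_vec :: "real^2 \<Rightarrow> complex" where
  "complex_of_vec v = Complex (v$1) (v$2)"

definition vec_of_complex :: "complex \<Rightarrow> real^2" where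
  "vec_of_complex z = vector [Re z, Im z]"

lemma vec_of_complex_inverse [simp]: "complex_of_vec (vec_of_complex z) = z"
  and complex_of_vec_inverse [simp]: "vec_of_complex (complex_of_vec v) = v"
  by (simp_all add: complex_of_vec_def vec_of_complex_def vec_eq_iff forall_2)

lemma bounded_linear_complex_of_vec: "bounded_linear complex_of_vec"
  by (intro linear_conv_bounded_linear[THEN iffD1] linearI)
     (simp_all add: complex_of_vec_def complex_eq_iff)

lemma bounded_linear_vec_of_complex: "bounded_linear vec_of_complex"
  by (intro linear_conv_bounded_linear[THEN iffD1] linearI)
     (simp_all add: vec_of_complex_def vec_eq_iff forall_2)

lemma borel_measurable_complex_of_vec [measurable]: "complex_of_vec \<in> borel_measurable borel"
  using bounded_linear_complex_of_vec linear_continuous_on borel_measurable_continuous_onI by blast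

lemma Basis_real_2: "(Basis :: (real^2) set) = {axis 1 1, axis 2 1}"
  by (auto simp: Basis_vec_def UNIV_2)

text \<open>Boxes correspond to boxes with the same side lengths, and Lebesgue measure is determined
  by its values on boxes.\<close>

lemma distr_lborel_complex_of_vec: "distr lborel borel complex_of_vec = lborel"
proof (rule lborel_eqI[symmetric])
  fix l u :: complex assume lu: "\<And>b. b \<in> Basis \<Longrightarrow> l \<bullet> b \<le> u \<bullet> b"
  have lu': "Re l \<le> Re u" "Im l \<le> Im u"
    using lu[of 1] lu[of \<i>] by (auto simp: Basis_complex_def)
  have "complex_of_vec -` box l u = box (vec_of_complex l) (vec_of_complex u)"
    by (auto simp: box_def complex_of_vec_def vec_of_complex_def Basis_complex_def Basis_real_2
        inner_axis)
  moreover have "emeasure lborel (box (vec_of_complex l) (vec_of_complex u)) =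
      ennreal (\<Prod>b\<in>Basis. (vec_of_complex u - vec_of_complex l) \<bullet> b)"
    by (rule emeasure_lborel_box)
       (use lu' in \<open>auto simp: Basis_real_2 vec_of_complex_def inner_axis\<close>)
  moreover have "(\<Prod>b\<in>Basis. (vec_of_complex u - vec_of_complex l) \<bullet> b) = (\<Prod>b\<in>Basis. (u - l) \<bullet> b)"
    by (simp add: Basis_real_2 Basis_complex_def axis_eq_axis inner_axis vec_of_complex_def)
  ultimately show "emeasure (distr lborel borel complex_of_vec) (box l u) = (\<Prod>b\<in>Basis. (u - l) \<bullet> b)"
    by (simp add: emeasure_distr)
qed simp

lemma vimage_complex_of_vec: "complex_of_vec -` B = vec_of_complex ` B"
proof (intro equalityI subsetI)
  fix x assume "x \<in> complex_of_vec -` B"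
  then have "complex_of_vec x \<in> B" by simp
  then show "x \<in> vec_of_complex ` B"
    by (rule rev_image_eqI) simp
qed auto

text \<open>Multiplication by \<open>d\<close> is a rotation combined with a dilation by
  \<open>cmod d\<close>; this is the real Jacobian of a holomorphic map.\<close>

lemma det_matrix_complex_mult:
  "det (matrix (\<lambda>v. vec_of_complex (d * complex_of_vec v))) = (cmod d)\<^sup>2"
  by (simp add: det_2 matrix_def vec_of_complex_def complex_of_vec_def axis_def cmod_power2)
     (simp add: power2_eq_square)

lemma borel_measurable_indicator_deriv:
  assumes "open S" "f holomorphic_on S" "B \<in> sets borel" "B \<subseteq> S"
  shows "(\<lambda>z. indicator B z * (cmod (deriv f z))\<^sup>2) \<in> borel_measurable borel"
proof -
  have "continuous_on B (\<lambda>z. (cmod (deriv f z))\<^sup>2)"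
    by (intro continuous_on_power continuous_on_norm
        continuous_on_subset[OF holomorphic_on_imp_continuous_on[OF holomorphic_deriv[OF assms(2,1)]] assms(4)])
  from borel_measurable_continuous_on_indicator[OF assms(3) this] show ?thesis
    unfolding real_scaleR_def .
qed

text \<open>Conjugation with the identification of the plane and \<open>real^2\<close> reduces this
  to the real change of variables formula, whose Jacobian is given by
  \<open>det_matrix_complex_mult\<close>.\<close>

lemma emeasure_lborel_holomorphic_image:
  assumes S: "open S" and f: "f holomorphic_on S" and inj: "inj_on f S"
    and B: "B \<in> sets borel" "B \<subseteq> S" and fB: "f ` B \<in> sets borel"
  shows "emeasure lborel (f ` B) = (\<integral>\<^sup>+z. indicator B z * ennreal ((cmod (deriv f z))\<^sup>2) \<partial>lborel)"
proof -
  let ?f = "\<lambda>v. vec_of_complex (f (complex_of_vec v))"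
  let ?f' = "\<lambda>v w. vec_of_complex (deriv f (complex_of_vec v) * complex_of_vec w)"
  let ?B = "complex_of_vec -` B"
  let ?J = "\<lambda>v. (cmod (deriv f (complex_of_vec v)))\<^sup>2"
  have B': "?B \<in> sets borel"
    using measurable_sets[OF borel_measurable_complex_of_vec B(1)] by simp
  have fB': "complex_of_vec -` (f ` B) \<in> sets borel"
    using measurable_sets[OF borel_measurable_complex_of_vec fB] by simp
  have im: "?f ` ?B = complex_of_vec -` (f ` B)"
    unfolding vimage_complex_of_vec by (auto simp: image_iff)
  have der: "(?f has_derivative ?f' v) (at v within ?B)" if "v \<in> ?B" for v
  proof -
    have "(f has_field_derivative deriv f (complex_of_vec v)) (at (complex_of_vec v))"
      using that B S f holomorphic_derivI by blast
    then have "(f has_derivative (*) (deriv f (complex_of_vec v))) (at (complex_of_vec v))"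
      by (simp add: has_field_derivative_def)
    then have "(f \<circ> complex_of_vec has_derivative (*) (deriv f (complex_of_vec v)) \<circ> complex_of_vec) (at v)"
      by (rule diff_chain_at[OF bounded_linear_imp_has_derivative[OF bounded_linear_complex_of_vec]])
    then have "(vec_of_complex \<circ> (f \<circ> complex_of_vec) has_derivative vec_of_complex \<circ> ((*) (deriv f (complex_of_vec v)) \<circ> complex_of_vec)) (at v)"
      by (rule diff_chain_at[OF _ bounded_linear_imp_has_derivative[OF bounded_linear_vec_of_complex]])
    then show ?thesis by (simp add: o_def has_derivative_at_withinI)
  qed
  have inj': "inj_on ?f ?B"
    using inj B(2) by (auto simp: inj_on_def) (metis complex_of_vec_inverse subsetD vec_of_complex_inverse)
  have key: "?f ` ?B \<in> lmeasurable \<and> measure lebesgue (?f ` ?B) = m \<longleftrightarrow> (?J has_integral m) ?B" for m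
    using has_measure_differentiable_image[of ?B ?f ?f' m] B' der inj'
    by (simp add: det_matrix_complex_mult)
  have J_meas [measurable]: "(\<lambda>z. indicator B z * (cmod (deriv f z))\<^sup>2) \<in> borel_measurable borel"
    by (rule borel_measurable_indicator_deriv[OF S f B])
  have eq1: "emeasure lborel (f ` B) = emeasure lborel (?f ` ?B)"
    by (subst distr_lborel_complex_of_vec[symmetric]) (use fB in \<open>simp add: emeasure_distr im\<close>)
  have J_meas' [measurable]: "(\<lambda>v. indicator ?B v * ?J v) \<in> borel_measurable borel"
  proof -
    have "indicator B (complex_of_vec v) = (indicator ?B v :: real)" for v
      by (simp add: indicator_def)
    then show ?thesis
      using measurable_compose[OF borel_measurable_complex_of_vec J_meas] by (simp only:)
  qed
  have "(\<integral>\<^sup>+z. indicator B z * ennreal ((cmod (deriv f z))\<^sup>2) \<partial>lborel) =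
      (\<integral>\<^sup>+z. ennreal (indicator B z * (cmod (deriv f z))\<^sup>2) \<partial>distr lborel borel complex_of_vec)"
    unfolding distr_lborel_complex_of_vec by (intro nn_integral_cong) (simp add: indicator_def)
  also have "\<dots> = (\<integral>\<^sup>+v. ennreal (indicator ?B v * ?J v) \<partial>lborel)"
    by (subst nn_integral_distr)
       (use J_meas in \<open>simp_all only: measurable_lborel1 measurable_lborel2 borel_measurable_complex_of_vec measurable_ennreal measurable_compose[OF _ measurable_ennreal]\<close>, auto simp: indicator_def intro!: nn_integral_cong)
  finally have eq2: "(\<integral>\<^sup>+z. indicator B z * ennreal ((cmod (deriv f z))\<^sup>2) \<partial>lborel) =
      (\<integral>\<^sup>+v. ennreal (indicator ?B v * ?J v) \<partial>lborel)" .
  have UNIV_iff: "((\<lambda>v. indicator ?B v * ?J v) has_integral m) UNIV \<longleftrightarrow> (?J has_integral m) ?B" for m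
    by (subst has_integral_restrict_UNIV[of ?B, symmetric])
       (auto simp: indicator_def intro!: has_integral_cong)
  show ?thesis
  proof (cases "?f ` ?B \<in> lmeasurable")
    case True
    then have "(?J has_integral measure lebesgue (?f ` ?B)) ?B" using key by blast
    then have "(\<integral>\<^sup>+v. ennreal (indicator ?B v * ?J v) \<partial>lborel) = ennreal (measure lebesgue (?f ` ?B))"
      unfolding UNIV_iff[symmetric] by (intro nn_integral_has_integral_lborel) simp_all
    also have "\<dots> = emeasure lebesgue (?f ` ?B)"
      using True by (simp add: emeasure_eq_measure2)
    also have "\<dots> = emeasure lborel (?f ` ?B)"
      using fB' im by simp
    finally show ?thesis using eq1 eq2 by simp
  \<comment> \<open>The equivalence \<open>key\<close> only speaks of images of finite measure. For
    an image of infinite measure it shows that the Jacobian is not integrable, so both sides are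
    infinite.\<close>
  next
    case False
    then have inf: "emeasure lborel (?f ` ?B) = \<infinity>"
      using fB' im by (auto simp: fmeasurable_def less_top[symmetric])
    have "(\<integral>\<^sup>+v. ennreal (indicator ?B v * ?J v) \<partial>lborel) = \<infinity>"
    proof (rule ccontr)
      assume "\<not> ?thesis"
      then have "(\<lambda>v. indicator ?B v * ?J v) integrable_on UNIV"
        by (intro nn_integral_integrable_on) (auto simp: less_top[symmetric])
      then show False using False key UNIV_iff unfolding integrable_on_def by blast
    qed
    with inf eq1 eq2 show ?thesis by simp
  qed
qed

text \<open>The inverse of an injective holomorphic map is holomorphic on the open image, so a
  direct image is a preimage under a continuous map.\<close>

lemma sets_borel_holomorphic_image:
  assumes S: "open S" and f: "f holomorphic_on S" and inj: "inj_on f S"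
    and B: "B \<in> sets borel" "B \<subseteq> S"
  shows "f ` B \<in> sets borel"
proof -
  obtain g where g: "g holomorphic_on (f ` S)" "\<And>z. z \<in> S \<Longrightarrow> g (f z) = z"
    using holomorphic_has_inverse[OF f S inj] by metis
  have T: "open (f ` S)" using open_mapping_thm3[OF f S inj] .
  have "f ` B = g -` B \<inter> f ` S"
    using g(2) B(2) by (auto simp: image_iff)
  moreover have "g -` B \<inter> f ` S \<in> sets borel"
  proof -
    have "g \<in> borel_measurable (restrict_space borel (f ` S))"
      using g(1) holomorphic_on_imp_continuous_on borel_measurable_continuous_on_restrict by blast
    from measurable_sets[OF this B(1)] show ?thesis
      using T by (subst (asm) sets_restrict_space_iff) (auto simp: space_restrict_space)
  qed
  ultimately show ?thesis by simp
qed

lemma nn_integral_holomorphic_image: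
  fixes h :: "complex \<Rightarrow> ennreal"
  assumes S: "open S" and f: "f holomorphic_on S" and inj: "inj_on f S"
    and B: "B \<in> sets borel" "B \<subseteq> S"
    and h: "(\<lambda>w. h w * indicator (f ` B) w) \<in> borel_measurable borel"
  shows "(\<integral>\<^sup>+w\<in>f ` B. h w \<partial>lborel) =
    (\<integral>\<^sup>+z\<in>B. h (f z) * ennreal ((cmod (deriv f z))\<^sup>2) \<partial>lborel)"
proof -
  define N where "N = density lborel (\<lambda>z. indicator B z * ennreal ((cmod (deriv f z))\<^sup>2))"
  \<comment> \<open>A push-forward needs a map that is measurable on the whole plane. The value 0
    off \<open>B\<close> is harmless, as \<open>N\<close> has no mass there.\<close>
  define f' where "f' = (\<lambda>z. if z \<in> B then f z else 0)"
  have [measurable]: "B \<in> sets borel" "f ` B \<in> sets borel"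
    using B sets_borel_holomorphic_image[OF S f inj B] by auto
  have "(\<lambda>z. indicator B z * (cmod (deriv f z))\<^sup>2) \<in> borel_measurable borel"
    by (rule borel_measurable_indicator_deriv[OF S f B])
  then have "(\<lambda>z. ennreal (indicator B z * (cmod (deriv f z))\<^sup>2)) \<in> borel_measurable borel"
    by measurable
  also have "(\<lambda>z. ennreal (indicator B z * (cmod (deriv f z))\<^sup>2)) =
      (\<lambda>z. indicator B z * ennreal ((cmod (deriv f z))\<^sup>2))"
    by (auto simp: indicator_def)
  finally have J [measurable]: "(\<lambda>z. indicator B z * ennreal ((cmod (deriv f z))\<^sup>2)) \<in> borel_measurable borel" .
  have "continuous_on B f"
    using f B(2) holomorphic_on_imp_continuous_on continuous_on_subset by blast
  then have f' [measurable]: "f' \<in> borel_measurable borel"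
    unfolding f'_def by (intro borel_measurable_continuous_on_if) auto
  have "distr N borel f' = density lborel (indicator (f ` B))"
  proof (rule measure_eqI)
    fix E assume "E \<in> sets (distr N borel f')"
    then have E [measurable]: "E \<in> sets borel" by simp
    have E': "f' -` E \<in> sets borel" using measurable_sets[OF f' E] by simp
    let ?D = "B \<inter> f' -` E"
    have D: "?D \<in> sets borel" "?D \<subseteq> S" using E' B by auto
    have "f ` ?D = f ` B \<inter> E" by (auto simp: f'_def)
    then have "emeasure lborel (f ` B \<inter> E) = (\<integral>\<^sup>+z. indicator ?D z * ennreal ((cmod (deriv f z))\<^sup>2) \<partial>lborel)"
      using emeasure_lborel_holomorphic_image[OF S f inj D] sets_borel_holomorphic_image[OF S f inj D] by simp
    also have "\<dots> = emeasure N (f' -` E)"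
      unfolding N_def using E' J
      by (subst emeasure_density) (simp_all, auto intro!: nn_integral_cong simp: indicator_def)
    also have "\<dots> = emeasure (distr N borel f') E"
      by (subst emeasure_distr) (auto simp: N_def)
    finally show "emeasure (distr N borel f') E = emeasure (density lborel (indicator (f ` B))) E"
      by (subst emeasure_density) (auto simp: indicator_inter_arith[symmetric])
  qed simp
  then have "(\<integral>\<^sup>+w. h w * indicator (f ` B) w \<partial>distr N borel f') =
     (\<integral>\<^sup>+w. h w * indicator (f ` B) w \<partial>density lborel (indicator (f ` B)))" by simp
  also have "\<dots> = (\<integral>\<^sup>+w\<in>f ` B. h w \<partial>lborel)"
    using h by (subst nn_integral_density) (auto intro!: nn_integral_cong simp: indicator_def)
  also have "(\<integral>\<^sup>+w. h w * indicator (f ` B) w \<partial>distr N borel f') = (\<integral>\<^sup>+z. h (f' z) * indicator (f ` B) (f' z) \<partial>N)"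
    using h by (subst nn_integral_distr) (auto simp: N_def)
  also have "\<dots> = (\<integral>\<^sup>+z\<in>B. h (f z) * ennreal ((cmod (deriv f z))\<^sup>2) \<partial>lborel)"
    unfolding N_def using measurable_compose[OF f' h]
    by (subst nn_integral_density)
       (simp_all add: J, auto intro!: nn_integral_cong simp: indicator_def f'_def mult.commute)
  finally show ?thesis by simp
qed

section \<open>Wirtinger derivatives\<close>

text \<open>Encoding the pair of derivatives as one real derivative lets sums, products and
  compositions inherit their rules from \<open>has_derivative\<close>.\<close>

definition has_wirtinger :: "(complex \<Rightarrow> complex) \<Rightarrow> complex \<Rightarrow> complex \<Rightarrow> complex \<Rightarrow> bool" where
  "has_wirtinger f a b z \<longleftrightarrow> (f has_derivative (\<lambda>h. a * h + b * cnj h)) (at z)"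

definition C1_on :: "(complex \<Rightarrow> complex) \<Rightarrow> complex set \<Rightarrow> bool" where
  "C1_on f S \<longleftrightarrow> (\<forall>z\<in>S. f differentiable at z) \<and> continuous_on S (dz f) \<and> continuous_on S (dzbar f)"

lemma has_wirtinger_dz: "has_wirtinger f a b z \<Longrightarrow> dz f z = a"
  and has_wirtinger_dzbar: "has_wirtinger f a b z \<Longrightarrow> dzbar f z = b"
  unfolding has_wirtinger_def dz_def dzbar_def
  by (drule frechet_derivative_at, erule subst, simp add: algebra_simps)+

lemma has_wirtinger_differentiable: "has_wirtinger f a b z \<Longrightarrow> f differentiable at z"
  unfolding has_wirtinger_def differentiable_def by blast

text \<open>Every real-linear map of the plane has the form \<open>a * h + b * cnj h\<close>; its
  values at 1 and \<open>\<i>\<close> determine \<open>a\<close> and \<open>b\<close>.\<close>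

lemma differentiable_has_wirtinger:
  assumes "f differentiable at z"
  shows "has_wirtinger f (dz f z) (dzbar f z) z"
proof -
  let ?D = "frechet_derivative f (at z)"
  have D: "(f has_derivative ?D) (at z)" using assms frechet_derivative_works by blast
  then interpret D: bounded_linear ?D by (rule has_derivative_bounded_linear)
  have "?D h = dz f z * h + dzbar f z * cnj h" for h
  proof -
    have "?D h = ?D (Re h *\<^sub>R 1 + Im h *\<^sub>R \<i>)"
      by (rule arg_cong[of _ _ ?D]) (simp add: complex_eq_iff)
    also have "\<dots> = of_real (Re h) * ?D 1 + of_real (Im h) * ?D \<i>"
      by (simp only: D.add D.scaleR) (simp only: scaleR_conv_of_real)
    also have "\<dots> = dz f z * h + dzbar f z * cnj h"
    proof -
      have "of_real (Re h) * p + of_real (Im h) * q = (p - \<i> * q) / 2 * h + (p + \<i> * q) / 2 * cnj h" for p q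
        by (simp add: complex_eq_iff field_simps)
      then show ?thesis unfolding dz_def dzbar_def .
    qed
    finally show ?thesis .
  qed
  then have "?D = (\<lambda>h. dz f z * h + dzbar f z * cnj h)" by blast
  with D show ?thesis unfolding has_wirtinger_def by simp
qed

lemma has_wirtinger_transform:
  assumes "has_wirtinger f a b z" "open S" "z \<in> S" "\<And>w. w \<in> S \<Longrightarrow> f w = g w"
  shows "has_wirtinger g a b z"
  using assms has_derivative_transform_within_open unfolding has_wirtinger_def by blast

lemma has_wirtinger_const: "has_wirtinger (\<lambda>_. c) 0 0 z"
  by (simp add: has_wirtinger_def)

lemma has_wirtinger_add:
  "has_wirtinger f a b z \<Longrightarrow> has_wirtinger g c d z \<Longrightarrow> has_wirtinger (\<lambda>w. f w + g w) (a + c) (b + d) z"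
  unfolding has_wirtinger_def by (drule (1) has_derivative_add) (simp add: algebra_simps)

lemma has_wirtinger_diff:
  "has_wirtinger f a b z \<Longrightarrow> has_wirtinger g c d z \<Longrightarrow> has_wirtinger (\<lambda>w. f w - g w) (a - c) (b - d) z"
  unfolding has_wirtinger_def by (drule (1) has_derivative_diff) (simp add: algebra_simps)

lemma has_wirtinger_mult:
  "has_wirtinger f a b z \<Longrightarrow> has_wirtinger g c d z \<Longrightarrow>
    has_wirtinger (\<lambda>w. f w * g w) (a * g z + f z * c) (b * g z + f z * d) z"
  unfolding has_wirtinger_def by (drule (1) has_derivative_mult) (simp add: algebra_simps)

lemma has_wirtinger_cnj: "has_wirtinger f a b z \<Longrightarrow> has_wirtinger (\<lambda>w. cnj (f w)) (cnj b) (cnj a) z"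
  unfolding has_wirtinger_def by (drule has_derivative_cnj) (simp add: algebra_simps)

lemma has_wirtinger_holomorphic:
  "(f has_field_derivative f') (at z) \<Longrightarrow> has_wirtinger f f' 0 z"
  by (simp add: has_wirtinger_def has_field_derivative_def)

lemma has_wirtinger_compose_holomorphic:
  assumes "has_wirtinger f a b z" "(F has_field_derivative F') (at (f z))"
  shows "has_wirtinger (\<lambda>w. F (f w)) (F' * a) (F' * b) z"
  using diff_chain_at[of f "\<lambda>h. a * h + b * cnj h" z F "(*) F'"] assms
  unfolding has_wirtinger_def has_field_derivative_def by (simp add: o_def algebra_simps)

lemma has_wirtinger_holomorphic_compose:
  assumes "(p has_field_derivative p') (at z)" "has_wirtinger f a b (p z)"
  shows "has_wirtinger (\<lambda>w. f (p w)) (a * p') (b * cnj p') z"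
  using diff_chain_at[of p "(*) p'" z f "\<lambda>h. a * h + b * cnj h"] assms
  unfolding has_wirtinger_def has_field_derivative_def by (simp add: o_def algebra_simps)

lemma has_wirtinger_divide:
  assumes "has_wirtinger f a b z" "has_wirtinger g c d z" "g z \<noteq> 0"
  shows "has_wirtinger (\<lambda>w. f w / g w) ((a * g z - f z * c) / (g z)\<^sup>2) ((b * g z - f z * d) / (g z)\<^sup>2) z"
proof -
  have "has_wirtinger (\<lambda>w. inverse (g w)) (- inverse ((g z)\<^sup>2) * c) (- inverse ((g z)\<^sup>2) * d) z"
    by (rule has_wirtinger_compose_holomorphic[OF assms(2)])
       (use assms(3) in \<open>auto intro!: derivative_eq_intros simp: power2_eq_square\<close>)
  from has_wirtinger_mult[OF assms(1) this] assms(3) show ?thesis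
    by (simp add: divide_inverse algebra_simps power2_eq_square)
qed

lemma dz_cong: "open S \<Longrightarrow> z \<in> S \<Longrightarrow> (\<And>w. w \<in> S \<Longrightarrow> f w = g w) \<Longrightarrow> dz f z = dz g z"
  and dzbar_cong: "open S \<Longrightarrow> z \<in> S \<Longrightarrow> (\<And>w. w \<in> S \<Longrightarrow> f w = g w) \<Longrightarrow> dzbar f z = dzbar g z"
proof -
  have "frechet_derivative f (at z) = frechet_derivative g (at z)"
    if "open S" "z \<in> S" "\<And>w. w \<in> S \<Longrightarrow> f w = g w"
  proof -
    have "(f has_derivative D) (at z) \<longleftrightarrow> (g has_derivative D) (at z)" for D
      using has_derivative_transform_within_open[OF _ that(1,2)] that(3) by metis
    then show ?thesis unfolding frechet_derivative_def by simp
  qed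
  then show "open S \<Longrightarrow> z \<in> S \<Longrightarrow> (\<And>w. w \<in> S \<Longrightarrow> f w = g w) \<Longrightarrow> dz f z = dz g z"
    "open S \<Longrightarrow> z \<in> S \<Longrightarrow> (\<And>w. w \<in> S \<Longrightarrow> f w = g w) \<Longrightarrow> dzbar f z = dzbar g z"
    by (simp_all add: dz_def dzbar_def)
qed

lemma C1_onI:
  assumes "\<And>z. z \<in> S \<Longrightarrow> has_wirtinger f (a z) (b z) z" "continuous_on S a" "continuous_on S b"
  shows "C1_on f S"
proof -
  have "continuous_on S (dz f)"
    by (rule continuous_on_eq[OF assms(2)]) (use has_wirtinger_dz[OF assms(1)] in simp)
  moreover have "continuous_on S (dzbar f)"
    by (rule continuous_on_eq[OF assms(3)]) (use has_wirtinger_dzbar[OF assms(1)] in simp)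
  ultimately show ?thesis
    unfolding C1_on_def by (simp add: has_wirtinger_differentiable[OF assms(1)])
qed

lemma C1_on_has_wirtinger: "C1_on f S \<Longrightarrow> z \<in> S \<Longrightarrow> has_wirtinger f (dz f z) (dzbar f z) z"
  by (simp add: C1_on_def differentiable_has_wirtinger)

lemma C1_on_continuous_dz: "C1_on f S \<Longrightarrow> continuous_on S (dz f)"
  and C1_on_continuous_dzbar: "C1_on f S \<Longrightarrow> continuous_on S (dzbar f)"
  by (simp_all add: C1_on_def)

lemma C1_on_continuous: "C1_on f S \<Longrightarrow> continuous_on S f"
  by (meson C1_on_def continuous_at_imp_continuous_on differentiable_imp_continuous_within)

lemma C1_on_subset: "C1_on f S \<Longrightarrow> T \<subseteq> S \<Longrightarrow> C1_on f T"
  by (auto simp: C1_on_def intro: continuous_on_subset)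

lemma C1_on_transform:
  assumes "C1_on f S" "open S" "\<And>w. w \<in> S \<Longrightarrow> f w = g w"
  shows "C1_on g S"
proof (rule C1_onI)
  show "has_wirtinger g (dz f z) (dzbar f z) z" if "z \<in> S" for z
    by (rule has_wirtinger_transform[OF C1_on_has_wirtinger[OF assms(1) that] assms(2) that assms(3)])
qed (use assms(1) C1_on_def in auto)

lemma C1_on_locally:
  assumes "\<And>z. z \<in> S \<Longrightarrow> \<exists>T. open T \<and> z \<in> T \<and> C1_on f T"
  shows "C1_on f S"
proof -
  have "isCont (dz f) z \<and> isCont (dzbar f) z \<and> f differentiable at z" if "z \<in> S" for z
  proof -
    from assms[OF that] obtain T where T: "open T" "z \<in> T" "C1_on f T" by blast
    then show ?thesis by (simp add: C1_on_def continuous_on_eq_continuous_at)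
  qed
  then show ?thesis unfolding C1_on_def by (simp add: continuous_at_imp_continuous_on)
qed

lemma C1_on_const: "C1_on (\<lambda>_. c) S"
  by (rule C1_onI[OF has_wirtinger_const]) auto

lemma C1_on_add:
  assumes "C1_on f S" "C1_on g S"
  shows "C1_on (\<lambda>w. f w + g w) S"
proof -
  note [continuous_intros] = C1_on_continuous_dz[OF assms(1)] C1_on_continuous_dzbar[OF assms(1)] C1_on_continuous[OF assms(1)]
    C1_on_continuous_dz[OF assms(2)] C1_on_continuous_dzbar[OF assms(2)] C1_on_continuous[OF assms(2)]
  show ?thesis
    by (rule C1_onI[OF has_wirtinger_add[OF C1_on_has_wirtinger[OF assms(1)] C1_on_has_wirtinger[OF assms(2)]]]; (assumption | intro continuous_intros)?)
qed

lemma C1_on_diff: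
  assumes "C1_on f S" "C1_on g S"
  shows "C1_on (\<lambda>w. f w - g w) S"
proof -
  note [continuous_intros] = C1_on_continuous_dz[OF assms(1)] C1_on_continuous_dzbar[OF assms(1)] C1_on_continuous[OF assms(1)]
    C1_on_continuous_dz[OF assms(2)] C1_on_continuous_dzbar[OF assms(2)] C1_on_continuous[OF assms(2)]
  show ?thesis
    by (rule C1_onI[OF has_wirtinger_diff[OF C1_on_has_wirtinger[OF assms(1)] C1_on_has_wirtinger[OF assms(2)]]]; (assumption | intro continuous_intros)?)
qed

lemma C1_on_mult:
  assumes "C1_on f S" "C1_on g S"
  shows "C1_on (\<lambda>w. f w * g w) S"
proof -
  note [continuous_intros] = C1_on_continuous_dz[OF assms(1)] C1_on_continuous_dzbar[OF assms(1)] C1_on_continuous[OF assms(1)]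
    C1_on_continuous_dz[OF assms(2)] C1_on_continuous_dzbar[OF assms(2)] C1_on_continuous[OF assms(2)]
  show ?thesis
    by (rule C1_onI[OF has_wirtinger_mult[OF C1_on_has_wirtinger[OF assms(1)] C1_on_has_wirtinger[OF assms(2)]]]; (assumption | intro continuous_intros)?)
qed

lemma C1_on_divide:
  assumes "C1_on f S" "C1_on g S" "\<And>z. z \<in> S \<Longrightarrow> g z \<noteq> 0"
  shows "C1_on (\<lambda>w. f w / g w) S"
proof -
  note [continuous_intros] = C1_on_continuous_dz[OF assms(1)] C1_on_continuous_dzbar[OF assms(1)] C1_on_continuous[OF assms(1)]
    C1_on_continuous_dz[OF assms(2)] C1_on_continuous_dzbar[OF assms(2)] C1_on_continuous[OF assms(2)]
  show ?thesis
    by (rule C1_onI[OF has_wirtinger_divide[OF C1_on_has_wirtinger[OF assms(1)] C1_on_has_wirtinger[OF assms(2)]]]; (assumption | intro continuous_intros)?; simp add: assms(3))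
qed

lemma C1_on_cnj:
  assumes "C1_on f S"
  shows "C1_on (\<lambda>w. cnj (f w)) S"
proof -
  note [continuous_intros] = C1_on_continuous_dz[OF assms(1)] C1_on_continuous_dzbar[OF assms(1)] C1_on_continuous[OF assms(1)]
  show ?thesis
    by (rule C1_onI[OF has_wirtinger_cnj[OF C1_on_has_wirtinger[OF assms(1)]]]; (assumption | intro continuous_intros)?)
qed

lemma C1_on_holomorphic:
  assumes "f holomorphic_on S" "open S" shows "C1_on f S"
  by (rule C1_onI[OF has_wirtinger_holomorphic[OF holomorphic_derivI[OF assms]]])
     (assumption, rule holomorphic_on_imp_continuous_on[OF holomorphic_deriv[OF assms]], rule continuous_on_const)

lemma C1_on_sum: "(\<And>i. i \<in> I \<Longrightarrow> C1_on (f i) S) \<Longrightarrow> C1_on (\<lambda>w. \<Sum>i\<in>I. f i w) S"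
proof (induction I rule: infinite_finite_induct)
  case (insert i I)
  then have "C1_on (\<lambda>w. f i w + (\<Sum>i\<in>I. f i w)) S" by (intro C1_on_add) simp_all
  with insert.hyps show ?case by simp
qed (simp_all add: C1_on_const)

lemma C1_on_holomorphic_compose:
  assumes "C1_on f T" "p holomorphic_on S" "open S" "p ` S \<subseteq> T"
  shows "C1_on (\<lambda>w. f (p w)) S"
proof (rule C1_onI)
  show "has_wirtinger (\<lambda>w. f (p w)) (dz f (p z) * deriv p z) (dzbar f (p z) * cnj (deriv p z)) z" if "z \<in> S" for z
    using that assms(4)
    by (intro has_wirtinger_holomorphic_compose holomorphic_derivI[OF assms(2,3)] C1_on_has_wirtinger[OF assms(1)]) auto
  have p: "continuous_on S p" "continuous_on S (deriv p)"
    using assms(2) holomorphic_deriv[OF assms(2,3)] by (simp_all add: holomorphic_on_imp_continuous_on)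
  show "continuous_on S (\<lambda>z. dz f (p z) * deriv p z)"
    by (intro continuous_on_mult p continuous_on_compose2[OF C1_on_continuous_dz[OF assms(1)] p(1) assms(4)])
  show "continuous_on S (\<lambda>z. dzbar f (p z) * cnj (deriv p z))"
    by (intro continuous_on_mult continuous_on_cnj p continuous_on_compose2[OF C1_on_continuous_dzbar[OF assms(1)] p(1) assms(4)])
qed

lemma C1_on_frechet:
  assumes "open S" "f differentiable_on S" "\<And>v. continuous_on S (\<lambda>x. frechet_derivative f (at x) v)"
  shows "C1_on f S"
proof -
  have "continuous_on S (dz f)" "continuous_on S (dzbar f)"
    unfolding dz_def[abs_def] dzbar_def[abs_def]
    by (rule continuous_on_divide, (rule continuous_on_diff continuous_on_add), rule assms(3),
        rule continuous_on_mult[OF continuous_on_const assms(3)], rule continuous_on_const, simp)+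
  moreover have "f differentiable at z" if "z \<in> S" for z
    using assms(2) that at_within_open[OF that assms(1)] unfolding differentiable_on_def by metis
  ultimately show ?thesis
    unfolding C1_on_def by blast
qed

lemma Ck_on_Suc_0: "open S \<Longrightarrow> Ck_on (Suc 0) f S \<Longrightarrow> C1_on f S"
  by (auto intro: C1_on_frechet)

lemma Ck_on_2_dz:
  assumes "open S" "Ck_on (Suc (Suc 0)) f S" shows "C1_on f S" "C1_on (dz f) S"
proof -
  have "C1_on (\<lambda>x. frechet_derivative f (at x) v) S" for v
    using assms by (intro Ck_on_Suc_0) simp_all
  then show "C1_on (dz f) S"
    unfolding dz_def[abs_def]
    by (intro C1_on_divide[OF C1_on_diff[OF _ C1_on_mult[OF C1_on_const]] C1_on_const]) simp_all
  have "continuous_on S (\<lambda>x. frechet_derivative f (at x) v)" for v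
    using assms(2) by (simp add: differentiable_imp_continuous_on)
  then show "C1_on f S" using assms by (intro C1_on_frechet) simp_all
qed

lemma smooth_on_C1_on: "open S \<Longrightarrow> smooth_on f S \<Longrightarrow> C1_on f S"
  and smooth_on_C1_on_dz: "open S \<Longrightarrow> smooth_on f S \<Longrightarrow> C1_on (dz f) S"
  unfolding smooth_on_def using Ck_on_2_dz by blast+

lemma of_real_has_derivative:
  assumes "open S" "f differentiable_on S" "z \<in> S"
  shows "((\<lambda>w. complex_of_real (f w)) has_derivative (\<lambda>v. of_real (frechet_derivative f (at z) v))) (at z)"
proof -
  have "f differentiable at z"
    using assms(2,3) at_within_open[OF assms(3,1)] unfolding differentiable_on_def by metis
  then show ?thesis using frechet_derivative_works has_derivative_of_real by blast
qed

lemma C1_on_of_real: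
  assumes "open S" "f differentiable_on S" "\<And>v. continuous_on S (\<lambda>x. frechet_derivative f (at x) v)"
  shows "C1_on (\<lambda>w. complex_of_real (f w)) S"
proof (rule C1_on_frechet[OF assms(1)])
  note der = of_real_has_derivative[OF assms(1,2)]
  then show "(\<lambda>w. complex_of_real (f w)) differentiable_on S"
    unfolding differentiable_on_def differentiable_def using has_derivative_at_withinI by blast
  show "continuous_on S (\<lambda>x. frechet_derivative (\<lambda>w. complex_of_real (f w)) (at x) v)" for v
  proof (rule continuous_on_eq[OF continuous_on_of_real[OF assms(3)]])
    show "complex_of_real (frechet_derivative f (at x) v) = frechet_derivative (\<lambda>w. complex_of_real (f w)) (at x) v"
      if "x \<in> S" for x using fun_cong[OF frechet_derivative_at[OF der[OF that]]] .
  qed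
qed

text \<open>Smoothness of a real function is stated with real-valued Frechet derivatives, while
  \<open>dz\<close> acts on complex-valued functions. The real derivatives are therefore embedded
  into the complex numbers first and then combined into \<open>dz\<close>.\<close>

lemma smooth_on_of_real:
  assumes "open S" "smooth_on f S"
  shows "C1_on (\<lambda>w. complex_of_real (f w)) S" "C1_on (dz (\<lambda>w. complex_of_real (f w))) S"
proof -
  let ?D = "\<lambda>v x. frechet_derivative f (at x) v"
  have f: "f differentiable_on S" and D: "?D v differentiable_on S"
    "\<And>w. continuous_on S (\<lambda>x. frechet_derivative (?D v) (at x) w)" for v
    using assms(2)[unfolded smooth_on_def, THEN spec, of "Suc (Suc 0)"] by auto
  show "C1_on (\<lambda>w. complex_of_real (f w)) S"
    using assms(1) f D(1) by (intro C1_on_of_real differentiable_imp_continuous_on)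
  have R: "C1_on (\<lambda>w. complex_of_real (?D v w)) S" for v
    by (rule C1_on_of_real[OF assms(1) D])
  have "C1_on (\<lambda>w. (of_real (?D 1 w) - \<i> * of_real (?D \<i> w)) / 2) S"
    by (rule C1_on_divide, rule C1_on_diff, rule R, rule C1_on_mult, rule C1_on_const, rule R, rule C1_on_const) simp
  moreover have "(of_real (?D 1 z) - \<i> * of_real (?D \<i> z)) / 2 = dz (\<lambda>w. complex_of_real (f w)) z" if "z \<in> S" for z
    by (simp add: dz_def fun_cong[OF frechet_derivative_at[OF of_real_has_derivative[OF assms(1) f that]], symmetric])
  ultimately show "C1_on (dz (\<lambda>w. complex_of_real (f w))) S"
    by (rule C1_on_transform[OF _ assms(1)])
qed

section \<open>Charts and the volume measure\<close>

locale surface_atlas =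
  fixes A :: "'a::{t2_space, second_countable_topology} chart set"
  assumes atlas: "complex_atlas A"
begin

lemma chart_homeomorphism:
  "c \<in> A \<Longrightarrow> homeomorphism (chart_dom c) (chart_range c) (coord c) (chart_inv c)"
  and open_chart_dom: "c \<in> A \<Longrightarrow> open (chart_dom c)"
  and open_chart_range: "c \<in> A \<Longrightarrow> open (chart_range c)"
  and transition_holomorphic: "c \<in> A \<Longrightarrow> d \<in> A \<Longrightarrow> transition c d holomorphic_on overlap c d"
  using atlas unfolding complex_atlas_def by blast+

lemma ex_chart: obtains c where "c \<in> A" "p \<in> chart_dom c"
  using atlas unfolding complex_atlas_def by blast

lemma chart_inv_coord: "c \<in> A \<Longrightarrow> p \<in> chart_dom c \<Longrightarrow> chart_inv c (coord c p) = p"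
  and coord_chart_inv: "c \<in> A \<Longrightarrow> z \<in> chart_range c \<Longrightarrow> coord c (chart_inv c z) = z"
  and chart_inv_in_dom: "c \<in> A \<Longrightarrow> z \<in> chart_range c \<Longrightarrow> chart_inv c z \<in> chart_dom c"
  and continuous_on_coord: "c \<in> A \<Longrightarrow> continuous_on (chart_dom c) (coord c)"
  and continuous_on_chart_inv: "c \<in> A \<Longrightarrow> continuous_on (chart_range c) (chart_inv c)"
  using chart_homeomorphism unfolding homeomorphism_def by blast+

lemma coord_in_range: "p \<in> chart_dom c \<Longrightarrow> coord c p \<in> chart_range c"
  by (simp add: chart_range_def)

lemma isCont_chart_inv: "c \<in> A \<Longrightarrow> z \<in> chart_range c \<Longrightarrow> isCont (chart_inv c) z"
  using continuous_on_chart_inv open_chart_range continuous_on_eq_continuous_at by blast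

lemma overlap_iff: "c \<in> A \<Longrightarrow> z \<in> overlap c d \<longleftrightarrow> z \<in> chart_range c \<and> chart_inv c z \<in> chart_dom d"
  unfolding overlap_def chart_range_def by (auto simp: chart_inv_coord)

lemma coord_in_overlap: "p \<in> chart_dom c \<Longrightarrow> p \<in> chart_dom d \<Longrightarrow> coord c p \<in> overlap c d"
  unfolding overlap_def by blast

lemma coord_image_eq:
  assumes c: "c \<in> A" and U: "U \<subseteq> chart_dom c" shows "coord c ` U = chart_inv c -` U \<inter> chart_range c"
proof (intro equalityI subsetI)
  fix z assume "z \<in> coord c ` U"
  then obtain p where "p \<in> U" "z = coord c p" by blast
  moreover from this have "p \<in> chart_dom c" using U by blast
  ultimately show "z \<in> chart_inv c -` U \<inter> chart_range c"
    using chart_inv_coord[OF c] coord_in_range by simp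
next
  fix z assume "z \<in> chart_inv c -` U \<inter> chart_range c"
  then have "coord c (chart_inv c z) = z" "chart_inv c z \<in> U" using coord_chart_inv[OF c] by simp_all
  then show "z \<in> coord c ` U" by (rule image_eqI[OF sym])
qed

lemma chart_inv_image_eq:
  assumes c: "c \<in> A" and U: "U \<subseteq> chart_range c" shows "chart_inv c ` U = coord c -` U \<inter> chart_dom c"
proof (intro equalityI subsetI)
  fix p assume "p \<in> chart_inv c ` U"
  then obtain z where "z \<in> U" "p = chart_inv c z" by blast
  moreover from this have "z \<in> chart_range c" using U by blast
  ultimately show "p \<in> coord c -` U \<inter> chart_dom c"
    using coord_chart_inv[OF c] chart_inv_in_dom[OF c] by simp
next
  fix p assume "p \<in> coord c -` U \<inter> chart_dom c"
  then have "chart_inv c (coord c p) = p" "coord c p \<in> U" using chart_inv_coord[OF c] by simp_all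
  then show "p \<in> chart_inv c ` U" by (rule image_eqI[OF sym])
qed

lemma open_chart_image:
  assumes "c \<in> A" "open U" "U \<subseteq> chart_dom c" shows "open (coord c ` U)"
  unfolding coord_image_eq[OF assms(1,3)]
  using continuous_on_chart_inv[OF assms(1)] assms(2) open_chart_range[OF assms(1)]
  by (simp add: continuous_on_open_vimage)

lemma open_chart_inv_image:
  assumes "c \<in> A" "open U" "U \<subseteq> chart_range c" shows "open (chart_inv c ` U)"
  unfolding chart_inv_image_eq[OF assms(1,3)]
  using continuous_on_coord[OF assms(1)] assms(2) open_chart_dom[OF assms(1)]
  by (simp add: continuous_on_open_vimage)

lemma open_overlap: "c \<in> A \<Longrightarrow> d \<in> A \<Longrightarrow> open (overlap c d)"
  unfolding overlap_def by (intro open_chart_image open_Int open_chart_dom) auto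

lemma overlap_subset: "overlap c d \<subseteq> chart_range c"
  unfolding overlap_def chart_range_def by blast

lemma transition_coord: "c \<in> A \<Longrightarrow> p \<in> chart_dom c \<Longrightarrow> transition c d (coord c p) = coord d p"
  by (simp add: transition_def chart_inv_coord)

lemma chart_inv_transition:
  assumes "c \<in> A" "d \<in> A" "z \<in> overlap c d" shows "chart_inv d (transition c d z) = chart_inv c z"
  using assms overlap_iff[OF assms(1)] by (simp add: transition_def chart_inv_coord)

lemma transition_in_overlap:
  assumes "c \<in> A" "d \<in> A" "z \<in> overlap c d" shows "transition c d z \<in> overlap d c"
  using assms overlap_iff[OF assms(1)] unfolding transition_def o_def
  by (intro coord_in_overlap chart_inv_in_dom) auto

lemma transition_inverse:
  assumes "c \<in> A" "d \<in> A" "z \<in> overlap c d" shows "transition d c (transition c d z) = z"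
  using assms overlap_iff[OF assms(1)] chart_inv_transition[OF assms] coord_chart_inv[OF assms(1)]
  unfolding transition_def[of d c] by simp

lemma transition_inj: "c \<in> A \<Longrightarrow> d \<in> A \<Longrightarrow> inj_on (transition c d) (overlap c d)"
  using transition_inverse by (metis inj_onI)

lemma transition_derivative:
  "c \<in> A \<Longrightarrow> d \<in> A \<Longrightarrow> z \<in> overlap c d \<Longrightarrow>
    (transition c d has_field_derivative deriv (transition c d) z) (at z)"
  by (rule holomorphic_derivI[OF transition_holomorphic open_overlap])

lemma transition_deriv_nonzero:
  "c \<in> A \<Longrightarrow> d \<in> A \<Longrightarrow> z \<in> overlap c d \<Longrightarrow> deriv (transition c d) z \<noteq> 0"
  by (rule holomorphic_injective_imp_regular[OF transition_holomorphic open_overlap transition_inj])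

lemma transition_image: "c \<in> A \<Longrightarrow> d \<in> A \<Longrightarrow> B \<subseteq> chart_dom c \<inter> chart_dom d \<Longrightarrow> transition c d ` coord c ` B = coord d ` B"
  by (force simp: transition_coord image_iff)

lemma measurable_coord_image:
  assumes "c \<in> A" "B \<in> sets borel" "B \<subseteq> chart_dom c" shows "coord c ` B \<in> sets borel"
proof -
  have "coord c ` B = chart_inv c -` B \<inter> chart_range c"
    by (rule coord_image_eq[OF assms(1,3)])
  moreover have "chart_inv c \<in> borel_measurable (restrict_space borel (chart_range c))"
    by (rule borel_measurable_continuous_on_restrict[OF continuous_on_chart_inv[OF assms(1)]])
  from measurable_sets[OF this assms(2)]
  have "chart_inv c -` B \<inter> chart_range c \<in> sets borel"
    using open_chart_range[OF assms(1)]
    by (subst (asm) sets_restrict_space_iff) (simp_all add: space_restrict_space)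
  ultimately show ?thesis by simp
qed

text \<open>Outside the range of the chart, \<^const>\<open>chart_inv\<close> is constant.\<close>

lemma measurable_chart_inv:
  assumes "c \<in> A" shows "chart_inv c \<in> borel_measurable borel"
proof -
  define k where "k = (SOME x::'a. False)"
  have "chart_inv c = (\<lambda>z. if z \<in> chart_range c then chart_inv c z else k)"
    by (auto simp: chart_inv_def inv_into_def chart_range_def k_def image_iff fun_eq_iff intro!: arg_cong[of _ _ Eps])
  also have "\<dots> \<in> borel_measurable borel"
    using continuous_on_chart_inv[OF assms] open_chart_range[OF assms]
    by (intro borel_measurable_continuous_on_if) auto
  finally show ?thesis .
qed

end

locale compact_surface = surface_atlas A for A :: "'a::{t2_space, second_countable_topology} chart set" +
  assumes compact_UNIV: "compact (UNIV :: 'a set)"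

locale metric_surface = compact_surface A for A :: "'a::{t2_space, second_countable_topology} chart set" +
  fixes g :: "'a chart \<Rightarrow> complex \<Rightarrow> real"
  assumes metric: "kaehler_metric A g"
begin

lemma metric_pos: "c \<in> A \<Longrightarrow> z \<in> chart_range c \<Longrightarrow> g c z > 0"
  using metric unfolding kaehler_metric_def by blast

lemma metric_smooth: "c \<in> A \<Longrightarrow> smooth_on (\<lambda>z. complex_of_real (g c z)) (chart_range c)"
  using metric unfolding kaehler_metric_def kaehler_form_def real_2_form_def by blast

lemma metric_transform:
  assumes "c \<in> A" "d \<in> A" "z \<in> overlap c d"
  shows "g c z = g d (transition c d z) * (cmod (deriv (transition c d) z))\<^sup>2"
proof -
  have "complex_of_real (g c z) = complex_of_real (g d (transition c d z) * (cmod (deriv (transition c d) z))\<^sup>2)"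
    using metric assms unfolding kaehler_metric_def kaehler_form_def real_2_form_def by simp
  then show ?thesis unfolding of_real_eq_iff .
qed

lemma continuous_on_metric: "c \<in> A \<Longrightarrow> continuous_on (chart_range c) (g c)"
  using smooth_on_C1_on[OF open_chart_range metric_smooth, THEN C1_on_continuous, THEN continuous_on_Re] by simp

lemma measurable_metric:
  assumes "c \<in> A"
  shows "(\<lambda>z. indicator (chart_range c) z * g c z) \<in> borel_measurable borel"
    "(\<lambda>z. indicator (chart_range c) z * ennreal (g c z)) \<in> borel_measurable borel"
proof -
  show *: "(\<lambda>z. indicator (chart_range c) z * g c z) \<in> borel_measurable borel"
    using borel_measurable_continuous_on_indicator[OF borel_open[OF open_chart_range] continuous_on_metric, OF assms assms]
    unfolding real_scaleR_def .
  have "(\<lambda>z. ennreal (indicator (chart_range c) z * g c z)) \<in> borel_measurable borel"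
    using * by (rule measurable_compose) simp
  also have "(\<lambda>z. ennreal (indicator (chart_range c) z * g c z)) = (\<lambda>z. indicator (chart_range c) z * ennreal (g c z))"
    by (auto simp: indicator_def)
  finally show "(\<lambda>z. indicator (chart_range c) z * ennreal (g c z)) \<in> borel_measurable borel" .
qed

text \<open>The indicator matters because \<open>chart_inv c\<close> is a function on the whole
  plane: points outside the range of the chart must not contribute mass.\<close>

definition chart_measure :: "'a chart \<Rightarrow> 'a measure" where
  "chart_measure c = distr (density lborel (\<lambda>z. indicator (chart_range c) z * ennreal (g c z))) borel (chart_inv c)"

lemma sets_chart_measure [simp]: "sets (chart_measure c) = sets borel"
  by (simp add: chart_measure_def)

lemma emeasure_chart_measure:
  assumes c: "c \<in> A" and B: "B \<in> sets borel"
  shows "emeasure (chart_measure c) B = (\<integral>\<^sup>+z\<in>coord c ` (B \<inter> chart_dom c). ennreal (g c z) \<partial>lborel)"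
proof -
  note [measurable] = measurable_chart_inv[OF c] measurable_metric[OF c] B
  have "coord c ` (B \<inter> chart_dom c) = chart_inv c -` B \<inter> chart_range c"
    using coord_image_eq[OF c, of "B \<inter> chart_dom c"] chart_inv_in_dom[OF c] by auto
  then have eq: "indicator (coord c ` (B \<inter> chart_dom c)) z = indicator (chart_range c) z * (indicator (chart_inv c -` B) z :: ennreal)" for z
    by (auto simp: indicator_def)
  have "emeasure (chart_measure c) B = emeasure (density lborel (\<lambda>z. indicator (chart_range c) z * ennreal (g c z))) (chart_inv c -` B)"
    unfolding chart_measure_def by (subst emeasure_distr) simp_all
  also have "\<dots> = (\<integral>\<^sup>+z. indicator (chart_range c) z * ennreal (g c z) * indicator (chart_inv c -` B) z \<partial>lborel)"
    using measurable_sets[OF measurable_chart_inv[OF c] B] by (subst emeasure_density) simp_all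
  finally show ?thesis unfolding eq by (simp add: mult_ac)
qed

text \<open>The Jacobian \<open>\<bar>\<phi>'\<bar>\<^sup>2\<close> of the transition map is exactly
  the factor in the transformation law of \<open>g\<close>.\<close>

lemma chart_integral_eq:
  assumes c: "c \<in> A" and d: "d \<in> A" and B: "B \<in> sets borel" "B \<subseteq> chart_dom c \<inter> chart_dom d"
  shows "(\<integral>\<^sup>+z\<in>coord c ` B. ennreal (g c z) \<partial>lborel) = (\<integral>\<^sup>+z\<in>coord d ` B. ennreal (g d z) \<partial>lborel)"
proof -
  have sub: "coord c ` B \<subseteq> overlap c d" unfolding overlap_def using B(2) by (rule image_mono)
  have eq: "transition c d ` coord c ` B = coord d ` B" using transition_image[OF c d B(2)] .
  have "coord d ` B \<in> sets borel" using measurable_coord_image[OF d B(1)] B(2) by simp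
  moreover have sub': "coord d ` B \<subseteq> chart_range d" using B(2) unfolding chart_range_def by auto
  ultimately have "(\<lambda>z. (indicator (chart_range d) z * ennreal (g d z)) * indicator (coord d ` B) z) \<in> borel_measurable borel"
    by (intro borel_measurable_times_ennreal measurable_metric(2)[OF d] borel_measurable_indicator)
  also have "(\<lambda>z. (indicator (chart_range d) z * ennreal (g d z)) * indicator (coord d ` B) z) = (\<lambda>z. ennreal (g d z) * indicator (coord d ` B) z)"
  proof
    show "(indicator (chart_range d) z * ennreal (g d z)) * indicator (coord d ` B) z = ennreal (g d z) * indicator (coord d ` B) z" for z
      using sub' by (cases "z \<in> coord d ` B") auto
  qed
  finally have "(\<integral>\<^sup>+z\<in>coord d ` B. ennreal (g d z) \<partial>lborel) =
      (\<integral>\<^sup>+z\<in>coord c ` B. ennreal (g d (transition c d z)) * ennreal ((cmod (deriv (transition c d) z))\<^sup>2) \<partial>lborel)"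
    using nn_integral_holomorphic_image[OF open_overlap[OF c d] transition_holomorphic[OF c d] transition_inj[OF c d]
       measurable_coord_image[OF c B(1)] sub, of "\<lambda>z. ennreal (g d z)"] B(2) unfolding eq by simp
  also have "\<dots> = (\<integral>\<^sup>+z\<in>coord c ` B. ennreal (g c z) \<partial>lborel)"
  proof (rule nn_integral_cong)
    fix z :: complex
    show "ennreal (g d (transition c d z)) * ennreal ((cmod (deriv (transition c d) z))\<^sup>2) * indicator (coord c ` B) z =
       ennreal (g c z) * indicator (coord c ` B) z"
    proof (cases "z \<in> coord c ` B")
      case True
      then have z: "z \<in> overlap c d" by (rule subsetD[OF sub])
      have "transition c d z \<in> chart_range d" by (rule subsetD[OF overlap_subset transition_in_overlap[OF c d z]])
      then have "0 < g d (transition c d z)" by (rule metric_pos[OF d])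
      then show ?thesis unfolding metric_transform[OF c d z] by (simp add: ennreal_mult')
    qed simp
  qed
  finally show ?thesis ..
qed

text \<open>The condition under the definite description in \<open>volume_measure\<close>, named so
  that existence and uniqueness can be treated separately.\<close>

definition is_volume :: "'a measure \<Rightarrow> bool" where
  "is_volume \<mu> \<longleftrightarrow> sets \<mu> = sets borel \<and>
     (\<forall>c\<in>A. \<forall>B\<in>sets borel. B \<subseteq> chart_dom c \<longrightarrow>
        emeasure \<mu> B = (\<integral>\<^sup>+z\<in>coord c ` B. ennreal (g c z) \<partial>lborel))"

lemma is_volume_sets: "is_volume \<mu> \<Longrightarrow> sets \<mu> = sets borel"
  by (simp add: is_volume_def)

lemma is_volume_emeasure:
  "is_volume \<mu> \<Longrightarrow> c \<in> A \<Longrightarrow> B \<in> sets borel \<Longrightarrow> B \<subseteq> chart_dom c \<Longrightarrow>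
    emeasure \<mu> B = (\<integral>\<^sup>+z\<in>coord c ` B. ennreal (g c z) \<partial>lborel)"
  by (simp add: is_volume_def)

text \<open>Compactness gives finitely many charts; removing from each domain the earlier ones makes
  the pieces disjoint. A measure prescribed inside charts is thereby determined by finitely many
  pieces.\<close>

lemma disjoint_chart_cover:
  obtains I :: "nat set" and c :: "nat \<Rightarrow> 'a chart" and B :: "nat \<Rightarrow> 'a set" where
    "finite I" "\<And>i. i \<in> I \<Longrightarrow> c i \<in> A" "\<And>i. i \<in> I \<Longrightarrow> B i \<in> sets borel" "\<And>i. i \<in> I \<Longrightarrow> B i \<subseteq> chart_dom (c i)"
    "disjoint_family_on B I" "(\<Union>i\<in>I. B i) = UNIV"
proof -
  have "\<And>T. T \<in> chart_dom ` A \<Longrightarrow> open T" using open_chart_dom by blast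
  moreover have "UNIV \<subseteq> \<Union>(chart_dom ` A)" using atlas unfolding complex_atlas_def by auto
  ultimately obtain D where D: "D \<subseteq> chart_dom ` A" "finite D" "UNIV \<subseteq> \<Union>D"
    using compactE[OF compact_UNIV] by metis
  obtain C where C: "C \<subseteq> A" "finite C" "D = chart_dom ` C"
    using finite_subset_image[OF D(2,1)] by blast
  obtain cs where cs: "set cs = C" using C(2) finite_list by blast
  define U where "U = (\<lambda>i. chart_dom (cs ! i))"
  define B where "B = (\<lambda>i. U i - (\<Union>j<i. U j))"
  have inA: "cs ! i \<in> A" if "i < length cs" for i using that C(1) cs nth_mem by blast
  show ?thesis
  proof (rule that[of "{..<length cs}" "\<lambda>i. cs ! i" B])
    show "B i \<in> sets borel" if "i \<in> {..<length cs}" for i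
      unfolding B_def U_def using that by (intro sets.Diff sets.finite_UN borel_open open_chart_dom inA) auto
    show "disjoint_family_on B {..<length cs}"
      unfolding disjoint_family_on_def
    proof (intro ballI impI)
      fix m n :: nat assume "m \<noteq> n"
      then consider "m < n" | "n < m" by linarith
      then show "B m \<inter> B n = {}" by cases (auto simp: B_def)
    qed
    show "(\<Union>i\<in>{..<length cs}. B i) = UNIV"
    proof (intro equalityI subsetI UNIV_I)
      fix x :: 'a
      obtain i where "i < length cs" "x \<in> U i"
        using D(3) C(3) cs unfolding U_def by (auto simp: in_set_conv_nth)  (metis UNIV_I UN_E cs in_set_conv_nth subsetD)
      \<comment> \<open>The first chart domain containing the point is the one whose piece contains
        it.\<close>
      define k where "k = (LEAST i. x \<in> U i)"
      have "x \<in> U k" unfolding k_def by (rule LeastI) fact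
      moreover have "k \<le> i" unfolding k_def by (rule Least_le) fact
      moreover have "x \<notin> U j" if "j < k" for j using that not_less_Least unfolding k_def by blast
      ultimately show "x \<in> (\<Union>i\<in>{..<length cs}. B i)"
        using \<open>i < length cs\<close> unfolding B_def by (auto intro!: bexI[of _ k])
    qed
  qed (use inA in \<open>auto simp: B_def U_def\<close>)
qed

lemma is_volume_unique:
  assumes "is_volume \<mu>" "is_volume \<nu>" shows "\<mu> = \<nu>"
proof -
  obtain I :: "nat set" and c :: "nat \<Rightarrow> 'a chart" and B where
    I: "finite I" "\<And>i. i \<in> I \<Longrightarrow> c i \<in> A" "\<And>i. i \<in> I \<Longrightarrow> B i \<in> sets borel" "\<And>i. i \<in> I \<Longrightarrow> B i \<subseteq> chart_dom (c i)"
    "disjoint_family_on B I" "(\<Union>i\<in>I. B i) = UNIV" by (rule disjoint_chart_cover) (rule that; assumption)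
  have split: "emeasure M E = (\<Sum>i\<in>I. \<integral>\<^sup>+z\<in>coord (c i) ` (B i \<inter> E). ennreal (g (c i) z) \<partial>lborel)"
    if M: "is_volume M" and E: "E \<in> sets borel" for M E
  proof -
    have sets: "sets M = sets borel" by (rule is_volume_sets[OF M])
    have "emeasure M (\<Union>i\<in>I. B i \<inter> E) = (\<Sum>i\<in>I. emeasure M (B i \<inter> E))"
      using I(1,3,5) E sets
      by (intro sum_emeasure[symmetric]) (auto simp: disjoint_family_on_def)
    also have "(\<Union>i\<in>I. B i \<inter> E) = E" using I(6) by auto
    also have "(\<Sum>i\<in>I. emeasure M (B i \<inter> E)) = (\<Sum>i\<in>I. \<integral>\<^sup>+z\<in>coord (c i) ` (B i \<inter> E). ennreal (g (c i) z) \<partial>lborel)"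
    proof (rule sum.cong[OF refl])
      fix i assume i: "i \<in> I"
      have "B i \<inter> E \<in> sets borel" "B i \<inter> E \<subseteq> chart_dom (c i)" using I(3,4)[OF i] E by auto
      then show "emeasure M (B i \<inter> E) = (\<integral>\<^sup>+z\<in>coord (c i) ` (B i \<inter> E). ennreal (g (c i) z) \<partial>lborel)"
        by (rule is_volume_emeasure[OF M I(2)[OF i]])
    qed
    finally show ?thesis .
  qed
  show ?thesis
  proof (rule measure_eqI)
    show "sets \<mu> = sets \<nu>" using assms[THEN is_volume_sets] by simp
    show "emeasure \<mu> E = emeasure \<nu> E" if "E \<in> sets \<mu>" for E
      using that split[OF assms(1)] split[OF assms(2)] is_volume_sets[OF assms(1)] by simp
  qed
qed

text \<open>Each piece of a disjoint cover is measured in its own chart and the results are added.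
  For a set inside the domain of another chart \<open>d\<close>, \<open>chart_integral_eq\<close>
  moves every summand to \<open>d\<close>, where additivity reassembles them.\<close>

lemma is_volume_exists: "\<exists>\<mu>. is_volume \<mu>"
proof -
  obtain I :: "nat set" and c :: "nat \<Rightarrow> 'a chart" and B where
    I: "finite I" "\<And>i. i \<in> I \<Longrightarrow> c i \<in> A" "\<And>i. i \<in> I \<Longrightarrow> B i \<in> sets borel" "\<And>i. i \<in> I \<Longrightarrow> B i \<subseteq> chart_dom (c i)"
    "disjoint_family_on B I" "(\<Union>i\<in>I. B i) = UNIV" by (rule disjoint_chart_cover) (rule that; assumption)
  define m where "m E = (\<Sum>i\<in>I. emeasure (chart_measure (c i)) (B i \<inter> E))" for E
  define \<mu> where "\<mu> = measure_of UNIV (sets borel) m"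
  have sets: "sets \<mu> = sets borel"
    unfolding \<mu>_def by (metis sets.sets_measure_of_eq space_borel)
  have em: "emeasure \<mu> E = m E" if "E \<in> sets borel" for E
    unfolding \<mu>_def
  proof (rule emeasure_measure_of_sigma)
    show "sigma_algebra UNIV (sets borel)" by (metis sets.sigma_algebra_axioms space_borel)
    show "positive (sets borel) m" by (simp add: positive_def m_def)
    show "countably_additive (sets borel) m"
    proof (rule countably_additiveI)
      fix F :: "nat \<Rightarrow> 'a set" assume F: "range F \<subseteq> sets borel" "disjoint_family F"
      have "(\<Sum>n. m (F n)) = (\<Sum>i\<in>I. \<Sum>n. emeasure (chart_measure (c i)) (B i \<inter> F n))"
        unfolding m_def by (rule suminf_sum) simp
      also have "\<dots> = (\<Sum>i\<in>I. emeasure (chart_measure (c i)) (\<Union>n. B i \<inter> F n))"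
        using F I(3) by (intro sum.cong refl suminf_emeasure) (auto simp: disjoint_family_on_def)
      also have "\<dots> = m (\<Union>n. F n)" by (simp add: m_def)
      finally show "(\<Sum>n. m (F n)) = m (\<Union>n. F n)" .
    qed
  qed (fact that)
  have "is_volume \<mu>" unfolding is_volume_def
  proof (intro conjI ballI impI sets)
    fix d E assume d: "d \<in> A" and E: "E \<in> sets borel" "E \<subseteq> chart_dom d"
    have "emeasure \<mu> E = (\<Sum>i\<in>I. emeasure (chart_measure d) (B i \<inter> E))"
      unfolding em[OF E(1)] m_def
    proof (rule sum.cong[OF refl])
      fix i assume i: "i \<in> I"
      have *: "B i \<inter> E \<in> sets borel" "B i \<inter> E \<subseteq> chart_dom (c i) \<inter> chart_dom d"
        using I(3,4)[OF i] E by auto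
      then have "B i \<inter> E \<inter> chart_dom (c i) = B i \<inter> E" "B i \<inter> E \<inter> chart_dom d = B i \<inter> E" by auto
      then show "emeasure (chart_measure (c i)) (B i \<inter> E) = emeasure (chart_measure d) (B i \<inter> E)"
        using emeasure_chart_measure[OF I(2)[OF i] *(1)] emeasure_chart_measure[OF d *(1)]
          chart_integral_eq[OF I(2)[OF i] d *] by simp
    qed
    also have "\<dots> = emeasure (chart_measure d) (\<Union>i\<in>I. B i \<inter> E)"
      using I(1,3,5) E(1) by (intro sum_emeasure) (auto simp: disjoint_family_on_def)
    also have "(\<Union>i\<in>I. B i \<inter> E) = E" using I(6) by auto
    also have "emeasure (chart_measure d) E = (\<integral>\<^sup>+z\<in>coord d ` E. ennreal (g d z) \<partial>lborel)"
      using emeasure_chart_measure[OF d E(1)] E(2) by (simp add: Int_absorb2)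
    finally show "emeasure \<mu> E = (\<integral>\<^sup>+z\<in>coord d ` E. ennreal (g d z) \<partial>lborel)" .
  qed
  then show ?thesis ..
qed

abbreviation vol :: "'a measure" where
  "vol \<equiv> volume_measure A g"

lemma is_volume_volume_measure: "is_volume vol"
proof -
  have "\<exists>!\<mu>. is_volume \<mu>" by (rule ex_ex1I[OF is_volume_exists is_volume_unique])
  then have "is_volume (THE \<mu>. is_volume \<mu>)" by (rule theI')
  moreover have "volume_measure A g = (THE \<mu>. is_volume \<mu>)"
    by (simp only: volume_measure_def is_volume_def)
  ultimately show ?thesis by simp
qed

lemma sets_volume_measure [simp]: "sets vol = sets borel"
  by (rule conjunct1[OF is_volume_volume_measure[unfolded is_volume_def]])

lemma density_volume_measure:
  assumes "c \<in> A" shows "density vol (indicator (chart_dom c)) = chart_measure c"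
proof (rule measure_eqI)
  fix E assume "E \<in> sets (density vol (indicator (chart_dom c)))"
  then have E: "E \<in> sets borel" by simp
  have dom: "chart_dom c \<in> sets borel" using open_chart_dom[OF assms] by simp
  have "emeasure (density vol (indicator (chart_dom c))) E = emeasure vol (E \<inter> chart_dom c)"
    using E dom by (subst emeasure_density) (simp_all add: borel_measurable_indicator indicator_inter_arith[symmetric] Int_commute)
  also have "\<dots> = (\<integral>\<^sup>+z\<in>coord c ` (E \<inter> chart_dom c). ennreal (g c z) \<partial>lborel)"
    by (rule is_volume_emeasure[OF is_volume_volume_measure assms]) (use E dom in simp_all)
  also have "\<dots> = emeasure (chart_measure c) E"
    using emeasure_chart_measure[OF assms E] by simp
  finally show "emeasure (density vol (indicator (chart_dom c))) E = emeasure (chart_measure c) E" .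
qed simp

text \<open>The bridge from the surface to the plane: the weight \<open>g\<close> is absorbed into
  \<open>h\<close>, and \<open>h\<close> is 0 off the range of the chart, so that the right-hand
  side is an integral over the whole plane.\<close>

lemma volume_integral_chart:
  fixes f :: "'a \<Rightarrow> complex" and h :: "complex \<Rightarrow> complex"
  assumes c: "c \<in> A" and f: "f \<in> borel_measurable borel" and zero: "\<And>p. p \<notin> chart_dom c \<Longrightarrow> f p = 0"
    and h: "\<And>z. z \<in> chart_range c \<Longrightarrow> of_real (g c z) * f (chart_inv c z) = h z" "\<And>z. z \<notin> chart_range c \<Longrightarrow> h z = 0"
    and int: "integrable lborel h"
  shows "integrable vol f" "integral\<^sup>L vol f = integral\<^sup>L lborel h"
proof -
  note [measurable] = f measurable_chart_inv[OF c] measurable_metric[OF c]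
  have dom: "chart_dom c \<in> sets borel" using open_chart_dom[OF c] by simp
  let ?w = "\<lambda>z. indicator (chart_range c) z * g c z"
  have nonneg: "0 \<le> ?w z" for z using metric_pos[OF c, of z] by (auto simp: indicator_def intro: less_imp_le)
  have mu: "chart_measure c = distr (density lborel (\<lambda>z. ennreal (?w z))) borel (chart_inv c)"
  proof -
    have "(\<lambda>z. indicator (chart_range c) z * ennreal (g c z)) = (\<lambda>z. ennreal (?w z))"
      by (rule ext, case_tac "z \<in> chart_range c") simp_all
    from arg_cong[OF this, of "\<lambda>w. distr (density lborel w) borel (chart_inv c)"]
    show ?thesis unfolding chart_measure_def .
  qed
  have h_eq: "?w z *\<^sub>R f (chart_inv c z) = h z" for z
    using h[of z] by (simp add: indicator_def scaleR_conv_of_real)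
  have f_eq: "indicator (chart_dom c) p *\<^sub>R f p = f p" for p
    using zero[of p] by (simp add: indicator_def)
  have dens_eq: "density vol (indicator (chart_dom c)) = density vol (\<lambda>p. ennreal (indicator (chart_dom c) p))"
  proof -
    have "indicator (chart_dom c) = (\<lambda>p. ennreal (indicator (chart_dom c) p))"
      by (rule ext, case_tac "p \<in> chart_dom c") simp_all
    from arg_cong[OF this, of "density vol"] show ?thesis .
  qed
  have eq: "density vol (\<lambda>p. ennreal (indicator (chart_dom c) p)) = distr (density lborel (\<lambda>z. ennreal (?w z))) borel (chart_inv c)"
    by (rule trans[OF trans[OF dens_eq[symmetric] density_volume_measure[OF c]] mu])
  have meas: "f \<in> borel_measurable vol"
    "(indicator (chart_dom c) :: _ \<Rightarrow> real) \<in> borel_measurable vol"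
    using f borel_measurable_indicator[OF dom]
    unfolding measurable_cong_sets[OF sets_volume_measure refl] by simp_all
  have "integrable vol f \<longleftrightarrow> integrable (density vol (\<lambda>p. ennreal (indicator (chart_dom c) p))) f"
    using meas by (subst integrable_density) (simp_all add: f_eq)
  also have "\<dots> \<longleftrightarrow> integrable lborel h"
    unfolding eq by (simp add: integrable_distr_eq integrable_density nonneg h_eq)
  finally show "integrable vol f" using int by simp
  have "integral\<^sup>L vol f = integral\<^sup>L (density vol (\<lambda>p. ennreal (indicator (chart_dom c) p))) f"
    using meas by (subst integral_density) (simp_all add: f_eq)
  also have "\<dots> = integral\<^sup>L lborel h"
    unfolding eq by (simp add: integral_distr integral_density nonneg h_eq)
  finally show "integral\<^sup>L vol f = integral\<^sup>L lborel h" .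
qed

end

section \<open>Stokes' theorem\<close>

lemma has_wirtinger_line:
  assumes "has_wirtinger h a b (z + t *\<^sub>R v)"
  shows "((\<lambda>s. h (z + s *\<^sub>R v)) has_vector_derivative (a * v + b * cnj v)) (at t)"
proof -
  have "((\<lambda>s. z + s *\<^sub>R v) has_derivative (\<lambda>s. s *\<^sub>R v)) (at t)"
    by (auto intro!: derivative_eq_intros)
  from diff_chain_at[OF this assms[unfolded has_wirtinger_def]]
  have "((\<lambda>s. h (z + s *\<^sub>R v)) has_derivative (\<lambda>s. a * (s *\<^sub>R v) + b * cnj (s *\<^sub>R v))) (at t)"
    unfolding o_def .
  then show ?thesis unfolding has_vector_derivative_def
    by (rule has_derivative_eq_rhs) (simp add: fun_eq_iff scaleR_conv_of_real algebra_simps)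
qed

lemma integrable_continuous_bounded_support:
  fixes f :: "complex \<Rightarrow> complex"
  assumes "continuous_on UNIV f" "\<And>z. R \<le> cmod z \<Longrightarrow> f z = 0"
  shows "integrable lborel f"
proof -
  have "integrable lborel (\<lambda>z. indicator (cball 0 R) z *\<^sub>R f z)"
    using continuous_on_subset[OF assms(1)] by (intro borel_integrable_compact) simp_all
  also have "(\<lambda>z. indicator (cball 0 R) z *\<^sub>R f z) = f"
  proof
    show "indicator (cball 0 R) z *\<^sub>R f z = f z" for z
      using assms(2)[of z] by (cases "cmod z \<le> R") auto
  qed
  finally show ?thesis .
qed

text \<open>By translation invariance the integral of every difference quotient vanishes.\<close>

lemma integral_directional_derivative_zero:
  fixes h :: "complex \<Rightarrow> complex"
  assumes h: "C1_on h UNIV" and supp: "\<And>z. R \<le> cmod z \<Longrightarrow> h z = 0" and v: "cmod v \<le> 1"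
  defines "D \<equiv> \<lambda>z. dz h z * v + dzbar h z * cnj v"
  shows "integrable lborel D" "integral\<^sup>L lborel D = 0"
proof -
  have h0: "h z = 0" if "R + 1 \<le> cmod z" for z using supp[of z] that by simp
  have D_cont: "continuous_on UNIV D"
    unfolding D_def using C1_on_continuous_dz[OF h] C1_on_continuous_dzbar[OF h]
    by (intro continuous_on_add continuous_on_mult continuous_on_const)
  have D0: "D z = 0" if "R + 1 \<le> cmod z" for z
  proof -
    have "open (- cball 0 R :: complex set)" by auto
    moreover have z: "z \<in> - cball 0 R" using that by auto
    moreover have "\<And>w. w \<in> - cball 0 R \<Longrightarrow> 0 = h w" using supp by auto
    ultimately have "has_wirtinger h 0 0 z"
      by (rule has_wirtinger_transform[OF has_wirtinger_const])
    then show ?thesis unfolding D_def using has_wirtinger_dz has_wirtinger_dzbar by simp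
  qed
  show intD: "integrable lborel D"
    by (rule integrable_continuous_bounded_support[OF D_cont D0])
  have inth: "integrable lborel h"
    by (rule integrable_continuous_bounded_support[OF C1_on_continuous[OF h] supp])
  have "bounded (D ` cball 0 (R + 1))"
    using continuous_on_subset[OF D_cont] by (intro compact_imp_bounded compact_continuous_image) simp_all
  then obtain M where M: "\<And>z. z \<in> cball 0 (R + 1) \<Longrightarrow> cmod (D z) \<le> M"
    unfolding bounded_iff by blast
  \<comment> \<open>The absolute value covers \<open>R + 1 < 0\<close>, when the ball is empty and
    nothing is known about the sign of \<open>M\<close>.\<close>
  have M': "cmod (D z) \<le> \<bar>M\<bar>" for z
    using M[of z] D0[of z] by (cases "cmod z \<le> R + 1") auto
  \<comment> \<open>Difference quotients of \<open>h\<close> in direction \<open>v\<close> with step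
    \<open>1 / (n + 1)\<close>. The displacement has length at most 1, so all of them vanish off the
    ball of radius \<open>R + 1\<close>; the mean value inequality bounds them by the supremum of
    \<open>D\<close>. This is the domination needed for the limit.\<close>
  define q where "q n z = of_nat (Suc n) * (h (z + (1 / real (Suc n)) *\<^sub>R v) - h z)" for n z
  have line: "((\<lambda>s. h (z + s *\<^sub>R v)) has_vector_derivative D (z + t *\<^sub>R v)) (at t)" for z t
    unfolding D_def by (rule has_wirtinger_line[OF C1_on_has_wirtinger[OF h UNIV_I]])
  have q_bound: "cmod (q n z) \<le> \<bar>M\<bar>" for n z
  proof -
    have "cmod (h (z + (1 / real (Suc n)) *\<^sub>R v) - h (z + 0 *\<^sub>R v)) \<le> \<bar>M\<bar> * norm (1 / real (Suc n) - 0)"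
    proof (rule differentiable_bound[where S = UNIV and f = "\<lambda>s. h (z + s *\<^sub>R v)" and f' = "\<lambda>t s. s *\<^sub>R D (z + t *\<^sub>R v)"])
      show "((\<lambda>s. h (z + s *\<^sub>R v)) has_derivative (\<lambda>s. s *\<^sub>R D (z + t *\<^sub>R v))) (at t within UNIV)" for t
        using line[of z t] unfolding has_vector_derivative_def by simp
      show "onorm (\<lambda>s. s *\<^sub>R D (z + t *\<^sub>R v)) \<le> \<bar>M\<bar>" for t
        using M'[of "z + t *\<^sub>R v"] by (intro onorm_bound) (auto intro: mult_left_mono simp: mult.commute)
    qed auto
    then have "cmod (h (z + (1 / real (Suc n)) *\<^sub>R v) - h z) \<le> \<bar>M\<bar> * (1 / real (Suc n))" by simp
    then have "real (Suc n) * cmod (h (z + (1 / real (Suc n)) *\<^sub>R v) - h z) \<le> \<bar>M\<bar>"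
      by (simp add: field_simps)
    then show ?thesis unfolding q_def norm_mult norm_of_nat .
  qed
  have q0: "q n z = 0" if "z \<notin> cball 0 (R + 1)" for n z
  proof -
    define w where "w = (1 / real (Suc n)) *\<^sub>R v"
    have "cmod w \<le> 1" using v by (simp add: w_def field_simps)
    moreover have "cmod z \<le> cmod (z + w) + cmod w" using norm_triangle_ineq4[of "z + w" w] by simp
    ultimately have "cmod (z + w) \<ge> R" using that by simp
    then show ?thesis using that supp unfolding q_def w_def by simp
  qed
  have q_lim: "(\<lambda>n. q n z) \<longlonglongrightarrow> D z" for z
  proof -
    let ?f = "\<lambda>s. h (z + s *\<^sub>R v)"
    have "((\<lambda>s. norm ((?f s - ?f 0) - (s - 0) *\<^sub>R D z) / norm (s - 0)) \<longlongrightarrow> 0) (at 0)"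
      using line[of z 0] unfolding has_vector_derivative_def has_derivative_iff_norm by simp
    moreover have "filterlim (\<lambda>n. 1 / real (Suc n)) (at 0) sequentially"
      by (intro filterlim_atI LIMSEQ_Suc[OF lim_1_over_n]) simp_all
    ultimately have "(\<lambda>n. norm ((?f (1 / real (Suc n)) - ?f 0) - (1 / real (Suc n) - 0) *\<^sub>R D z) / norm (1 / real (Suc n) - 0)) \<longlonglongrightarrow> 0"
      by (rule filterlim_compose)
    moreover have "norm ((?f (1 / real (Suc n)) - ?f 0) - (1 / real (Suc n) - 0) *\<^sub>R D z) / norm (1 / real (Suc n) - 0) = norm (q n z - D z)" for n
    proof -
      have "q n z - D z = of_nat (Suc n) * ((?f (1 / real (Suc n)) - ?f 0) - (1 / real (Suc n)) *\<^sub>R D z)"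
      proof -
        have "of_nat (Suc n) * ((1 / real (Suc n)) *\<^sub>R D z) = D z"
          by (simp add: scaleR_conv_of_real del: of_nat_Suc)
        then show ?thesis unfolding q_def by (simp add: right_diff_distrib del: of_nat_Suc)
      qed
      then have "norm (q n z - D z) = real (Suc n) * norm ((?f (1 / real (Suc n)) - ?f 0) - (1 / real (Suc n)) *\<^sub>R D z)"
        by (simp only: norm_mult norm_of_nat)
      then show ?thesis by simp
    qed
    ultimately have "(\<lambda>n. norm (q n z - D z)) \<longlonglongrightarrow> 0" by simp
    then show ?thesis using tendsto_norm_zero_iff LIM_zero_cancel by blast
  qed
  have q_int: "integral\<^sup>L lborel (q n) = 0" for n
  proof -
    define t where "t = (1 / real (Suc n)) *\<^sub>R v"
    have hm: "h \<in> borel_measurable borel" using inth by simp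
    have int: "integrable lborel (\<lambda>z. h (t + z))"
      using inth hm integrable_distr_eq[of "(+) t" lborel borel h] lborel_distr_plus[of t] by simp
    have eq: "integral\<^sup>L lborel (\<lambda>z. h (t + z)) = integral\<^sup>L lborel h"
      using hm integral_distr[of "(+) t" lborel borel h] lborel_distr_plus[of t] by simp
    have "q n = (\<lambda>z. of_nat (Suc n) * (h (t + z) - h z))"
      by (simp add: q_def t_def fun_eq_iff add.commute)
    then show ?thesis
      using Bochner_Integration.integral_diff[OF int inth] eq by simp
  qed
  have "(\<lambda>n. integral\<^sup>L lborel (q n)) \<longlonglongrightarrow> integral\<^sup>L lborel D"
  proof (rule integral_dominated_convergence)
    show "D \<in> borel_measurable lborel" using intD by simp
    show "q n \<in> borel_measurable lborel" for n
    proof -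
      have "continuous_on UNIV (q n)" unfolding q_def
        by (intro continuous_intros continuous_on_compose2[OF C1_on_continuous[OF h]]) auto
      then show ?thesis using borel_measurable_continuous_onI by simp
    qed
    show "integrable lborel (\<lambda>z. indicator (cball 0 (R + 1)) z *\<^sub>R \<bar>M\<bar> :: real)"
      by (rule borel_integrable_compact) simp_all
    show "AE z in lborel. (\<lambda>n. q n z) \<longlonglongrightarrow> D z" using q_lim by simp
    show "AE z in lborel. norm (q n z) \<le> indicator (cball 0 (R + 1)) z *\<^sub>R \<bar>M\<bar>" for n
    proof (rule AE_I2)
      fix z show "norm (q n z) \<le> indicator (cball 0 (R + 1)) z *\<^sub>R \<bar>M\<bar>"
        using q_bound[of n z] q0[of z n] by (cases "z \<in> cball 0 (R + 1)") simp_all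
    qed
  qed
  then show "integral\<^sup>L lborel D = 0" using q_int by (simp add: LIMSEQ_const_iff)
qed

text \<open>\<open>dzbar\<close> is a linear combination of the directional derivatives along 1 and
  \<open>\<i>\<close>, each of which integrates to 0.\<close>

lemma integral_dzbar_zero:
  assumes h: "C1_on h UNIV" and supp: "\<And>z. R \<le> cmod z \<Longrightarrow> h z = 0"
  shows "integrable lborel (dzbar h)" "integral\<^sup>L lborel (dzbar h) = 0"
proof -
  let ?D = "\<lambda>v z. dz h z * v + dzbar h z * cnj v"
  have I1: "integrable lborel (?D 1)" "integral\<^sup>L lborel (?D 1) = 0"
    by (rule integral_directional_derivative_zero[OF h supp]; simp)+
  have I2: "integrable lborel (?D \<i>)" "integral\<^sup>L lborel (?D \<i>) = 0"
    by (rule integral_directional_derivative_zero[OF h supp]; simp)+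
  have eq: "dzbar h = (\<lambda>z. (?D 1 z + \<i> * ?D \<i> z) / 2)"
    by (simp add: fun_eq_iff algebra_simps)
  have "integrable lborel (\<lambda>z. (?D 1 z + \<i> * ?D \<i> z) / 2)"
    by (intro integrable_divide Bochner_Integration.integrable_add integrable_mult_right I1(1) I2(1))
  then show "integrable lborel (dzbar h)" by (simp only: eq[symmetric])
  have "integral\<^sup>L lborel (\<lambda>z. (?D 1 z + \<i> * ?D \<i> z) / 2) = 0"
    by (simp only: integral_divide_zero Bochner_Integration.integral_add[OF I1(1) integrable_mult_right[OF I2(1)]]
        integral_mult_right_zero I1(2) I2(2)) simp
  then show "integral\<^sup>L lborel (dzbar h) = 0" by (simp only: eq[symmetric])
qed

section \<open>C1 cutoff functions in the plane\<close>

definition bump :: "complex \<Rightarrow> real \<Rightarrow> complex \<Rightarrow> complex" where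
  "bump z0 r z = of_real ((max 0 (1 - (cmod (z - z0))\<^sup>2 / r\<^sup>2))\<^sup>2)"

text \<open>Squaring removes the kink of the positive part: at 0 the difference quotient is
  \<open>max 0 h\<close>, which tends to 0. Hence \<open>bump\<close> is C1, the regularity in which
  Stokes' theorem is proved here.\<close>

lemma has_real_derivative_max_0_square:
  "((\<lambda>t. (max 0 t)\<^sup>2) has_real_derivative 2 * max 0 t) (at t)"
proof -
  consider "t < 0" | "t > 0" | "t = 0" by linarith
  then show ?thesis
  proof cases
    case 1
    have "((\<lambda>t::real. 0) has_real_derivative 0) (at t)" by simp
    then have "((\<lambda>t. (max 0 t)\<^sup>2) has_real_derivative 0) (at t)"
      by (rule has_field_derivative_transform_within_open[where S = "{..<0}"]) (use 1 in auto)
    with 1 show ?thesis by simp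
  next
    case 2
    have "((\<lambda>t::real. t\<^sup>2) has_real_derivative 2 * t) (at t)" by (auto intro!: derivative_eq_intros)
    then have "((\<lambda>t. (max 0 t)\<^sup>2) has_real_derivative 2 * t) (at t)"
      by (rule has_field_derivative_transform_within_open[where S = "{0<..}"]) (use 2 in auto)
    with 2 show ?thesis by simp
  next
    case 3
    have eq: "(max 0 h)\<^sup>2 / h = max 0 h" for h :: real
      by (cases "h \<le> 0") (auto simp: power2_eq_square)
    have "((\<lambda>h::real. max 0 h) \<longlongrightarrow> max 0 0) (at 0)" by (intro tendsto_intros)
    with 3 show ?thesis unfolding DERIV_def by (simp add: eq)
  qed
qed

lemma has_wirtinger_bump:
  defines "t \<equiv> \<lambda>z0 r z. 1 - (cmod (z - z0))\<^sup>2 / r\<^sup>2"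
  shows "has_wirtinger (bump z0 r) (of_real (2 * max 0 (t z0 r z)) * (- cnj (z - z0) / of_real (r\<^sup>2)))
      (of_real (2 * max 0 (t z0 r z)) * (- (z - z0) / of_real (r\<^sup>2))) z"
proof -
  have "((\<lambda>z. 1 - k * ((z - z0) \<bullet> (z - z0))) has_derivative (\<lambda>h. - (k * (2 * ((z - z0) \<bullet> h))))) (at z)" for k
    by (auto intro!: derivative_eq_intros simp: inner_commute)
  from this[of "1 / r\<^sup>2"] have "(t z0 r has_derivative (\<lambda>h. - (2 * ((z - z0) \<bullet> h)) / r\<^sup>2)) (at z)"
    unfolding t_def power2_norm_eq_inner[symmetric] by simp
  from diff_chain_at[OF this has_real_derivative_max_0_square[unfolded has_field_derivative_def]]
  have "((\<lambda>z. (max 0 (t z0 r z))\<^sup>2) has_derivative (\<lambda>h. 2 * max 0 (t z0 r z) * (- (2 * ((z - z0) \<bullet> h)) / r\<^sup>2))) (at z)"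
    unfolding o_def .
  then have "(bump z0 r has_derivative (\<lambda>h. of_real (2 * max 0 (t z0 r z) * (- (2 * ((z - z0) \<bullet> h)) / r\<^sup>2)))) (at z)"
    unfolding bump_def t_def by (rule has_derivative_of_real)
  moreover have "of_real (2 * m * (- (2 * (w \<bullet> h)) / q)) = of_real (2 * m) * (- cnj w / of_real q) * h + of_real (2 * m) * (- w / of_real q) * cnj h"
    for m q :: real and w h :: complex
    by (cases "q = 0") (simp_all add: complex_eq_iff inner_complex_def field_simps)
  ultimately show ?thesis unfolding has_wirtinger_def by (simp only:)
qed

lemma C1_on_bump: "C1_on (bump z0 r) UNIV"
proof (rule C1_onI[OF has_wirtinger_bump])
  have *: "continuous_on UNIV (\<lambda>z. 2 * max 0 (1 - (cmod (z - z0))\<^sup>2 / r\<^sup>2))"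
    by (simp only: divide_inverse) (intro continuous_intros)
  show "continuous_on UNIV (\<lambda>z. of_real (2 * max 0 (1 - (cmod (z - z0))\<^sup>2 / r\<^sup>2)) * (- cnj (z - z0) / of_real (r\<^sup>2)))"
    by (rule continuous_on_mult[OF continuous_on_of_real[OF *]], simp only: divide_inverse, intro continuous_intros)
  show "continuous_on UNIV (\<lambda>z. of_real (2 * max 0 (1 - (cmod (z - z0))\<^sup>2 / r\<^sup>2)) * (- (z - z0) / of_real (r\<^sup>2)))"
    by (rule continuous_on_mult[OF continuous_on_of_real[OF *]], simp only: divide_inverse, intro continuous_intros)
qed

lemma bump_zero:
  assumes "0 < r" "z \<notin> cball z0 r" shows "bump z0 r z = 0"
proof -
  have "r < cmod (z - z0)" using assms(2) by (simp add: dist_norm norm_minus_commute)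
  then have "r\<^sup>2 < (cmod (z - z0))\<^sup>2" using assms(1) by (intro power_strict_mono) auto
  then have "1 \<le> (cmod (z - z0))\<^sup>2 / r\<^sup>2" using assms(1) \<open>r < cmod (z - z0)\<close> by (subst le_divide_eq_1_pos) simp_all
  then have "1 - (cmod (z - z0))\<^sup>2 / r\<^sup>2 \<le> 0" by simp
  then show ?thesis by (simp add: bump_def)
qed

lemma bump_pos:
  assumes "z \<in> ball z0 r" shows "Re (bump z0 r z) > 0"
proof -
  have "cmod (z - z0) < r" using assms by (simp add: dist_norm norm_minus_commute)
  moreover from this have "0 < r" using norm_ge_zero order_le_less_trans by blast
  ultimately have "(cmod (z - z0))\<^sup>2 < r\<^sup>2" by (intro power_strict_mono) auto
  then have "(cmod (z - z0))\<^sup>2 / r\<^sup>2 < 1" using \<open>0 < r\<close> by (subst divide_less_eq_1_pos) simp_all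
  then have "0 < max 0 (1 - (cmod (z - z0))\<^sup>2 / r\<^sup>2)" by simp
  from zero_less_power[OF this, of 2] show ?thesis unfolding bump_def Re_complex_of_real .
qed

lemma bump_nonneg: "Re (bump z0 r z) \<ge> 0"
  by (simp add: bump_def)

section \<open>(1,0)-forms on the surface and partitions of unity\<close>

context surface_atlas
begin

definition chart_bump :: "'a chart \<Rightarrow> complex \<Rightarrow> real \<Rightarrow> 'a \<Rightarrow> complex" where
  "chart_bump c z0 r p = (if p \<in> chart_dom c then bump z0 r (coord c p) else 0)"

definition C1_form :: "('a chart \<Rightarrow> complex \<Rightarrow> complex) \<Rightarrow> bool" where
  "C1_form \<eta> \<longleftrightarrow> (\<forall>c\<in>A. C1_on (\<eta> c) (chart_range c)) \<and>
     (\<forall>c\<in>A. \<forall>d\<in>A. \<forall>z\<in>overlap c d. \<eta> c z = \<eta> d (transition c d z) * deriv (transition c d) z)"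

text \<open>The quotient of the 2-form \<open>dbar \<eta>\<close> by the volume form, up to a
  constant. Numerator and denominator both scale by \<open>\<bar>\<phi>'\<bar>\<^sup>2\<close>, so
  the arbitrary choice of a chart does no harm, as \<open>form_dbar_chart\<close> shows.\<close>

definition form_dbar :: "('a chart \<Rightarrow> complex \<Rightarrow> real) \<Rightarrow> ('a chart \<Rightarrow> complex \<Rightarrow> complex) \<Rightarrow> 'a \<Rightarrow> complex" where
  "form_dbar g \<eta> p =
    (let c = (SOME c. c \<in> A \<and> p \<in> chart_dom c) in dzbar (\<eta> c) (coord c p) / of_real (g c (coord c p)))"

lemma C1_form_C1_on: "C1_form \<eta> \<Longrightarrow> c \<in> A \<Longrightarrow> C1_on (\<eta> c) (chart_range c)"
  by (simp add: C1_form_def)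

lemma C1_form_transform: "C1_form \<eta> \<Longrightarrow> c \<in> A \<Longrightarrow> d \<in> A \<Longrightarrow> z \<in> overlap c d \<Longrightarrow>
    \<eta> c z = \<eta> d (transition c d z) * deriv (transition c d) z"
  by (simp add: C1_form_def)

lemma C1_formI:
  "(\<And>c. c \<in> A \<Longrightarrow> C1_on (\<eta> c) (chart_range c)) \<Longrightarrow>
   (\<And>c d z. c \<in> A \<Longrightarrow> d \<in> A \<Longrightarrow> z \<in> overlap c d \<Longrightarrow> \<eta> c z = \<eta> d (transition c d z) * deriv (transition c d) z) \<Longrightarrow>
   C1_form \<eta>"
  by (simp add: C1_form_def)

lemma C1_on_transition:
  assumes "c \<in> A" "d \<in> A" "C1_on f (chart_range d)"
  shows "C1_on (\<lambda>z. f (transition c d z)) (overlap c d)"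
proof (rule C1_on_holomorphic_compose[OF assms(3) transition_holomorphic[OF assms(1,2)] open_overlap[OF assms(1,2)]])
  show "transition c d ` overlap c d \<subseteq> chart_range d"
    using transition_in_overlap[OF assms(1,2)] overlap_subset by (intro image_subsetI) (rule subsetD[OF overlap_subset])
qed

text \<open>The image of a closed disc is compact, hence closed in a Hausdorff space. So the bump
  extended by 0 vanishes on an open neighbourhood of every point outside the chart, which makes the
  extension C1.\<close>

lemma chart_bump_support:
  assumes c: "c \<in> A" and r: "0 < r" "cball z0 r \<subseteq> chart_range c"
  shows "closed (chart_inv c ` cball z0 r)"
    and "p \<notin> chart_inv c ` cball z0 r \<Longrightarrow> chart_bump c z0 r p = 0"
    and "p \<notin> chart_dom c \<Longrightarrow> p \<notin> chart_inv c ` cball z0 r"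
proof -
  show "closed (chart_inv c ` cball z0 r)"
    using continuous_on_subset[OF continuous_on_chart_inv[OF c] r(2)]
    by (intro compact_imp_closed compact_continuous_image) simp_all
  show "chart_bump c z0 r p = 0" if p: "p \<notin> chart_inv c ` cball z0 r"
  proof (cases "p \<in> chart_dom c")
    case True
    have "coord c p \<notin> cball z0 r"
      using p chart_inv_coord[OF c True] by (metis imageI)
    then show ?thesis using bump_zero[OF r(1)] by (simp add: chart_bump_def)
  qed (simp add: chart_bump_def)
  show "p \<notin> chart_inv c ` cball z0 r" if p: "p \<notin> chart_dom c"
  proof
    assume "p \<in> chart_inv c ` cball z0 r"
    then obtain z where "z \<in> cball z0 r" "p = chart_inv c z" by (rule imageE)
    then show False using chart_inv_in_dom[OF c, of z] r(2) p by auto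
  qed
qed

lemma open_chart_inv_vimage: "c \<in> A \<Longrightarrow> open U \<Longrightarrow> open (chart_inv c -` U \<inter> chart_range c)"
  using continuous_on_chart_inv open_chart_range continuous_on_open_vimage by metis

lemma C1_on_chart_bump:
  assumes c: "c \<in> A" and r: "0 < r" "cball z0 r \<subseteq> chart_range c" and d: "d \<in> A"
  shows "C1_on (\<lambda>z. chart_bump c z0 r (chart_inv d z)) (chart_range d)"
proof (rule C1_on_locally)
  fix z assume z: "z \<in> chart_range d"
  let ?f = "\<lambda>z. chart_bump c z0 r (chart_inv d z)"
  show "\<exists>T. open T \<and> z \<in> T \<and> C1_on ?f T"
  proof (cases "chart_inv d z \<in> chart_dom c")
    case True
    have "C1_on ?f (overlap d c)"
    proof (rule C1_on_transform[OF C1_on_transition[OF d c C1_on_subset[OF C1_on_bump]] open_overlap[OF d c]])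
      show "bump z0 r (transition d c w) = ?f w" if "w \<in> overlap d c" for w
        using that overlap_iff[OF d, of w c] by (simp add: chart_bump_def transition_def)
    qed auto
    moreover have "z \<in> overlap d c" using overlap_iff[OF d] z True by simp
    ultimately show ?thesis using open_overlap[OF d c] by metis
  next
    case False
    let ?T = "chart_inv d -` (- chart_inv c ` cball z0 r) \<inter> chart_range d"
    have T: "open ?T"
      by (rule open_chart_inv_vimage[OF d]) (use chart_bump_support(1)[OF c r] in auto)
    have "C1_on ?f ?T"
    proof (rule C1_on_transform[OF C1_on_const T])
      show "0 = ?f w" if "w \<in> ?T" for w
        using that chart_bump_support(2)[OF c r, of "chart_inv d w"] by simp
    qed
    moreover have "z \<in> ?T" using z chart_bump_support(3)[OF c r False] by simp
    ultimately show ?thesis using T by metis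
  qed
qed

lemma C1_form_mult:
  assumes \<eta>: "C1_form \<eta>" and f: "\<And>c. c \<in> A \<Longrightarrow> C1_on (\<lambda>z. f (chart_inv c z)) (chart_range c)"
  shows "C1_form (\<lambda>c z. f (chart_inv c z) * \<eta> c z)"
proof (rule C1_formI)
  show "C1_on (\<lambda>z. f (chart_inv c z) * \<eta> c z) (chart_range c)" if "c \<in> A" for c
    by (rule C1_on_mult[OF f[OF that] C1_form_C1_on[OF \<eta> that]])
  show "f (chart_inv c z) * \<eta> c z = f (chart_inv d (transition c d z)) * \<eta> d (transition c d z) * deriv (transition c d) z"
    if "c \<in> A" "d \<in> A" "z \<in> overlap c d" for c d z
    using C1_form_transform[OF \<eta> that] chart_inv_transition[OF that] by simp
qed

lemma some_chart: "(SOME c. c \<in> A \<and> p \<in> chart_dom c) \<in> A \<and> p \<in> chart_dom (SOME c. c \<in> A \<and> p \<in> chart_dom c)"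
proof -
  obtain c where "c \<in> A" "p \<in> chart_dom c" by (rule ex_chart)
  then have "c \<in> A \<and> p \<in> chart_dom c" ..
  then show ?thesis by (rule someI)
qed

end

context metric_surface
begin

text \<open>The factor \<open>\<phi>'\<close> in the transformation law of \<open>\<eta>\<close> is
  holomorphic and passes through \<open>dzbar\<close>; the chain rule adds
  \<open>cnj \<phi>'\<close>. The resulting \<open>\<bar>\<phi>'\<bar>\<^sup>2\<close> cancels
  against that of the metric.\<close>

lemma form_dbar_chart:
  assumes \<eta>: "C1_form \<eta>" and c: "c \<in> A" and z: "z \<in> chart_range c"
  shows "of_real (g c z) * form_dbar g \<eta> (chart_inv c z) = dzbar (\<eta> c) z"
proof -
  define p where "p = chart_inv c z"
  define e where "e = (SOME c. c \<in> A \<and> p \<in> chart_dom c)"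
  have e: "e \<in> A" "p \<in> chart_dom e" using some_chart[of p] unfolding e_def by blast+
  have zo: "z \<in> overlap c e" using overlap_iff[OF c] z e(2) unfolding p_def by simp
  define w where "w = coord e p"
  let ?\<phi> = "transition c e"
  have w: "?\<phi> z = w" unfolding w_def p_def transition_def by simp
  have wr: "w \<in> chart_range e" unfolding w_def by (rule coord_in_range[OF e(2)])
  have "has_wirtinger (\<eta> e) (dz (\<eta> e) w) (dzbar (\<eta> e) w) (?\<phi> z)"
    unfolding w by (rule C1_on_has_wirtinger[OF C1_form_C1_on[OF \<eta> e(1)] wr])
  note W1 = has_wirtinger_holomorphic_compose[OF transition_derivative[OF c e(1) zo] this]
  have "(deriv ?\<phi> has_field_derivative deriv (deriv ?\<phi>) z) (at z)"
    by (rule holomorphic_derivI[OF holomorphic_deriv[OF transition_holomorphic open_overlap] open_overlap]) (fact c e zo)+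
  note W2 = has_wirtinger_mult[OF W1 has_wirtinger_holomorphic[OF this]]
  have W3: "has_wirtinger (\<eta> c) (dz (\<eta> e) w * deriv ?\<phi> z * deriv ?\<phi> z + \<eta> e (?\<phi> z) * deriv (deriv ?\<phi>) z)
     (dzbar (\<eta> e) w * cnj (deriv ?\<phi> z) * deriv ?\<phi> z + \<eta> e (?\<phi> z) * 0) z"
    by (rule has_wirtinger_transform[OF W2 open_overlap[OF c e(1)] zo C1_form_transform[OF \<eta> c e(1), symmetric]])
  have "dzbar (\<eta> c) z = dzbar (\<eta> e) w * of_real ((cmod (deriv ?\<phi> z))\<^sup>2)"
    unfolding has_wirtinger_dzbar[OF W3] complex_norm_square by simp
  moreover have "of_real (g c z) = of_real (g e w) * (of_real ((cmod (deriv ?\<phi> z))\<^sup>2) :: complex)"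
    using metric_transform[OF c e(1) zo] w by simp
  moreover have "form_dbar g \<eta> p = dzbar (\<eta> e) w / of_real (g e w)"
    unfolding form_dbar_def Let_def e_def[symmetric] w_def[symmetric] by simp
  moreover have "g e w \<noteq> 0" using metric_pos[OF e(1) wr] by simp
  ultimately show ?thesis unfolding p_def by simp
qed

lemma form_dbar_eq:
  assumes \<eta>: "C1_form \<eta>" and c: "c \<in> A" and p: "p \<in> chart_dom c"
  shows "form_dbar g \<eta> p = dzbar (\<eta> c) (coord c p) / of_real (g c (coord c p))"
  using form_dbar_chart[OF \<eta> c coord_in_range[OF p]] metric_pos[OF c coord_in_range[OF p]] chart_inv_coord[OF c p]
  by (simp add: field_simps)

lemma form_dbar_continuous:
  assumes \<eta>: "C1_form \<eta>" shows "continuous_on UNIV (form_dbar g \<eta>)"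
proof (rule continuous_at_imp_continuous_on, rule ballI)
  fix p :: 'a
  obtain c where c: "c \<in> A" "p \<in> chart_dom c" by (rule ex_chart)
  let ?f = "\<lambda>p. dzbar (\<eta> c) (coord c p) / of_real (g c (coord c p))"
  have sub: "coord c ` chart_dom c \<subseteq> chart_range c" by (simp add: chart_range_def)
  have g0: "\<And>q. q \<in> chart_dom c \<Longrightarrow> complex_of_real (g c (coord c q)) \<noteq> 0"
    using metric_pos[OF c(1) coord_in_range] by force
  have "continuous_on (chart_dom c) ?f"
    by (intro continuous_on_divide continuous_on_of_real continuous_on_compose2[OF C1_on_continuous_dzbar[OF C1_form_C1_on[OF \<eta> c(1)]] continuous_on_coord[OF c(1)] sub]
       continuous_on_compose2[OF continuous_on_metric[OF c(1)] continuous_on_coord[OF c(1)] sub] ballI g0)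
  then have "continuous_on (chart_dom c) (form_dbar g \<eta>)"
    by (rule continuous_on_eq) (rule form_dbar_eq[OF \<eta> c(1), symmetric])
  then show "isCont (form_dbar g \<eta>) p"
    using iffD1[OF continuous_on_eq_continuous_at[OF open_chart_dom[OF c(1)]]] c(2) by blast
qed

text \<open>A form cut off inside one coordinate disc extends by 0 to a C1 function on the plane,
  where the integral of \<open>dzbar\<close> vanishes.\<close>

lemma form_dbar_bump_integral:
  assumes \<eta>: "C1_form \<eta>" and c: "c \<in> A" and r: "0 < r" "cball z0 r \<subseteq> chart_range c"
  defines "\<eta>' \<equiv> \<lambda>d z. chart_bump c z0 r (chart_inv d z) * \<eta> d z"
  shows "integrable vol (form_dbar g \<eta>')" "integral\<^sup>L vol (form_dbar g \<eta>') = 0"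
proof -
  have \<eta>': "C1_form \<eta>'"
    unfolding \<eta>'_def by (rule C1_form_mult[OF \<eta> C1_on_chart_bump[OF c r]])
  define h where "h z = (if z \<in> chart_range c then \<eta>' c z else 0)" for z
  have h0: "h z = 0" if "z \<notin> cball z0 r" for z
  proof (cases "z \<in> chart_range c")
    case True
    then have "chart_bump c z0 r (chart_inv c z) = bump z0 r z"
      by (simp add: chart_bump_def chart_inv_in_dom[OF c] coord_chart_inv[OF c])
    then show ?thesis using bump_zero[OF r(1) that] by (simp add: h_def \<eta>'_def)
  qed (simp add: h_def)
  have open_out: "open (- cball z0 r)" by auto
  have h_in: "C1_on h (chart_range c)"
    by (rule C1_on_transform[OF C1_form_C1_on[OF \<eta>' c] open_chart_range[OF c]]) (simp add: h_def)
  have h_out: "C1_on h (- cball z0 r)"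
    by (rule C1_on_transform[OF C1_on_const open_out]) (use h0 in simp)
  have h: "C1_on h UNIV"
  proof (rule C1_on_locally)
    fix z show "\<exists>T. open T \<and> z \<in> T \<and> C1_on h T"
      using h_in h_out open_chart_range[OF c] open_out r(2) by (cases "z \<in> cball z0 r") auto
  qed
  \<comment> \<open>\<open>integral_dzbar_zero\<close> asks for a disc about 0 instead of
    \<open>z0\<close>; the summand 1 makes the point lie strictly outside the closed disc.\<close>
  have supp: "h z = 0" if "cmod z0 + r + 1 \<le> cmod z" for z
  proof (rule h0)
    show "z \<notin> cball z0 r" using that norm_triangle_ineq2[of z z0] by (simp add: dist_norm norm_minus_commute)
  qed
  have eq: "of_real (g c z) * form_dbar g \<eta>' (chart_inv c z) = dzbar h z" if "z \<in> chart_range c" for z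
    unfolding form_dbar_chart[OF \<eta>' c that]
    by (rule dzbar_cong[OF open_chart_range[OF c] that]) (simp add: h_def)
  have zero: "dzbar h z = 0" if "z \<notin> chart_range c" for z
  proof -
    have z: "z \<in> - cball z0 r" using that r(2) by blast
    have "has_wirtinger h 0 0 z"
      by (rule has_wirtinger_transform[OF has_wirtinger_const open_out z]) (use h0 in simp)
    then show ?thesis by (rule has_wirtinger_dzbar)
  qed
  have zero': "form_dbar g \<eta>' p = 0" if p: "p \<notin> chart_dom c" for p
  proof -
    obtain e where e: "e \<in> A" "p \<in> chart_dom e" by (rule ex_chart)
    let ?T = "chart_inv e -` (- chart_inv c ` cball z0 r) \<inter> chart_range e"
    have T: "open ?T"
      by (rule open_chart_inv_vimage[OF e(1)]) (use chart_bump_support(1)[OF c r] in auto)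
    have pT: "coord e p \<in> ?T"
      using chart_bump_support(3)[OF c r p] chart_inv_coord[OF e] coord_in_range[OF e(2)] by simp
    have "has_wirtinger (\<eta>' e) 0 0 (coord e p)"
    proof (rule has_wirtinger_transform[OF has_wirtinger_const T pT])
      show "0 = \<eta>' e w" if "w \<in> ?T" for w
        using that chart_bump_support(2)[OF c r, of "chart_inv e w"] by (simp add: \<eta>'_def)
    qed
    then show ?thesis unfolding form_dbar_eq[OF \<eta>' e] by (simp add: has_wirtinger_dzbar)
  qed
  note VI = volume_integral_chart[OF c borel_measurable_continuous_onI[OF form_dbar_continuous[OF \<eta>']]
      zero' eq zero integral_dzbar_zero(1)[OF h supp]]
  show "integrable vol (form_dbar g \<eta>')" by (rule VI(1))
  show "integral\<^sup>L vol (form_dbar g \<eta>') = 0"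
    using VI(2) integral_dzbar_zero(2)[OF h supp] by simp
qed

text \<open>Each bump is nonnegative, and positive on its open disc; finitely many discs cover the
  surface. Positivity of the sum is what permits dividing by it to get a partition of unity.\<close>

lemma bump_cover:
  obtains J :: "('a chart \<times> complex \<times> real) set" where "finite J"
    "\<And>c z0 r. (c, z0, r) \<in> J \<Longrightarrow> c \<in> A \<and> 0 < r \<and> cball z0 r \<subseteq> chart_range c"
    "\<And>p. 0 < Re (\<Sum>(c, z0, r)\<in>J. chart_bump c z0 r p)"
proof -
  define Q where "Q = {(c, z0, r). c \<in> A \<and> 0 < r \<and> cball z0 r \<subseteq> chart_range c}"
  define U where "U = (\<lambda>(c, z0, r). chart_inv c ` ball z0 (r::real) :: 'a set)"
  have opn: "open (U q)" if "q \<in> Q" for q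
  proof -
    obtain c z0 r where q: "q = (c, z0, r)" by (cases q) auto
    with that have "c \<in> A" "cball z0 r \<subseteq> chart_range c" by (auto simp: Q_def)
    then show ?thesis unfolding q U_def using ball_subset_cball by (auto intro!: open_chart_inv_image)
  qed
  have cov: "UNIV \<subseteq> (\<Union>q\<in>Q. U q)"
  proof
    fix p :: 'a
    obtain c where c: "c \<in> A" "p \<in> chart_dom c" by (rule ex_chart)
    obtain r where r: "0 < r" "cball (coord c p) r \<subseteq> chart_range c"
      using open_contains_cball[of "chart_range c"] open_chart_range[OF c(1)] coord_in_range[OF c(2)] by blast
    have "(c, coord c p, r) \<in> Q" using c r by (simp add: Q_def)
    moreover have "p \<in> U (c, coord c p, r)"
      unfolding U_def using chart_inv_coord[OF c] r(1) by (simp add: image_iff) (metis centre_in_ball)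
    ultimately show "p \<in> (\<Union>q\<in>Q. U q)" by blast
  qed
  obtain J where J: "J \<subseteq> Q" "finite J" "UNIV \<subseteq> (\<Union>q\<in>J. U q)"
    using compactE_image[OF compact_UNIV opn cov] by metis
  show ?thesis
  proof (rule that[OF J(2)])
    show JQ: "c \<in> A \<and> 0 < r \<and> cball z0 r \<subseteq> chart_range c" if "(c, z0, r) \<in> J" for c z0 r
      using that J(1) unfolding Q_def by blast
    fix p :: 'a
    have "p \<in> (\<Union>q\<in>J. U q)" using J(3) by blast
    then obtain c z0 r where j: "(c, z0, r) \<in> J" "p \<in> chart_inv c ` ball z0 r"
      unfolding U_def by auto
    then obtain z where z: "z \<in> ball z0 r" "p = chart_inv c z" by (elim imageE)
    have zc: "z \<in> chart_range c" using JQ[OF j(1)] z(1) by auto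
    have cA: "c \<in> A" using JQ[OF j(1)] by blast
    have "chart_bump c z0 r p = bump z0 r z"
      using z(2) chart_inv_in_dom[OF cA zc] coord_chart_inv[OF cA zc] by (simp add: chart_bump_def)
    then have pos: "0 < Re (chart_bump c z0 r p)" using bump_pos[OF z(1)] by simp
    have nonneg: "0 \<le> Re (case q of (c, z0, r) \<Rightarrow> chart_bump c z0 r p)" for q
      by (cases q) (simp add: chart_bump_def bump_nonneg)
    have "0 < (\<Sum>q\<in>J. Re (case q of (c, z0, r) \<Rightarrow> chart_bump c z0 r p))"
      by (rule sum_pos2[OF J(2) j(1)]) (use pos nonneg in auto)
    then show "0 < Re (\<Sum>(c, z0, r)\<in>J. chart_bump c z0 r p)" by (simp add: Re_sum)
  qed
qed

text \<open>The form is first divided by the sum \<open>B\<close> of the bumps and then multiplied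
  by each bump. The resulting pieces add up to \<open>\<eta>\<close>, and each is covered by
  \<open>form_dbar_bump_integral\<close>.\<close>

theorem stokes:
  assumes \<eta>: "C1_form \<eta>"
  shows "integrable vol (form_dbar g \<eta>)" "integral\<^sup>L vol (form_dbar g \<eta>) = 0"
proof -
  obtain J where J: "finite J"
    "\<And>c z0 r. (c, z0, r) \<in> J \<Longrightarrow> c \<in> A \<and> 0 < r \<and> cball z0 r \<subseteq> chart_range c"
    "\<And>p. 0 < Re (\<Sum>(c, z0, r)\<in>J. chart_bump c z0 r p)" by (rule bump_cover) (rule that; assumption)
  define b where "b j p = (case j of (c, z0, r) \<Rightarrow> chart_bump c z0 r p)" for j p
  define B where "B p = (\<Sum>j\<in>J. b j p)" for p
  have B0: "B p \<noteq> 0" for p using J(3)[of p] unfolding B_def b_def by force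
  have bC1: "C1_on (\<lambda>z. b j (chart_inv d z)) (chart_range d)" if "j \<in> J" "d \<in> A" for j d
  proof -
    obtain c z0 r where j: "j = (c, z0, r)" by (cases j) auto
    show ?thesis unfolding j b_def using J(2)[of c z0 r] that C1_on_chart_bump[of c r z0 d] unfolding j by simp
  qed
  define \<eta>' where "\<eta>' = (\<lambda>d z. 1 / B (chart_inv d z) * \<eta> d z)"
  have BC1: "C1_on (\<lambda>z. B (chart_inv d z)) (chart_range d)" if "d \<in> A" for d
    unfolding B_def by (rule C1_on_sum) (rule bC1[OF _ that])
  have \<eta>': "C1_form \<eta>'" unfolding \<eta>'_def
  proof (rule C1_form_mult[OF \<eta>])
    fix d assume d: "d \<in> A"
    show "C1_on (\<lambda>z. 1 / B (chart_inv d z)) (chart_range d)"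
      by (rule C1_on_divide[OF C1_on_const BC1[OF d] B0])
  qed
  define \<eta>j where "\<eta>j j = (\<lambda>d z. b j (chart_inv d z) * \<eta>' d z)" for j
  have \<eta>j: "C1_form (\<eta>j j)" if "j \<in> J" for j
    unfolding \<eta>j_def by (rule C1_form_mult[OF \<eta>' bC1[OF that]])
  have int: "integrable vol (form_dbar g (\<eta>j j)) \<and> integral\<^sup>L vol (form_dbar g (\<eta>j j)) = 0"
    if "j \<in> J" for j
  proof -
    obtain c z0 r where j: "j = (c, z0, r)" by (cases j) auto
    have "c \<in> A" "0 < r" "cball z0 r \<subseteq> chart_range c" using J(2)[of c z0 r] that unfolding j by blast+
    from form_dbar_bump_integral[OF \<eta>' this] show ?thesis unfolding \<eta>j_def b_def j by simp
  qed
  have sum: "form_dbar g \<eta> p = (\<Sum>j\<in>J. form_dbar g (\<eta>j j) p)" for p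
  proof -
    obtain c where c: "c \<in> A" "p \<in> chart_dom c" by (rule ex_chart)
    let ?z = "coord c p"
    have W: "has_wirtinger (\<eta>j j c) (dz (\<eta>j j c) ?z) (dzbar (\<eta>j j c) ?z) ?z" if "j \<in> J" for j
      by (rule C1_on_has_wirtinger[OF C1_form_C1_on[OF \<eta>j[OF that] c(1)] coord_in_range[OF c(2)]])
    have "has_wirtinger (\<lambda>z. \<Sum>j\<in>K. \<eta>j j c z) (\<Sum>j\<in>K. dz (\<eta>j j c) ?z) (\<Sum>j\<in>K. dzbar (\<eta>j j c) ?z) ?z"
      if "finite K" "K \<subseteq> J" for K
      using that
    proof (induction K rule: finite_induct)
      case empty
      show ?case using has_wirtinger_const[of 0 ?z] by simp
    next
      case (insert j K)
      then show ?case using has_wirtinger_add[OF W[of j] insert.IH] by simp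
    qed
    from this[OF J(1) subset_refl]
    have "has_wirtinger (\<lambda>z. \<Sum>j\<in>J. \<eta>j j c z) (\<Sum>j\<in>J. dz (\<eta>j j c) ?z) (\<Sum>j\<in>J. dzbar (\<eta>j j c) ?z) ?z" .
    moreover have "(\<lambda>z. \<Sum>j\<in>J. \<eta>j j c z) = \<eta> c"
    proof
      fix z
      have "(\<Sum>j\<in>J. \<eta>j j c z) = B (chart_inv c z) * \<eta>' c z"
        unfolding \<eta>j_def B_def by (simp add: sum_distrib_right)
      then show "(\<Sum>j\<in>J. \<eta>j j c z) = \<eta> c z" using B0 by (simp add: \<eta>'_def)
    qed
    ultimately have "dzbar (\<eta> c) ?z = (\<Sum>j\<in>J. dzbar (\<eta>j j c) ?z)"
      using has_wirtinger_dzbar by simp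
    then show ?thesis
      using form_dbar_eq[OF \<eta> c] form_dbar_eq[OF \<eta>j c] by (simp add: sum_divide_distrib)
  qed
  have eq: "form_dbar g \<eta> = (\<lambda>p. \<Sum>j\<in>J. form_dbar g (\<eta>j j) p)" using sum by (rule ext)
  show "integrable vol (form_dbar g \<eta>)"
    unfolding eq by (rule Bochner_Integration.integrable_sum) (use int in blast)
  have "integral\<^sup>L vol (\<lambda>p. \<Sum>j\<in>J. form_dbar g (\<eta>j j) p) = (\<Sum>j\<in>J. integral\<^sup>L vol (form_dbar g (\<eta>j j)))"
    by (rule Bochner_Integration.integral_sum) (use int in blast)
  also have "\<dots> = 0" by (rule sum.neutral) (use int in blast)
  finally show "integral\<^sup>L vol (form_dbar g \<eta>) = 0" unfolding eq .
qed

end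

section \<open>Holomorphic flows in the plane\<close>

lemma holomorphic_primitive_on_ball:
  assumes "f holomorphic_on ball 0 d" "0 < d"
  obtains F where "F 0 = y" "\<And>t. t \<in> ball 0 d \<Longrightarrow> (F has_field_derivative f t) (at t)"
proof -
  obtain G where G: "\<And>t. t \<in> ball 0 d \<Longrightarrow> (G has_field_derivative f t) (at t within ball 0 d)"
    using holomorphic_convex_primitive'[OF convex_ball open_ball assms(1)] by metis
  show ?thesis
  proof (rule that[of "\<lambda>t. G t - G 0 + y"])
    fix t :: complex assume t: "t \<in> ball 0 d"
    have "(G has_field_derivative f t) (at t)" using G[OF t] at_within_open[OF t open_ball] by simp
    then show "((\<lambda>t. G t - G 0 + y) has_field_derivative f t) (at t)"
      by (auto intro!: derivative_eq_intros)
  qed simp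
qed

text \<open>Picard iteration in complex time. The condition \<open>M * d \<le> r\<close> keeps the
  iterates in the closed ball, and \<open>L * d \<le> 1 / 2\<close> halves successive differences. A
  uniform limit of holomorphic functions may be differentiated term by term.\<close>

lemma holomorphic_flow_exists:
  assumes f: "f holomorphic_on S" "open S" and y: "cball y r \<subseteq> S"
    and M: "\<And>z. z \<in> cball y r \<Longrightarrow> cmod (f z) \<le> M"
    and L: "\<And>z w. z \<in> cball y r \<Longrightarrow> w \<in> cball y r \<Longrightarrow> cmod (f z - f w) \<le> L * cmod (z - w)"
    and d: "0 < d" "M * d \<le> r" "L * d \<le> 1 / 2" and "0 \<le> M" "0 \<le> L" "0 < r"
  obtains g where "g 0 = y" "\<And>t. t \<in> ball 0 d \<Longrightarrow> g t \<in> cball y r"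
    "\<And>t. t \<in> ball 0 d \<Longrightarrow> (g has_field_derivative f (g t)) (at t)"
proof -
  let ?B = "ball (0::complex) d"
  define P where "P = (\<lambda>g. g 0 = y \<and> g holomorphic_on ?B \<and> g ` ?B \<subseteq> cball y r)"
  have step: "\<exists>h. P h \<and> (\<forall>t\<in>?B. (h has_field_derivative f (g t)) (at t))" if "P g" for g
  proof -
    have g: "g holomorphic_on ?B" "g ` ?B \<subseteq> cball y r" using that unfolding P_def by auto
    have "(f \<circ> g) holomorphic_on ?B"
      by (rule holomorphic_on_compose[OF g(1) holomorphic_on_subset[OF f(1) subset_trans[OF g(2) y]]])
    from holomorphic_primitive_on_ball[OF this d(1)]
    obtain h where h: "h 0 = y" "\<And>t. t \<in> ?B \<Longrightarrow> (h has_field_derivative (f \<circ> g) t) (at t)" by metis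
    have "h holomorphic_on ?B"
      unfolding holomorphic_on_open[OF open_ball] by (intro ballI exI) (rule h(2))
    moreover have "h t \<in> cball y r" if t: "t \<in> ?B" for t
    proof -
      have "cmod (h t - h 0) \<le> M * cmod (t - 0)"
      proof (rule field_differentiable_bound[OF convex_ball])
        show "(h has_field_derivative (f \<circ> g) z) (at z within ?B)" if "z \<in> ?B" for z
          using h(2)[OF that] by (rule has_field_derivative_at_within)
        show "cmod ((f \<circ> g) z) \<le> M" if "z \<in> ?B" for z
        proof -
          have "g z \<in> cball y r" using g(2) that by blast
          then show ?thesis using M by simp
        qed
      qed (use t d(1) in auto)
      also have "\<dots> \<le> M * d" using t \<open>0 \<le> M\<close> by (intro mult_left_mono) auto
      finally have "cmod (h t - y) \<le> r" using h(1) d(2) by simp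
      then show ?thesis by (simp add: dist_norm norm_minus_commute)
    qed
    ultimately have "P h" unfolding P_def using h(1) by blast
    moreover have "\<forall>t\<in>?B. (h has_field_derivative f (g t)) (at t)" using h(2) by simp
    ultimately show ?thesis by (intro exI conjI)
  qed
  have P0: "P (\<lambda>_. y)" unfolding P_def using \<open>0 < r\<close> by auto
  have "\<exists>g. \<forall>n. P (g n) \<and> (\<forall>t\<in>?B. (g (Suc n) has_field_derivative f (g n t)) (at t))"
    by (rule dependent_nat_choice[where P = "\<lambda>_. P" and Q = "\<lambda>_ g h. \<forall>t\<in>?B. (h has_field_derivative f (g t)) (at t)"])
       (rule exI[of P, OF P0], rule step)
  then obtain g where "\<forall>n. P (g n) \<and> (\<forall>t\<in>?B. (g (Suc n) has_field_derivative f (g n t)) (at t))" ..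
  then have g: "\<And>n. P (g n)" "\<And>n t. t \<in> ?B \<Longrightarrow> (g (Suc n) has_field_derivative f (g n t)) (at t)" by blast+
  have g0: "g n 0 = y" and gin: "t \<in> ?B \<Longrightarrow> g n t \<in> cball y r" for n t
    using g(1)[of n] unfolding P_def by blast+
  \<comment> \<open>The constant \<open>2 * r\<close> is the diameter of the ball that contains all
    iterates; it settles the case \<open>n = 0\<close>.\<close>
  have diff: "cmod (g (Suc n) t - g n t) \<le> 2 * r * (1 / 2) ^ n" if "t \<in> ?B" for n t
    using that
  proof (induction n arbitrary: t)
    case 0
    have "cmod (g (Suc 0) t - g 0 t) \<le> dist (g (Suc 0) t) y + dist y (g 0 t)"
      using dist_triangle[of "g (Suc 0) t" "g 0 t" y] by (simp add: dist_norm)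
    then show ?case using gin[OF 0, of 0] gin[OF 0, of "Suc 0"] by (simp add: dist_commute)
  next
    case (Suc n)
    have "cmod ((g (Suc (Suc n)) t - g (Suc n) t) - (g (Suc (Suc n)) 0 - g (Suc n) 0)) \<le> (L * (2 * r * (1 / 2) ^ n)) * cmod (t - 0)"
    proof (rule field_differentiable_bound[OF convex_ball, of 0 d "\<lambda>t. g (Suc (Suc n)) t - g (Suc n) t" "\<lambda>t. f (g (Suc n) t) - f (g n t)"])
      show "((\<lambda>t. g (Suc (Suc n)) t - g (Suc n) t) has_field_derivative f (g (Suc n) z) - f (g n z)) (at z within ?B)" if "z \<in> ?B" for z
        by (rule has_field_derivative_at_within[OF DERIV_diff[OF g(2)[OF that] g(2)[OF that]]])
      show "cmod (f (g (Suc n) z) - f (g n z)) \<le> L * (2 * r * (1 / 2) ^ n)" if "z \<in> ?B" for z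
        by (rule order_trans[OF L[OF gin[OF that] gin[OF that]] mult_left_mono[OF Suc.IH[OF that] \<open>0 \<le> L\<close>]])
    qed (use Suc.prems d(1) in auto)
    also have "\<dots> \<le> (L * (2 * r * (1 / 2) ^ n)) * d"
    proof (rule mult_left_mono)
      show "cmod (t - 0) \<le> d" using Suc.prems by simp
      show "0 \<le> L * (2 * r * (1 / 2) ^ n)"
        by (intro mult_nonneg_nonneg \<open>0 \<le> L\<close> zero_le_power less_imp_le[OF \<open>0 < r\<close>]) simp_all
    qed
    also have "\<dots> = (L * d) * (2 * r * (1 / 2) ^ n)" by (simp only: mult_ac)
    also have "\<dots> \<le> 1 / 2 * (2 * r * (1 / 2) ^ n)"
      by (intro mult_right_mono d(3) mult_nonneg_nonneg zero_le_power less_imp_le[OF \<open>0 < r\<close>]) simp_all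
    also have "\<dots> = 2 * r * (1 / 2) ^ Suc n" by simp
    finally show ?case unfolding g0 by (simp only: diff_self diff_zero)
  qed
  have "uniform_limit ?B (\<lambda>n t. \<Sum>i<n. g (Suc i) t - g i t) (\<lambda>t. \<Sum>i. g (Suc i) t - g i t) sequentially"
  proof (rule Weierstrass_m_test[OF diff])
    show "summable (\<lambda>n. 2 * r * (1 / 2) ^ n)" by (intro summable_mult summable_geometric) simp
  qed
  then have "uniform_limit ?B (\<lambda>n t. g n t - g 0 t) (\<lambda>t. \<Sum>i. g (Suc i) t - g i t) sequentially"
  proof (rule back_subst[of "\<lambda>h. uniform_limit ?B h _ sequentially"], intro ext)
    show "(\<Sum>i<n. g (Suc i) t - g i t) = g n t - g 0 t" for n t
      using sum_lessThan_telescope[of "\<lambda>i. g i t" n] .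
  qed
  from uniform_limit_add[OF this uniform_limit_const[where c = "g 0"]]
  have "uniform_limit ?B g (\<lambda>t. (\<Sum>i. g (Suc i) t - g i t) + g 0 t) sequentially" by simp
  then obtain G where G: "uniform_limit ?B g G sequentially" ..
  \<comment> \<open>The shifted sequence is the one to differentiate: the derivative of
    \<open>g (Suc n)\<close> is \<open>f (g n t)\<close>, whose limit is
    \<open>f (G t)\<close>.\<close>
  have "uniform_limit ?B (\<lambda>n. g (Suc n)) G sequentially"
    by (rule filterlim_compose[OF G filterlim_Suc])
  note suc = this
  have *: "\<exists>e>0. cball t e \<subseteq> ?B \<and> uniform_limit (cball t e) (\<lambda>n. g (Suc n)) G sequentially" if "t \<in> ?B" for t
  proof -
    define e where "e = (d - cmod t) / 2"
    have e: "0 < e" "cmod t + e < d" using that by (simp_all add: e_def field_simps)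
    have sub: "cball t e \<subseteq> ?B"
    proof
      fix w assume "w \<in> cball t e"
      then show "w \<in> ?B" using e(2) norm_triangle_sub[of w t] by (simp add: dist_norm norm_minus_commute)
    qed
    show ?thesis
      by (rule exI[of _ e], rule conjI, rule e(1), rule conjI, rule sub, rule uniform_limit_on_subset[OF suc sub])
  qed
  have "\<exists>G'. \<forall>t\<in>?B. (G has_field_derivative G' t) (at t) \<and> (\<lambda>n. f (g n t)) \<longlonglongrightarrow> G' t"
    by (rule has_complex_derivative_uniform_sequence[OF open_ball g(2) *])
  then obtain G' where G': "\<And>t. t \<in> ?B \<Longrightarrow> (G has_field_derivative G' t) (at t)" "\<And>t. t \<in> ?B \<Longrightarrow> (\<lambda>n. f (g n t)) \<longlonglongrightarrow> G' t"
    by blast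
  have lim: "(\<lambda>n. g n t) \<longlonglongrightarrow> G t" if "t \<in> ?B" for t
    by (rule tendsto_uniform_limitI[OF G that])
  have Gin: "G t \<in> cball y r" if "t \<in> ?B" for t
    by (rule closed_sequentially[OF closed_cball gin[OF that] lim[OF that]])
  have eqG: "G' t = f (G t)" if t: "t \<in> ?B" for t
  proof (rule LIMSEQ_unique[OF G'(2)[OF t]])
    have "G t \<in> S" using Gin[OF t] y by (rule subsetD[rotated])
    then have "isCont f (G t)"
      using holomorphic_on_imp_continuous_on[OF f(1), unfolded continuous_on_eq_continuous_at[OF f(2)]] by blast
    then show "(\<lambda>n. f (g n t)) \<longlonglongrightarrow> f (G t)" by (rule isCont_tendsto_compose[OF _ lim[OF t]])
  qed
  have "0 \<in> ?B" using d(1) by simp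
  from lim[OF this] have "G 0 = y" unfolding g0 by (rule LIMSEQ_unique[OF _ tendsto_const])
  show ?thesis
  proof (rule that[of G, OF \<open>G 0 = y\<close> Gin])
    show "(G has_field_derivative f (G t)) (at t)" if "t \<in> ?B" for t
      using G'(1)[OF that] unfolding eqG[OF that] .
  qed
qed

text \<open>The bounds \<open>M\<close> and \<open>L\<close> are taken on a ball of radius
  \<open>R\<close>, and starting points only from the ball of half that radius. Balls of radius
  \<open>R / 2\<close> about them stay in the large ball, so one existence time serves all of
  them.\<close>

lemma holomorphic_flow_locally_uniform:
  assumes f: "f holomorphic_on S" "open S" and z0: "z0 \<in> S"
  obtains r d where "0 < r" "0 < d" "ball z0 r \<subseteq> S"
    "\<And>y. y \<in> ball z0 r \<Longrightarrow> \<exists>g. g 0 = y \<and> (\<forall>t\<in>ball 0 d. g t \<in> S \<and> (g has_field_derivative f (g t)) (at t))"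
proof -
  obtain R where R: "0 < R" "cball z0 R \<subseteq> S" using open_contains_cball[of S] f(2) z0 by blast
  define r where "r = R / 2"
  have r: "0 < r" using R(1) by (simp add: r_def)
  have sub: "cball y r \<subseteq> cball z0 R" if "y \<in> ball z0 r" for y
  proof
    fix w assume "w \<in> cball y r"
    then show "w \<in> cball z0 R" using that dist_triangle[of z0 w y] by (simp add: r_def)
  qed
  have bdd: "\<exists>B>0. \<forall>z\<in>cball z0 R. cmod (h z) \<le> B" if "h holomorphic_on S" for h
  proof -
    have "compact (h ` cball z0 R)"
      using holomorphic_on_imp_continuous_on[OF that] R(2) continuous_on_subset by (intro compact_continuous_image) auto
    from compact_imp_bounded[OF this] show ?thesis unfolding bounded_pos by auto
  qed
  obtain M where M: "0 < M" "\<And>z. z \<in> cball z0 R \<Longrightarrow> cmod (f z) \<le> M" using bdd[OF f(1)] by blast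
  obtain L where L: "0 < L" "\<And>z. z \<in> cball z0 R \<Longrightarrow> cmod (deriv f z) \<le> L" using bdd[OF holomorphic_deriv[OF f]] by blast
  have Lip: "cmod (f z - f w) \<le> L * cmod (z - w)" if "z \<in> cball z0 R" "w \<in> cball z0 R" for z w
  proof (rule field_differentiable_bound[OF convex_cball _ L(2) that])
    show "(f has_field_derivative deriv f z) (at z within cball z0 R)" if "z \<in> cball z0 R" for z
      using holomorphic_derivI[OF f] that R(2) has_field_derivative_at_within by blast
  qed
  define d where "d = min (r / M) (1 / (2 * L))"
  have d: "0 < d" "M * d \<le> r" "L * d \<le> 1 / 2"
  proof -
    show "0 < d" using r M(1) L(1) by (simp add: d_def)
    have "d \<le> r / M" by (simp add: d_def)
    then show "M * d \<le> r" using M(1) by (simp add: field_simps)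
    have "d \<le> 1 / (2 * L)" by (simp add: d_def)
    then show "L * d \<le> 1 / 2" using L(1) by (simp add: field_simps)
  qed
  show ?thesis
  proof (rule that[OF r d(1)])
    show "ball z0 r \<subseteq> S" using R r_def by (auto simp: subset_iff)
    fix y assume y: "y \<in> ball z0 r"
    have s: "cball y r \<subseteq> S" using sub[OF y] R(2) by blast
    obtain g where g: "g 0 = y" "\<And>t. t \<in> ball 0 d \<Longrightarrow> g t \<in> cball y r"
      "\<And>t. t \<in> ball 0 d \<Longrightarrow> (g has_field_derivative f (g t)) (at t)"
    proof (rule holomorphic_flow_exists[OF f s _ _ d])
      show "cmod (f z) \<le> M" if "z \<in> cball y r" for z using M(2) that sub[OF y] by blast
      show "cmod (f z - f w) \<le> L * cmod (z - w)" if "z \<in> cball y r" "w \<in> cball y r" for z w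
        using Lip that sub[OF y] by blast
    qed (use M(1) L(1) r that in auto)
    then show "\<exists>g. g 0 = y \<and> (\<forall>t\<in>ball 0 d. g t \<in> S \<and> (g has_field_derivative f (g t)) (at t))"
      using s by blast
  qed
qed

text \<open>Linearization at a simple zero: the new coordinate is \<open>(z - z0) exp K\<close>, where \<open>K\<close> is a primitive
  of \<open>1 / f - 1 / (z - z0)\<close>.\<close>

lemma holomorphic_linearization:
  assumes f: "f holomorphic_on S" "open S" and z0: "z0 \<in> S" "f z0 = 0" "deriv f z0 = 1"
  obtains \<psi> R where "0 < R" "\<psi> 0 = z0" "inj_on \<psi> (ball 0 R)" "\<psi> ` ball 0 R \<subseteq> S" "open (\<psi> ` ball 0 R)"
    "\<And>t. t \<in> ball 0 R \<Longrightarrow> \<exists>D. (\<psi> has_field_derivative D) (at t) \<and> t * D = f (\<psi> t)"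
proof -
  define v where "v = (\<lambda>z. if z = z0 then deriv f z0 else (f z - f z0) / (z - z0))"
  have v: "v holomorphic_on S" unfolding v_def by (rule pole_lemma_open[OF f])
  have v0: "v z0 = 1" by (simp add: v_def z0)
  have fv: "f z = (z - z0) * v z" for z by (simp add: v_def z0)
  have "isCont v z0" using v f(2) z0(1) holomorphic_on_imp_continuous_on continuous_on_eq_continuous_at by blast
  then have "\<exists>e>0. \<forall>z. dist z0 z < e \<longrightarrow> v z \<noteq> 0" using continuous_at_avoid[of z0 v 0] v0 by simp
  then obtain e1 where e1: "0 < e1" "\<And>z. z \<in> ball z0 e1 \<Longrightarrow> v z \<noteq> 0" by auto
  obtain e2 where e2: "0 < e2" "ball z0 e2 \<subseteq> S" using f(2) z0(1) openE by blast
  define e where "e = min e1 e2"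
  let ?B = "ball z0 e"
  have e: "0 < e" "?B \<subseteq> S" "\<And>z. z \<in> ?B \<Longrightarrow> v z \<noteq> 0" using e1 e2 by (auto simp: e_def)
  \<comment> \<open>Because \<open>f z = (z - z0) * v z\<close> and \<open>v z0 = 1\<close>, this is
    the removable extension of \<open>1 / f - 1 / (z - z0)\<close>.\<close>
  define m where "m = (\<lambda>z. if z = z0 then deriv (\<lambda>z. 1 / v z) z0 else (1 / v z - 1 / v z0) / (z - z0))"
  have "(\<lambda>z. 1 / v z) holomorphic_on ?B"
    by (intro holomorphic_intros holomorphic_on_subset[OF v e(2)] e(3))
  then have m: "m holomorphic_on ?B" unfolding m_def by (rule pole_lemma_open) simp
  obtain K where K: "\<And>z. z \<in> ?B \<Longrightarrow> (K has_field_derivative m z) (at z within ?B)"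
    using holomorphic_convex_primitive'[OF convex_ball open_ball m] by metis
  define l where "l = (\<lambda>z. (z - z0) * exp (K z))"
  \<comment> \<open>Since \<open>exp (K z) / v z = l z / f z\<close> away from \<open>z0\<close>,
    this says \<open>f * l' = l\<close>: in the coordinate \<open>l\<close> the field is the Euler
    field. For the inverse \<open>\<psi>\<close> it reads
    \<open>t * \<psi>' = f \<circ> \<psi>\<close>.\<close>
  have l: "(l has_field_derivative exp (K z) / v z) (at z)" if z: "z \<in> ?B" for z
  proof -
    have "(K has_field_derivative m z) (at z)" using K[OF z] at_within_open[OF z open_ball] by simp
    then have "(l has_field_derivative (exp (K z) + (z - z0) * (exp (K z) * m z))) (at z)"
      unfolding l_def by (auto intro!: derivative_eq_intros)
    moreover have "1 + (z - z0) * m z = 1 / v z" using v0 by (simp add: m_def)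
    then have "exp (K z) * (1 + (z - z0) * m z) = exp (K z) / v z" by simp
    ultimately show ?thesis by (simp add: algebra_simps)
  qed
  have lhol: "l holomorphic_on ?B" using l holomorphic_on_open[OF open_ball] by blast
  have "deriv l z0 \<noteq> 0" using DERIV_imp_deriv[OF l[of z0]] e(1) v0 by simp
  then obtain r where r: "0 < r" "ball z0 r \<subseteq> ?B" "inj_on l (ball z0 r)"
    using has_complex_derivative_locally_injective[OF lhol _ open_ball] e(1) by (metis centre_in_ball)
  have lr: "l holomorphic_on ball z0 r" by (rule holomorphic_on_subset[OF lhol r(2)])
  obtain \<psi> where \<psi>: "\<psi> holomorphic_on l ` ball z0 r" "\<And>z. z \<in> ball z0 r \<Longrightarrow> deriv l z * deriv \<psi> (l z) = 1"
     "\<And>z. z \<in> ball z0 r \<Longrightarrow> \<psi> (l z) = z"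
    using holomorphic_has_inverse[OF lr open_ball r(3)] by metis
  have opn: "open (l ` ball z0 r)" by (rule open_mapping_thm3[OF lr open_ball r(3)])
  have l0: "l z0 = 0" by (simp add: l_def)
  then have "0 \<in> l ` ball z0 r" using r(1) by (metis centre_in_ball imageI)
  then obtain R where R: "0 < R" "ball 0 R \<subseteq> l ` ball z0 r" using opn openE by blast
  have pre: "\<exists>z\<in>ball z0 r. t = l z" if "t \<in> ball 0 R" for t using R(2) that by blast
  have inj: "inj_on \<psi> (ball 0 R)"
  proof (rule inj_onI)
    fix s t assume "s \<in> ball 0 R" "t \<in> ball 0 R" and eq: "\<psi> s = \<psi> t"
    then obtain z w where "z \<in> ball z0 r" "s = l z" "w \<in> ball z0 r" "t = l w" using pre by blast
    then show "s = t" using eq \<psi>(3) by simp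
  qed
  have hol: "\<psi> holomorphic_on ball 0 R" by (rule holomorphic_on_subset[OF \<psi>(1) R(2)])
  show ?thesis
  proof (rule that[OF R(1) _ inj])
    show "\<psi> 0 = z0" using \<psi>(3)[of z0] r(1) l0 by simp
    show "\<psi> ` ball 0 R \<subseteq> S"
    proof
      fix w assume "w \<in> \<psi> ` ball 0 R"
      then obtain t where "t \<in> ball 0 R" "w = \<psi> t" by blast
      moreover from this obtain z where "z \<in> ball z0 r" "t = l z" using pre by blast
      ultimately show "w \<in> S" using \<psi>(3) r(2) e(2) by auto
    qed
    show "open (\<psi> ` ball 0 R)" by (rule open_mapping_thm3[OF hol open_ball inj])
    fix t assume t: "t \<in> ball (0::complex) R"
    then obtain z where z: "z \<in> ball z0 r" "t = l z" using pre by blast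
    have zB: "z \<in> ?B" using z r(2) by blast
    have "(\<psi> has_field_derivative deriv \<psi> t) (at t)" by (rule holomorphic_derivI[OF hol open_ball t])
    moreover have "t * deriv \<psi> t = f (\<psi> t)"
    proof -
      have "exp (K z) / v z * deriv \<psi> t = 1" using \<psi>(2)[OF z(1)] DERIV_imp_deriv[OF l[OF zB]] z(2) by simp
      then have "exp (K z) * deriv \<psi> t = v z" using e(3)[OF zB] by (simp add: field_simps)
      then show ?thesis using z \<psi>(3)[OF z(1)] fv[of z] by (simp add: l_def mult.assoc)
    qed
    ultimately show "\<exists>D. (\<psi> has_field_derivative D) (at t) \<and> t * D = f (\<psi> t)" by blast
  qed
qed

text \<open>On a ball of radius \<open>d\<close> with \<open>L d \<le> 1 / 2\<close> the supremum \<open>M\<close> of \<open>\<bar>f - g\<bar>\<close> satisfies \<open>M \<le> M / 2\<close>.\<close>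

lemma holomorphic_flow_unique_locally:
  assumes V: "V holomorphic_on S" "open S"
    and F: "\<And>t. t \<in> ball s e \<Longrightarrow> (F has_field_derivative V (F t)) (at t)"
    and G: "\<And>t. t \<in> ball s e \<Longrightarrow> (G has_field_derivative V (G t)) (at t)"
    and eq: "F s = G s" and s: "F s \<in> S" and e: "0 < e"
  obtains d where "0 < d" "d \<le> e" "\<And>t. t \<in> ball s d \<Longrightarrow> F t = G t"
proof -
  obtain R where R: "0 < R" "cball (F s) R \<subseteq> S" using open_contains_cball[of S] V(2) s by blast
  have "compact (deriv V ` cball (F s) R)"
    using holomorphic_on_imp_continuous_on[OF holomorphic_deriv[OF V]] R(2) continuous_on_subset by (intro compact_continuous_image) auto
  from compact_imp_bounded[OF this]
  obtain L where L: "0 < L" "\<And>z. z \<in> cball (F s) R \<Longrightarrow> cmod (deriv V z) \<le> L" unfolding bounded_pos by auto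
  have Lip: "cmod (V z - V w) \<le> L * cmod (z - w)" if "z \<in> cball (F s) R" "w \<in> cball (F s) R" for z w
  proof (rule field_differentiable_bound[OF convex_cball _ L(2) that])
    show "(V has_field_derivative deriv V z) (at z within cball (F s) R)" if "z \<in> cball (F s) R" for z
      using holomorphic_derivI[OF V] that R(2) has_field_derivative_at_within by blast
  qed
  have "isCont F s" "isCont G s" using F[of s] G[of s] e DERIV_isCont by auto
  then have "\<forall>\<^sub>F t in at s. dist (F t) (F s) < R" "\<forall>\<^sub>F t in at s. dist (G t) (G s) < R"
    using R(1) by (auto simp: isCont_def tendstoD)
  then have "\<forall>\<^sub>F t in at s. dist (F t) (F s) < R \<and> dist (G t) (F s) < R" using eq by (simp add: eventually_conj)
  then obtain d1 where d1: "0 < d1" "\<And>t. t \<noteq> s \<Longrightarrow> dist t s < d1 \<Longrightarrow> dist (F t) (F s) < R \<and> dist (G t) (F s) < R"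
    unfolding eventually_at by blast
  define d where "d = min (min (d1 / 2) (e / 2)) (1 / (2 * L))"
  have d: "0 < d" "d < d1" "d < e" "L * d \<le> 1 / 2"
  proof -
    show "0 < d" "d < d1" "d < e" using d1(1) e L(1) by (auto simp: d_def)
    have "d \<le> 1 / (2 * L)" by (simp add: d_def)
    then show "L * d \<le> 1 / 2" using L(1) by (simp add: field_simps)
  qed
  have inR: "F t \<in> cball (F s) R" "G t \<in> cball (F s) R" if "t \<in> cball s d" for t
    using d1(2)[of t] that d(2) R(1) eq by (cases "t = s"; force simp: dist_commute)+
  have sub: "cball s d \<subseteq> ball s e" using d(3) by auto
  define D where "D = (\<lambda>t. F t - G t)"
  have derD: "(D has_field_derivative V (F t) - V (G t)) (at t)" if "t \<in> cball s d" for t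
    unfolding D_def using F[of t] G[of t] that sub by (intro DERIV_diff) auto
  have "continuous_on (cball s d) (\<lambda>t. cmod (D t))"
    using derD DERIV_isCont by (intro continuous_on_norm continuous_at_imp_continuous_on) blast
  then obtain tm where tm: "tm \<in> cball s d" "\<And>t. t \<in> cball s d \<Longrightarrow> cmod (D t) \<le> cmod (D tm)"
    using continuous_attains_sup[of "cball s d" "\<lambda>t. cmod (D t)"] d(1) by (metis cball_eq_empty compact_cball not_less_iff_gr_or_eq)
  have "cmod (D tm - D s) \<le> (L * cmod (D tm)) * cmod (tm - s)"
  proof (rule field_differentiable_bound[OF convex_cball, of s d D "\<lambda>t. V (F t) - V (G t)"])
    show "(D has_field_derivative V (F z) - V (G z)) (at z within cball s d)" if "z \<in> cball s d" for z
      using derD[OF that] by (rule has_field_derivative_at_within)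
    show "cmod (V (F z) - V (G z)) \<le> L * cmod (D tm)" if "z \<in> cball s d" for z
    proof -
      have "cmod (V (F z) - V (G z)) \<le> L * cmod (D z)" using Lip[OF inR(1)[OF that] inR(2)[OF that]] by (simp add: D_def)
      also have "\<dots> \<le> L * cmod (D tm)" using tm(2)[OF that] L(1) by (intro mult_left_mono) auto
      finally show ?thesis .
    qed
  qed (use tm(1) d(1) in auto)
  also have "\<dots> \<le> (L * cmod (D tm)) * d" using tm(1) L(1) by (intro mult_left_mono) (auto simp: dist_norm norm_minus_commute)
  also have "\<dots> = (L * d) * cmod (D tm)" by simp
  also have "\<dots> \<le> 1 / 2 * cmod (D tm)" using d(4) by (intro mult_right_mono) auto
  finally have "cmod (D tm) = 0" using eq by (simp add: D_def)
  then have "D t = 0" if "t \<in> cball s d" for t using tm(2)[OF that] by simp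
  then show ?thesis using that[of d] d by (auto simp: D_def)
qed

section \<open>Complex orbits of a holomorphic vector field\<close>

locale compact_surface_vf = compact_surface A for A :: "'a::{t2_space, second_countable_topology} chart set" +
  fixes W :: "'a chart \<Rightarrow> complex \<Rightarrow> complex"
  assumes vf: "holomorphic_vector_field A W"
begin

lemma vf_holomorphic: "c \<in> A \<Longrightarrow> W c holomorphic_on chart_range c"
  and vf_transform: "c \<in> A \<Longrightarrow> d \<in> A \<Longrightarrow> z \<in> overlap c d \<Longrightarrow>
    W d (transition c d z) = deriv (transition c d) z * W c z"
  using vf unfolding holomorphic_vector_field_def by auto

text \<open>Continuity is demanded separately: \<open>coord c\<close> takes arbitrary values off its
  domain, so differentiability of \<open>coord c (F t)\<close> does not force \<open>F\<close> to
  stay near \<open>F s\<close>.\<close>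

definition integral_curve_at :: "(complex \<Rightarrow> 'a) \<Rightarrow> complex \<Rightarrow> bool" where
  "integral_curve_at F s \<longleftrightarrow> isCont F s \<and>
     (\<forall>c\<in>A. F s \<in> chart_dom c \<longrightarrow> ((\<lambda>t. coord c (F t)) has_field_derivative W c (coord c (F s))) (at s))"

definition integral_curve :: "(complex \<Rightarrow> 'a) \<Rightarrow> complex set \<Rightarrow> bool" where
  "integral_curve F S \<longleftrightarrow> (\<forall>s\<in>S. integral_curve_at F s)"

lemma integral_curveI: "(\<And>s. s \<in> S \<Longrightarrow> integral_curve_at F s) \<Longrightarrow> integral_curve F S"
  by (simp add: integral_curve_def)

lemma integral_curveD: "integral_curve F S \<Longrightarrow> s \<in> S \<Longrightarrow> integral_curve_at F s"
  by (simp add: integral_curve_def)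

lemma integral_curve_at_isCont: "integral_curve_at F s \<Longrightarrow> isCont F s"
  by (simp add: integral_curve_at_def)

lemma integral_curve_at_deriv:
  "integral_curve_at F s \<Longrightarrow> c \<in> A \<Longrightarrow> F s \<in> chart_dom c \<Longrightarrow>
    ((\<lambda>t. coord c (F t)) has_field_derivative W c (coord c (F s))) (at s)"
  by (simp add: integral_curve_at_def)

lemma integral_curve_subset: "integral_curve F S \<Longrightarrow> T \<subseteq> S \<Longrightarrow> integral_curve F T"
  unfolding integral_curve_def by blast

lemma integral_curve_continuous_on: "integral_curve F S \<Longrightarrow> continuous_on S F"
  by (simp add: integral_curve_def integral_curve_at_isCont continuous_at_imp_continuous_on)

lemma integral_curve_at_cong:
  assumes "integral_curve_at F s" "\<forall>\<^sub>F t in nhds s. F t = G t"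
  shows "integral_curve_at G s"
  unfolding integral_curve_at_def
proof (intro conjI ballI impI)
  have eq: "F s = G s" using eventually_nhds_x_imp_x[OF assms(2)] .
  show "isCont G s" using isCont_cong[OF assms(2)] integral_curve_at_isCont[OF assms(1)] by simp
  fix c assume c: "c \<in> A" "G s \<in> chart_dom c"
  have ev: "\<forall>\<^sub>F t in nhds s. coord c (F t) = coord c (G t)"
    by (rule eventually_mono[OF assms(2)]) simp
  have "((\<lambda>t. coord c (F t)) has_field_derivative W c (coord c (F s))) (at s)"
    using integral_curve_at_deriv[OF assms(1) c(1)] c(2) eq by simp
  then show "((\<lambda>t. coord c (G t)) has_field_derivative W c (coord c (G s))) (at s)"
    using DERIV_cong_ev[OF refl ev refl] eq by simp
qed

lemma integral_curve_cong_open: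
  assumes "integral_curve F S" "open S" "\<And>s. s \<in> S \<Longrightarrow> F s = G s"
  shows "integral_curve G S"
proof (rule integral_curveI)
  fix s assume s: "s \<in> S"
  have "\<forall>\<^sub>F t in nhds s. F t = G t"
    by (rule eventually_mono[OF eventually_nhds_in_open[OF assms(2) s]]) (rule assms(3))
  then show "integral_curve_at G s" by (rule integral_curve_at_cong[OF integral_curveD[OF assms(1) s]])
qed

text \<open>By the chain rule the velocity changes with the factor \<open>\<phi>'\<close>, exactly
  as the components of the vector field do, so checking one chart suffices.\<close>

lemma integral_curve_at_oneI:
  assumes F: "isCont F s" and c: "c \<in> A" "F s \<in> chart_dom c"
    and D: "((\<lambda>t. coord c (F t)) has_field_derivative W c (coord c (F s))) (at s)"
  shows "integral_curve_at F s"
  unfolding integral_curve_at_def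
proof (intro conjI ballI impI F)
  fix d assume d: "d \<in> A" "F s \<in> chart_dom d"
  let ?z = "coord c (F s)"
  have z: "?z \<in> overlap c d" by (rule coord_in_overlap[OF c(2) d(2)])
  have "(transition c d \<circ> (\<lambda>t. coord c (F t)) has_field_derivative deriv (transition c d) ?z * W c ?z) (at s)"
    by (rule DERIV_chain[OF transition_derivative[OF c(1) d(1) z] D])
  moreover have "\<forall>\<^sub>F t in nhds s. (transition c d \<circ> (\<lambda>t. coord c (F t))) t = coord d (F t)"
  proof -
    have "\<forall>\<^sub>F t in nhds s. F t \<in> chart_dom c"
      using F c(2) open_chart_dom[OF c(1)] by (simp add: continuous_at_open eventually_nhds)
    then show ?thesis by (rule eventually_mono) (simp add: transition_coord[OF c(1)])
  qed
  ultimately have "((\<lambda>t. coord d (F t)) has_field_derivative deriv (transition c d) ?z * W c ?z) (at s)"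
    using DERIV_cong_ev[OF refl _ refl] by fast
  moreover have "deriv (transition c d) ?z * W c ?z = W d (coord d (F s))"
    using vf_transform[OF c(1) d(1) z] transition_coord[OF c] by simp
  ultimately show "((\<lambda>t. coord d (F t)) has_field_derivative W d (coord d (F s))) (at s)" by simp
qed

lemma integral_curve_chart:
  assumes c: "c \<in> A" and f: "\<And>t. t \<in> S \<Longrightarrow> f t \<in> chart_range c"
    "\<And>t. t \<in> S \<Longrightarrow> (f has_field_derivative W c (f t)) (at t)" and S: "open S"
  shows "integral_curve (\<lambda>t. chart_inv c (f t)) S"
proof (rule integral_curveI)
  fix s assume s: "s \<in> S"
  show "integral_curve_at (\<lambda>t. chart_inv c (f t)) s"
  proof (rule integral_curve_at_oneI[OF _ c])
    show "isCont (\<lambda>t. chart_inv c (f t)) s"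
      by (rule isCont_o2[OF DERIV_isCont[OF f(2)[OF s]] isCont_chart_inv[OF c f(1)[OF s]]])
    show "chart_inv c (f s) \<in> chart_dom c" by (rule chart_inv_in_dom[OF c f(1)[OF s]])
    have "((\<lambda>t. coord c (chart_inv c (f t))) has_field_derivative W c (f s)) (at s)"
      by (rule has_field_derivative_transform_within_open[OF f(2)[OF s] S s]) (simp add: coord_chart_inv[OF c f(1)])
    then show "((\<lambda>t. coord c (chart_inv c (f t))) has_field_derivative W c (coord c (chart_inv c (f s)))) (at s)"
      by (simp add: coord_chart_inv[OF c f(1)[OF s]])
  qed
qed

lemma integral_curve_shift:
  assumes "integral_curve F S" shows "integral_curve (\<lambda>t. F (t + a)) {t. t + a \<in> S}"
proof (rule integral_curveI)
  fix s assume "s \<in> {t. t + a \<in> S}"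
  then have I: "integral_curve_at F (s + a)" using integral_curveD[OF assms] by simp
  show "integral_curve_at (\<lambda>t. F (t + a)) s" unfolding integral_curve_at_def
  proof (intro conjI ballI impI)
    have "isCont (\<lambda>t. t + a) s" by (intro continuous_intros)
    then show "isCont (\<lambda>t. F (t + a)) s"
      by (rule isCont_o2[where f = "\<lambda>t. t + a" and g = F, OF _ integral_curve_at_isCont[OF I]])
    fix c assume "c \<in> A" "F (s + a) \<in> chart_dom c"
    from integral_curve_at_deriv[OF I this]
    show "((\<lambda>t. coord c (F (t + a))) has_field_derivative W c (coord c (F (s + a)))) (at s)"
      by (simp add: DERIV_shift)
  qed
qed

lemma integral_curve_const:
  assumes "c \<in> A" "p \<in> chart_dom c" "W c (coord c p) = 0"
  shows "integral_curve (\<lambda>_. p) S"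
proof (rule integral_curveI)
  fix s show "integral_curve_at (\<lambda>_. p) s"
    by (rule integral_curve_at_oneI[OF _ assms(1,2)]) (simp_all add: assms(3))
qed

section \<open>Uniqueness and completeness of the complex flow\<close>

lemma integral_curve_unique_locally:
  assumes F: "integral_curve F S" and G: "integral_curve G S" and S: "open S" and s: "s \<in> S" "F s = G s"
  shows "\<exists>T. open T \<and> s \<in> T \<and> T \<subseteq> S \<and> (\<forall>t\<in>T. F t = G t)"
proof -
  obtain c where c: "c \<in> A" "F s \<in> chart_dom c" by (rule ex_chart)
  have opn: "open {t \<in> S. F t \<in> chart_dom c}" "open {t \<in> S. G t \<in> chart_dom c}"
    using continuous_on_open_vimage[OF S, of F] integral_curve_continuous_on[OF F]
      continuous_on_open_vimage[OF S, of G] integral_curve_continuous_on[OF G] open_chart_dom[OF c(1)]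
    by (simp_all add: vimage_def Int_def conj_commute)
  then have "open ({t \<in> S. F t \<in> chart_dom c} \<inter> {t \<in> S. G t \<in> chart_dom c})" by (rule open_Int)
  moreover have "s \<in> {t \<in> S. F t \<in> chart_dom c} \<inter> {t \<in> S. G t \<in> chart_dom c}" using s c(2) by simp
  ultimately obtain e where e: "0 < e" "ball s e \<subseteq> {t \<in> S. F t \<in> chart_dom c} \<inter> {t \<in> S. G t \<in> chart_dom c}"
    by (rule openE)
  have in_e: "t \<in> S" "F t \<in> chart_dom c" "G t \<in> chart_dom c" if "t \<in> ball s e" for t
    using e(2) that by auto
  obtain d where d: "0 < d" "d \<le> e" "\<And>t. t \<in> ball s d \<Longrightarrow> coord c (F t) = coord c (G t)"
  proof (rule holomorphic_flow_unique_locally[OF vf_holomorphic[OF c(1)] open_chart_range[OF c(1)],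
        of s e "\<lambda>t. coord c (F t)" "\<lambda>t. coord c (G t)"])
    show "((\<lambda>t. coord c (F t)) has_field_derivative W c (coord c (F t))) (at t)" if "t \<in> ball s e" for t
      by (rule integral_curve_at_deriv[OF integral_curveD[OF F in_e(1)[OF that]] c(1) in_e(2)[OF that]])
    show "((\<lambda>t. coord c (G t)) has_field_derivative W c (coord c (G t))) (at t)" if "t \<in> ball s e" for t
      by (rule integral_curve_at_deriv[OF integral_curveD[OF G in_e(1)[OF that]] c(1) in_e(3)[OF that]])
    show "coord c (F s) = coord c (G s)" using s by simp
    show "coord c (F s) \<in> chart_range c" by (rule coord_in_range[OF c(2)])
  qed (use e(1) that in auto)
  have sub: "ball s d \<subseteq> ball s e" using d(2) by auto
  have "F t = G t" if t: "t \<in> ball s d" for t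
  proof -
    have "t \<in> ball s e" using t sub by blast
    from in_e(2,3)[OF this] show ?thesis
      using d(3)[OF t] chart_inv_coord[OF c(1)] by metis
  qed
  then show ?thesis using d(1) sub in_e(1) by (intro exI[of _ "ball s d"]) auto
qed

text \<open>The set of coincidence is open by local uniqueness, and its complement is open because
  limits in a Hausdorff space are unique; connectedness finishes the argument.\<close>

lemma integral_curve_unique:
  assumes F: "integral_curve F S" and G: "integral_curve G S" and S: "open S" "connected S"
    and s: "s \<in> S" "F s = G s" and t: "t \<in> S"
  shows "F t = G t"
proof -
  let ?U = "{t \<in> S. F t = G t}" and ?V = "{t \<in> S. F t \<noteq> G t}"
  have U: "open ?U"
  proof (rule open_subopen[THEN iffD2], intro ballI)
    show "\<exists>T. open T \<and> x \<in> T \<and> T \<subseteq> ?U" if "x \<in> ?U" for x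
      using integral_curve_unique_locally[OF F G S(1), of x] that by blast
  qed
  have V: "open ?V"
  proof (rule open_subopen[THEN iffD2], intro ballI)
    fix x assume x: "x \<in> ?V"
    then obtain N M where N: "open N" "open M" "F x \<in> N" "G x \<in> M" "N \<inter> M = {}"
      using hausdorff[of "F x" "G x"] by blast
    let ?T = "(F -` N \<inter> S) \<inter> (G -` M \<inter> S)"
    have "open ?T"
      using continuous_on_open_vimage[OF S(1), of F] integral_curve_continuous_on[OF F]
        continuous_on_open_vimage[OF S(1), of G] integral_curve_continuous_on[OF G] N(1,2)
      by (simp add: open_Int)
    moreover have "x \<in> ?T" using x N by simp
    moreover have "?T \<subseteq> ?V" using N(5) by auto
    ultimately show "\<exists>T. open T \<and> x \<in> T \<and> T \<subseteq> ?V" by blast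
  qed
  have "?V \<inter> S = {} \<or> ?U \<inter> S = {}"
    using connectedD[OF S(2) V U] by auto
  then show ?thesis using s t by auto
qed

lemma integral_curve_uniform_existence:
  obtains \<delta> where "0 < \<delta>" "\<And>x. \<exists>F. F 0 = x \<and> integral_curve F (ball 0 \<delta>)"
proof -
  define P where "P N d \<longleftrightarrow> open N \<and> 0 < d \<and> (\<forall>y\<in>N. \<exists>F. F 0 = y \<and> integral_curve F (ball 0 d))" for N :: "'a set" and d :: real
  have ex: "\<exists>N d. x \<in> N \<and> P N d" for x :: 'a
  proof -
    obtain c where c: "c \<in> A" "x \<in> chart_dom c" by (rule ex_chart)
    obtain r d where rd: "0 < r" "0 < d" "ball (coord c x) r \<subseteq> chart_range c"
      "\<And>y. y \<in> ball (coord c x) r \<Longrightarrow> \<exists>g. g 0 = y \<and> (\<forall>t\<in>ball 0 d. g t \<in> chart_range c \<and> (g has_field_derivative W c (g t)) (at t))"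
      using holomorphic_flow_locally_uniform[OF vf_holomorphic[OF c(1)] open_chart_range[OF c(1)] coord_in_range[OF c(2)]] by metis
    let ?N = "chart_inv c ` ball (coord c x) r"
    have "open ?N" by (rule open_chart_inv_image[OF c(1) open_ball rd(3)])
    moreover have "x \<in> ?N" using chart_inv_coord[OF c] rd(1) by (metis centre_in_ball imageI)
    moreover have "\<exists>F. F 0 = y \<and> integral_curve F (ball 0 d)" if "y \<in> ?N" for y
    proof -
      from that obtain z where z: "z \<in> ball (coord c x) r" "y = chart_inv c z" by blast
      obtain g where g: "g 0 = z" "\<And>t. t \<in> ball 0 d \<Longrightarrow> g t \<in> chart_range c"
        "\<And>t. t \<in> ball 0 d \<Longrightarrow> (g has_field_derivative W c (g t)) (at t)" using rd(4)[OF z(1)] by blast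
      have "integral_curve (\<lambda>t. chart_inv c (g t)) (ball 0 d)"
        by (rule integral_curve_chart[OF c(1) g(2,3) open_ball])
      then show ?thesis using g(1) z(2) by (intro exI[of _ "\<lambda>t. chart_inv c (g t)"]) simp
    qed
    ultimately show ?thesis unfolding P_def using rd(2) by blast
  qed
  then obtain N d where Nd: "\<And>x::'a. x \<in> N x" "\<And>x. P (N x) (d x)" by metis
  have opn: "open (N x)" for x using Nd(2)[of x] unfolding P_def by blast
  obtain C where C: "finite C" "UNIV \<subseteq> (\<Union>x\<in>C. N x)"
    using compactE_image[OF compact_UNIV, of UNIV N] opn Nd(1) by (metis UNIV_I UN_I subsetI)
  \<comment> \<open>The additional element 1 keeps \<open>Min\<close> from being applied to the
    empty set.\<close>
  define \<delta> where "\<delta> = Min (insert 1 (d ` C))"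
  have dpos: "0 < d x" for x using Nd(2)[of x] unfolding P_def by blast
  show ?thesis
  proof (rule that)
    show "0 < \<delta>" unfolding \<delta>_def using C(1) dpos by simp
    fix y :: 'a
    obtain x where x: "x \<in> C" "y \<in> N x" using C(2) by blast
    have "\<exists>F. F 0 = y \<and> integral_curve F (ball 0 (d x))" using Nd(2)[of x] x(2) unfolding P_def by blast
    then obtain F where F: "F 0 = y" "integral_curve F (ball 0 (d x))" by blast
    have "\<delta> \<le> d x" unfolding \<delta>_def using C(1) x(1) by simp
    then have "ball 0 \<delta> \<subseteq> ball (0::complex) (d x)" by auto
    then show "\<exists>F. F 0 = y \<and> integral_curve F (ball 0 \<delta>)" using F integral_curve_subset by blast
  qed
qed

text \<open>In the chart the derivative of the curve is the value of \<open>W\<close>. Where it is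
  nonzero, the curve is locally injective and the open mapping theorem applies: nonconstant complex
  orbits are open in the surface.\<close>

lemma integral_curve_open_image:
  assumes F: "integral_curve F S" and S: "open S" and s: "s \<in> S" and c: "c \<in> A" "F s \<in> chart_dom c" and nz: "W c (coord c (F s)) \<noteq> 0"
  obtains r where "0 < r" "ball s r \<subseteq> S" "F ` ball s r \<subseteq> chart_dom c" "inj_on (\<lambda>t. coord c (F t)) (ball s r)"
    "(\<lambda>t. coord c (F t)) holomorphic_on ball s r" "open (F ` ball s r)"
proof -
  let ?f = "\<lambda>t. coord c (F t)"
  let ?T = "F -` chart_dom c \<inter> S"
  have T: "open ?T"
    using continuous_on_open_vimage[OF S, of F] integral_curve_continuous_on[OF F] open_chart_dom[OF c(1)] by simp
  have sT: "s \<in> ?T" using s c(2) by simp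
  have der: "(?f has_field_derivative W c (?f t)) (at t)" if "t \<in> ?T" for t
    using that integral_curve_at_deriv[OF integral_curveD[OF F] c(1)] by simp
  have hol: "?f holomorphic_on ?T"
    unfolding holomorphic_on_open[OF T] by (intro ballI exI) (rule der)
  have "deriv ?f s \<noteq> 0" using DERIV_imp_deriv[OF der[OF sT]] nz by simp
  then obtain r where r: "0 < r" "ball s r \<subseteq> ?T" "inj_on ?f (ball s r)"
    using has_complex_derivative_locally_injective[OF hol sT T] by metis
  have hol': "?f holomorphic_on ball s r" by (rule holomorphic_on_subset[OF hol r(2)])
  have opn: "open (?f ` ball s r)" by (rule open_mapping_thm3[OF hol' open_ball r(3)])
  have Fdom: "F ` ball s r \<subseteq> chart_dom c" using r(2) by auto
  have in_dom: "F t \<in> chart_dom c" if "t \<in> ball s r" for t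
    by (rule subsetD[OF Fdom imageI[OF that]])
  have "?f ` ball s r \<subseteq> chart_range c" by (intro image_subsetI coord_in_range in_dom)
  then have "open (chart_inv c ` ?f ` ball s r)" by (rule open_chart_inv_image[OF c(1) opn])
  moreover have "chart_inv c ` ?f ` ball s r = F ` ball s r"
    unfolding image_image by (rule image_cong[OF refl chart_inv_coord[OF c(1) in_dom]])
  ultimately have "open (F ` ball s r)" by simp
  then show ?thesis using that[OF r(1) _ Fdom r(3) hol'] r(2) by blast
qed

text \<open>A time beyond the half plane is reached by starting at \<open>F (s - t)\<close> and
  flowing for the fixed time \<open>t = \<delta> / 2\<close>. Since \<open>\<delta>\<close> comes
  from compactness, the gain does not depend on \<open>\<rho>\<close> or \<open>F\<close>.\<close>

lemma integral_curve_extend: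
  obtains t :: real where "0 < t"
    "\<And>\<rho> F. integral_curve F {s. Re s < \<rho>} \<Longrightarrow> \<exists>G. integral_curve G {s. Re s < \<rho> + t} \<and> (\<forall>s. Re s < \<rho> \<longrightarrow> G s = F s)"
proof -
  obtain \<delta> where \<delta>: "0 < \<delta>" "\<And>x. \<exists>F. F 0 = x \<and> integral_curve F (ball 0 \<delta>)"
    by (rule integral_curve_uniform_existence) (rule that; assumption)
  from \<delta>(2) obtain C where C: "\<And>x. C x 0 = x" "\<And>x. integral_curve (C x) (ball 0 \<delta>)" by metis
  define t where "t = \<delta> / 2"
  have t: "0 < t" "t < \<delta>" using \<delta>(1) by (simp_all add: t_def)
  have norm_t: "cmod (of_real t) = t" using t(1) by simp
  show ?thesis
  proof (rule that[OF t(1)])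
    fix \<rho> and F assume F: "integral_curve F {s. Re s < \<rho>}"
    define G where "G s = C (F (s - of_real t)) (of_real t)" for s
    have G_eq: "G s = F s" if s: "Re s < \<rho>" for s
    proof -
      let ?a = "s - of_real t"
      let ?S = "ball 0 \<delta> \<inter> {\<tau>. Re \<tau> < \<rho> - Re ?a}"
      have a: "Re ?a < \<rho>" using s t(1) by simp
      have 1: "integral_curve (C (F ?a)) ?S" by (rule integral_curve_subset[OF C(2)]) simp
      have 2: "integral_curve (\<lambda>\<tau>. F (\<tau> + ?a)) ?S"
        by (rule integral_curve_subset[OF integral_curve_shift[OF F]]) auto
      have "C (F ?a) (of_real t) = F (of_real t + ?a)"
      proof (rule integral_curve_unique[OF 1 2])
        show "open ?S" by (intro open_Int open_ball open_halfspace_Re_lt)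
        show "connected ?S" by (intro convex_connected convex_Int convex_ball convex_halfspace_Re_lt)
        show "0 \<in> ?S" using a \<delta>(1) by simp
        show "C (F ?a) 0 = F (0 + ?a)" using C(1) by simp
        show "of_real t \<in> ?S" using t s by simp
      qed
      then show ?thesis by (simp add: G_def)
    qed
    have "integral_curve G {s. Re s < \<rho> + t}"
    proof (rule integral_curveI)
      fix s1 assume "s1 \<in> {s. Re s < \<rho> + t}"
      then have s1: "Re s1 - t < \<rho>" by simp
      define a where "a = s1 - of_real t"
      define \<epsilon> where "\<epsilon> = min t (\<rho> - Re a)"
      have \<epsilon>: "0 < \<epsilon>" "\<epsilon> \<le> t" "\<epsilon> \<le> \<rho> - Re a" using s1 t(1) by (auto simp: \<epsilon>_def a_def)
      \<comment> \<open>In the definition of \<open>G\<close> the starting point moves with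
        \<open>s\<close>. Uniqueness replaces it near \<open>s1\<close> by the fixed starting point
        \<open>F a\<close>: flowing from \<open>F a\<close> for the time \<open>u = s - s1\<close>
        leads to \<open>F (s - t)\<close>, and flowing on for the time \<open>t\<close> gives
        \<open>G s\<close>. So \<open>G\<close> is locally a single flow curve.\<close>
      have step: "G s = C (F a) (s + (of_real t - s1))" if s: "s \<in> ball s1 \<epsilon>" for s
      proof -
        define u where "u = s - s1"
        have u: "cmod u < \<epsilon>" using s by (simp add: u_def dist_norm norm_minus_commute)
        have sub: "ball (0::complex) \<epsilon> \<subseteq> ball 0 \<delta>" using \<epsilon>(2) t(2) by auto
        have 1: "integral_curve (C (F a)) (ball 0 \<epsilon>)" by (rule integral_curve_subset[OF C(2) sub])
        have 2: "integral_curve (\<lambda>\<sigma>. F (\<sigma> + a)) (ball 0 \<epsilon>)"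
        proof (rule integral_curve_subset[OF integral_curve_shift[OF F]], rule subsetI)
          fix x :: complex assume "x \<in> ball 0 \<epsilon>"
          then have "Re x < \<epsilon>" using complex_Re_le_cmod[of x] by simp
          then show "x \<in> {t. t + a \<in> {s. Re s < \<rho>}}" using \<epsilon>(3) by simp
        qed
        have "C (F a) u = F (u + a)"
          by (rule integral_curve_unique[OF 1 2 open_ball connected_ball, of 0]) (use \<epsilon>(1) C(1) u in simp_all)
        then have Cu: "C (F a) u = F (s - of_real t)" by (simp add: u_def a_def)
        let ?S = "ball 0 \<delta> \<inter> ball (- u) \<delta>"
        have 3: "integral_curve (C (F (s - of_real t))) ?S" by (rule integral_curve_subset[OF C(2)]) simp
        have 4: "integral_curve (\<lambda>\<tau>. C (F a) (\<tau> + u)) ?S"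
          by (rule integral_curve_subset[OF integral_curve_shift[OF C(2)]]) (auto simp: dist_norm norm_minus_commute add.commute)
        have "C (F (s - of_real t)) (of_real t) = C (F a) (of_real t + u)"
        proof (rule integral_curve_unique[OF 3 4])
          show "open ?S" by (intro open_Int open_ball)
          show "connected ?S" by (intro convex_connected convex_Int convex_ball)
          show "0 \<in> ?S" using \<delta>(1) u \<epsilon>(2) t(2) by simp
          show "C (F (s - of_real t)) 0 = C (F a) (0 + u)" using C(1) Cu by simp
          have "cmod (- u - of_real t) \<le> cmod u + t" using norm_triangle_ineq4[of "- u" "of_real t"] norm_t by simp
          also have "\<dots> < \<delta>" using u \<epsilon>(2) by (simp add: t_def)
          finally show "of_real t \<in> ?S" using t norm_t by (simp add: dist_norm)
        qed
        then show ?thesis by (simp add: G_def u_def algebra_simps)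
      qed
      have "integral_curve (\<lambda>s. C (F a) (s + (of_real t - s1))) (ball s1 \<epsilon>)"
      proof (rule integral_curve_subset[OF integral_curve_shift[OF C(2)]], rule subsetI)
        fix s assume "s \<in> ball s1 \<epsilon>"
        then have "cmod (s - s1) < \<epsilon>" by (simp add: dist_norm norm_minus_commute)
        moreover have "cmod (s + (of_real t - s1)) \<le> cmod (s - s1) + t"
          using norm_triangle_ineq[of "s - s1" "of_real t"] norm_t by (simp add: algebra_simps)
        ultimately have "cmod (s + (of_real t - s1)) < \<delta>" using \<epsilon>(2) by (simp add: t_def)
        then show "s \<in> {s. s + (of_real t - s1) \<in> ball 0 \<delta>}" by simp
      qed
      then have "integral_curve G (ball s1 \<epsilon>)"
        by (rule integral_curve_cong_open[OF _ open_ball]) (rule step[symmetric])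
      then show "integral_curve_at G s1" by (rule integral_curveD) (use \<epsilon>(1) in simp)
    qed
    then show "\<exists>G. integral_curve G {s. Re s < \<rho> + t} \<and> (\<forall>s. Re s < \<rho> \<longrightarrow> G s = F s)"
      using G_eq by blast
  qed
qed

text \<open>Every extension widens the half plane by the same amount \<open>t\<close>, so countably
  many exhaust the plane, and later curves agree with earlier ones where both are defined.\<close>

lemma integral_curve_entire:
  assumes F: "integral_curve F {s. Re s < \<rho>}"
  obtains G where "integral_curve G UNIV" "\<And>s. Re s < \<rho> \<Longrightarrow> G s = F s"
proof -
  obtain t :: real where t: "0 < t" "\<And>\<rho> F. integral_curve F {s. Re s < \<rho>} \<Longrightarrow>
      \<exists>G. integral_curve G {s. Re s < \<rho> + t} \<and> (\<forall>s. Re s < \<rho> \<longrightarrow> G s = F s)"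
    by (rule integral_curve_extend) (rule that; assumption)
  define H where "H n = \<rho> + real n * t" for n
  have Hmono: "H m \<le> H n" if "m \<le> n" for m n using that t(1) by (simp add: H_def)
  have "\<exists>g. \<forall>n. (integral_curve (g n) {s. Re s < H n} \<and> (\<forall>s. Re s < \<rho> \<longrightarrow> g n s = F s)) \<and>
      (\<forall>s. Re s < H n \<longrightarrow> g (Suc n) s = g n s)"
  proof (rule dependent_nat_choice[where P = "\<lambda>n g. integral_curve g {s. Re s < H n} \<and> (\<forall>s. Re s < \<rho> \<longrightarrow> g s = F s)"
       and Q = "\<lambda>n g h. \<forall>s. Re s < H n \<longrightarrow> h s = g s"])
    show "\<exists>g. integral_curve g {s. Re s < H 0} \<and> (\<forall>s. Re s < \<rho> \<longrightarrow> g s = F s)"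
      using F by (intro exI[of _ F]) (simp add: H_def)
    fix g n assume g: "integral_curve g {s. Re s < H n} \<and> (\<forall>s. Re s < \<rho> \<longrightarrow> g s = F s)"
    then obtain h where h: "integral_curve h {s. Re s < H n + t}" "\<forall>s. Re s < H n \<longrightarrow> h s = g s"
      using t(2) by blast
    have "H n + t = H (Suc n)" by (simp add: H_def algebra_simps)
    moreover have "h s = F s" if "Re s < \<rho>" for s
    proof -
      have "0 \<le> real n * t" using t(1) by simp
      then have "Re s < H n" using that unfolding H_def by linarith
      then show ?thesis using h(2) g that by simp
    qed
    ultimately show "\<exists>h. (integral_curve h {s. Re s < H (Suc n)} \<and> (\<forall>s. Re s < \<rho> \<longrightarrow> h s = F s)) \<and> (\<forall>s. Re s < H n \<longrightarrow> h s = g s)"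
      using h by (intro exI[of _ h]) simp
  qed
  then obtain g where g: "\<And>n. integral_curve (g n) {s. Re s < H n}" "\<And>n s. Re s < \<rho> \<Longrightarrow> g n s = F s"
    "\<And>n s. Re s < H n \<Longrightarrow> g (Suc n) s = g n s" by blast
  have g_eq: "g n s = g m s" if "m \<le> n" "Re s < H m" for m n s
    using that(1)
  proof (induction n rule: dec_induct)
    case (step n)
    have "Re s < H n" using that(2) Hmono[OF step.hyps(1)] by simp
    then show ?case using g(3) step.IH by simp
  qed simp
  have ex: "\<exists>n. Re s < H n" for s
  proof -
    obtain n where "Re s - \<rho> < real n * t" using ex_less_of_nat_mult[OF t(1)] by blast
    then have "Re s < H n" by (simp add: H_def)
    then show ?thesis ..
  qed
  define G where "G s = g (LEAST n. Re s < H n) s" for s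
  have G: "g n s = G s" if "Re s < H n" for n s
    unfolding G_def by (rule g_eq[OF Least_le[of "\<lambda>n. Re s < H n", OF that] LeastI[of "\<lambda>n. Re s < H n", OF that]])
  have "integral_curve G UNIV"
  proof (rule integral_curveI)
    fix s :: complex
    obtain n where n: "Re s < H n" using ex by blast
    have "integral_curve G {s. Re s < H n}"
      by (rule integral_curve_cong_open[OF g(1) open_halfspace_Re_lt]) (simp add: G)
    then show "integral_curve_at G s" by (rule integral_curveD) (simp add: n)
  qed
  moreover have "G s = F s" if "Re s < \<rho>" for s
    using G[of s 0] g(2)[OF that, of 0] that by (simp add: H_def)
  ultimately show ?thesis using that by blast
qed

end

text \<open>The orbit through the punctured neighbourhood of a zero \<open>p\<close> of \<open>W\<close> with \<open>W' = 1\<close>: in the linearizing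
  coordinate the flow is \<open>exp s\<close>.\<close>

locale linearized_orbit = compact_surface_vf A W for A :: "'a::{t2_space, second_countable_topology} chart set" and W +
  fixes c :: "'a chart" and p :: 'a and G :: "complex \<Rightarrow> 'a" and \<psi> :: "complex \<Rightarrow> complex" and R :: real
  assumes c: "c \<in> A" and p: "p \<in> chart_dom c" and R: "0 < R"
    and curve: "integral_curve G UNIV"
    and G_eq: "\<And>s. exp s \<in> ball 0 R \<Longrightarrow> G s = chart_inv c (\<psi> (exp s))"
    and psi0: "\<psi> 0 = coord c p" and psi_inj: "inj_on \<psi> (ball 0 R)" and psi_range: "\<psi> ` ball 0 R \<subseteq> chart_range c"
    and psi_cont: "isCont \<psi> 0"

text \<open>The relation \<open>t * \<psi>'(t) = W (\<psi> t)\<close> says that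
  \<open>\<psi> \<circ> exp\<close> solves the flow equation. It is defined on the half plane
  \<open>Re s < ln R\<close>, which \<open>exp\<close> maps into the disc, and completeness extends
  it to all times.\<close>

lemma (in compact_surface_vf) linearized_orbit_exists:
  assumes c: "c \<in> A" and p: "p \<in> chart_dom c" and zero: "W c (coord c p) = 0" and one: "deriv (W c) (coord c p) = 1"
  shows "\<exists>G \<psi> R. linearized_orbit A W c p G \<psi> R"
proof -
  obtain R \<psi> where \<psi>: "0 < R" "\<psi> 0 = coord c p" "inj_on \<psi> (ball 0 R)" "\<psi> ` ball 0 R \<subseteq> chart_range c"
    "\<And>t. t \<in> ball 0 R \<Longrightarrow> \<exists>D. (\<psi> has_field_derivative D) (at t) \<and> t * D = W c (\<psi> t)"
    using holomorphic_linearization[OF vf_holomorphic[OF c] open_chart_range[OF c] coord_in_range[OF p] zero one] by metis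
  let ?H = "{s. Re s < ln R}"
  have exp_in: "exp s \<in> ball 0 R \<longleftrightarrow> Re s < ln R" for s
    using \<psi>(1) exp_less_cancel_iff[of "Re s" "ln R"] by simp
  have F: "integral_curve (\<lambda>s. chart_inv c (\<psi> (exp s))) ?H"
  proof (rule integral_curve_chart[OF c _ _ open_halfspace_Re_lt])
    fix s assume "s \<in> ?H"
    then have s: "exp s \<in> ball 0 R" using exp_in by simp
    show "\<psi> (exp s) \<in> chart_range c" using \<psi>(4) s by blast
    obtain D where D: "(\<psi> has_field_derivative D) (at (exp s))" "exp s * D = W c (\<psi> (exp s))" using \<psi>(5)[OF s] by blast
    have "(\<psi> \<circ> exp has_field_derivative D * exp s) (at s)" by (rule DERIV_chain[OF D(1) DERIV_exp])
    then show "((\<lambda>s. \<psi> (exp s)) has_field_derivative W c (\<psi> (exp s))) (at s)"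
      using D(2) by (simp add: o_def mult.commute)
  qed
  obtain G where G: "integral_curve G UNIV" "\<And>s. Re s < ln R \<Longrightarrow> G s = chart_inv c (\<psi> (exp s))"
    by (rule integral_curve_entire[OF F]) (rule that; assumption)
  obtain D where "(\<psi> has_field_derivative D) (at 0)" using \<psi>(5)[of 0] \<psi>(1) by auto
  then have "isCont \<psi> 0" by (rule DERIV_isCont)
  then have "linearized_orbit A W c p G \<psi> R"
    by unfold_locales (use c p \<psi>(1-4) G exp_in in auto)
  then show ?thesis by blast
qed

section \<open>Geometry of the orbit emanating from a simple zero\<close>

context linearized_orbit
begin

text \<open>Shifting time by \<open>ln (R / 2) - m\<close> moves every \<open>s\<close> with
  \<open>Re s \<le> m\<close> into the linear regime. Questions about arbitrary times are reduced to
  explicit ones this way.\<close>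

lemma small_exp: "exp (complex_of_real (ln (R / 2) - m) + s) \<in> ball 0 R" if "Re s \<le> m"
proof -
  have "cmod (exp (complex_of_real (ln (R / 2) - m) + s)) = exp (ln (R / 2)) * exp (Re s - m)"
    by (simp add: exp_add[symmetric] algebra_simps)
  also have "\<dots> \<le> exp (ln (R / 2)) * 1" using that by (intro mult_left_mono) auto
  also have "\<dots> < R" using R by simp
  finally show ?thesis by simp
qed

text \<open>A period of \<open>exp\<close> is a period of \<open>G\<close> in the linear regime,
  where \<open>G\<close> depends on \<open>exp s\<close> only; uniqueness of integral curves carries
  it to all times.\<close>

lemma orbit_periodic:
  assumes "exp s = exp s'" shows "G s = G s'"
proof -
  define a where "a = s' - s"
  have a: "exp a = 1" using assms by (simp add: a_def exp_diff)
  have sh: "integral_curve (\<lambda>t. G (t + a)) UNIV" using integral_curve_shift[OF curve, of a] by simp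
  let ?t = "complex_of_real (ln (R / 2) - 0) + 0"
  have t: "exp ?t \<in> ball 0 R" by (rule small_exp) simp
  have t': "exp (?t + a) = exp ?t" using a by (simp add: exp_add)
  then have "G ?t = G (?t + a)" using G_eq[OF t] G_eq[of "?t + a"] t by simp
  from integral_curve_unique[OF curve sh open_UNIV connected_UNIV UNIV_I this UNIV_I, of s]
  show ?thesis by (simp add: a_def)
qed

text \<open>If \<open>G s = G s'\<close>, the two curves shifted by \<open>s\<close> and
  \<open>s'\<close> coincide. At a common shift into the linear regime, injectivity of
  \<open>\<psi>\<close> compares the exponentials, and the common factor cancels.\<close>

lemma orbit_inj:
  assumes "G s = G s'" shows "exp s = exp s'"
proof -
  have 1: "integral_curve (\<lambda>t. G (t + s)) UNIV" and 2: "integral_curve (\<lambda>t. G (t + s')) UNIV"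
    using integral_curve_shift[OF curve] by simp_all
  define t where "t = complex_of_real (ln (R / 2) - max (Re s) (Re s'))"
  have eq: "G (t + s) = G (t + s')"
    using integral_curve_unique[OF 1 2 open_UNIV connected_UNIV, of 0 t] assms by simp
  have in_ball: "exp (t + s) \<in> ball 0 R" "exp (t + s') \<in> ball 0 R"
    unfolding t_def by (rule small_exp; simp)+
  then have "chart_inv c (\<psi> (exp (t + s))) = chart_inv c (\<psi> (exp (t + s')))"
    using eq G_eq by simp
  moreover have "\<psi> (exp (t + s)) \<in> chart_range c" "\<psi> (exp (t + s')) \<in> chart_range c"
    using psi_range in_ball by auto
  ultimately have "\<psi> (exp (t + s)) = \<psi> (exp (t + s'))" using coord_chart_inv[OF c] by metis
  then have "exp (t + s) = exp (t + s')" using psi_inj in_ball by (simp only: inj_on_eq_iff)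
  then show ?thesis by (simp add: exp_add)
qed

text \<open>At a zero the constant curve would be the integral curve, so
  \<open>G (s + 1) = G s\<close>; but 1 is not a period of \<open>exp\<close>.\<close>

lemma orbit_nonzero:
  assumes d: "d \<in> A" "G s \<in> chart_dom d" shows "W d (coord d (G s)) \<noteq> 0"
proof
  assume zero: "W d (coord d (G s)) = 0"
  have "G (s + 1) = G s"
    by (rule integral_curve_unique[OF curve integral_curve_const[OF d zero] open_UNIV connected_UNIV, of s]) simp_all
  then have "exp (s + 1) = exp s" by (rule orbit_inj)
  then have "exp (1::complex) = 1" by (simp add: exp_add)
  then have "cmod (exp 1) = 1" by simp
  then show False by simp
qed

lemma orbit_near_zero:
  assumes N: "open N" "p \<in> N"
  obtains m where "\<And>s. Re s < m \<Longrightarrow> G s \<in> N"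
proof -
  have p0: "chart_inv c (\<psi> 0) = p" using psi0 chart_inv_coord[OF c p] by simp
  have "isCont (\<lambda>z. chart_inv c (\<psi> z)) 0"
    by (rule isCont_o2[OF psi_cont]) (use isCont_chart_inv[OF c coord_in_range[OF p]] psi0 in simp)
  then obtain T where T: "open T" "0 \<in> T" "\<And>z. z \<in> T \<Longrightarrow> chart_inv c (\<psi> z) \<in> N"
    using N p0 unfolding continuous_at_open by metis
  obtain e where e: "0 < e" "ball 0 e \<subseteq> T" using T(1,2) openE by blast
  show ?thesis
  proof (rule that[of "ln (min e R)"])
    fix s assume "Re s < ln (min e R)"
    then have "exp (Re s) < exp (ln (min e R))" by (simp only: exp_less_cancel_iff)
    also have "exp (ln (min e R)) = min e R" using e(1) R by (intro exp_ln) simp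
    finally have "exp s \<in> ball 0 e" "exp s \<in> ball 0 R" by simp_all
    then show "G s \<in> N" using G_eq T(3)[OF subsetD[OF e(2)]] by simp
  qed
qed

lemma orbit_open: "open (range G)"
proof (rule open_subopen[THEN iffD2], rule ballI)
  fix x assume "x \<in> range G"
  then obtain s where s: "x = G s" by blast
  obtain d where d: "d \<in> A" "G s \<in> chart_dom d" by (rule ex_chart)
  obtain r where r: "0 < r" "open (G ` ball s r)"
    by (rule integral_curve_open_image[OF curve open_UNIV UNIV_I d orbit_nonzero[OF d]])
  show "\<exists>T. open T \<and> x \<in> T \<and> T \<subseteq> range G"
    by (rule exI[of _ "G ` ball s r"]) (use r s in auto)
qed

text \<open>The flow curve through \<open>x\<close> covers a neighbourhood of \<open>x\<close> and
  hence meets the orbit. From the meeting point one flows back to \<open>x\<close>, staying on the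
  orbit by uniqueness.\<close>

lemma orbit_closure_regular:
  assumes x: "x \<in> closure (range G)" and d: "d \<in> A" "x \<in> chart_dom d" and nz: "W d (coord d x) \<noteq> 0"
  shows "x \<in> range G"
proof -
  obtain \<delta> where \<delta>: "0 < \<delta>" "\<And>x. \<exists>F. F 0 = x \<and> integral_curve F (ball 0 \<delta>)"
    by (rule integral_curve_uniform_existence) (rule that; assumption)
  obtain F where F: "F 0 = x" "integral_curve F (ball 0 \<delta>)" using \<delta>(2) by blast
  have F0: "F 0 \<in> chart_dom d" "W d (coord d (F 0)) \<noteq> 0" using d(2) nz F(1) by simp_all
  have z: "0 \<in> ball (0::complex) \<delta>" using \<delta>(1) by simp
  obtain r where r: "0 < r" "ball (0::complex) r \<subseteq> ball 0 \<delta>" "open (F ` ball 0 r)"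
    by (rule integral_curve_open_image[OF F(2) open_ball z d(1) F0]) (rule that; assumption)
  have "x \<in> F ` ball 0 r" using F(1) r(1) by (metis centre_in_ball imageI)
  then have "F ` ball 0 r \<inter> range G \<noteq> {}"
    using x r(3) open_Int_closure_eq_empty[of "F ` ball 0 r" "range G"] by blast
  then obtain \<tau> s where ts: "\<tau> \<in> ball 0 r" "F \<tau> = G s" by auto
  have \<tau>: "\<tau> \<in> ball 0 \<delta>" by (rule subsetD[OF r(2) ts(1)])
  let ?S = "{\<sigma>. \<sigma> + \<tau> \<in> ball 0 \<delta>}"
  have S_eq: "?S = ball (- \<tau>) \<delta>" by (auto simp: dist_norm norm_minus_commute add.commute)
  have 1: "integral_curve (\<lambda>\<sigma>. F (\<sigma> + \<tau>)) ?S" by (rule integral_curve_shift[OF F(2)])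
  have 2: "integral_curve (\<lambda>\<sigma>. G (\<sigma> + s)) ?S"
    using integral_curve_shift[OF curve, of s] by (rule integral_curve_subset) simp
  have "F (- \<tau> + \<tau>) = G (- \<tau> + s)"
  proof (rule integral_curve_unique[OF 1 2])
    show "open ?S" "connected ?S" unfolding S_eq by simp_all
    show "0 \<in> ?S" "- \<tau> \<in> ?S" using \<tau> \<delta>(1) by simp_all
    show "F (0 + \<tau>) = G (0 + s)" using ts(2) by simp
  qed
  then show ?thesis using F(1) by (metis add.left_inverse rangeI)
qed

text \<open>On a small punctured disc about \<open>q\<close> the field has no zeros, so by
  \<open>orbit_closure_regular\<close> being in the orbit and being in its closure are the same
  there. This splits the disc into two open parts; it is connected, and the orbit part is not
  empty.\<close>

lemma orbit_punctured:
  assumes q: "q \<in> closure (range G)" and d: "d \<in> A" "q \<in> chart_dom d" and zero: "W d (coord d q) = 0"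
    and U: "open U" "q \<in> U"
  obtains r where "0 < r" "ball (coord d q) r \<subseteq> chart_range d" "chart_inv d ` ball (coord d q) r \<subseteq> U"
    "\<And>w. w \<in> ball (coord d q) r - {coord d q} \<Longrightarrow> chart_inv d w \<in> range G"
proof -
  define w0 where "w0 = coord d q"
  have w0: "w0 \<in> chart_range d" "chart_inv d w0 = q"
    unfolding w0_def using coord_in_range[OF d(2)] chart_inv_coord[OF d] by simp_all
  have "open (chart_inv d -` U \<inter> chart_range d)" by (rule open_chart_inv_vimage[OF d(1) U(1)])
  moreover have "w0 \<in> chart_inv d -` U \<inter> chart_range d" using w0 U(2) by simp
  ultimately obtain r1 where r1: "0 < r1" "ball w0 r1 \<subseteq> chart_inv d -` U \<inter> chart_range d" by (rule openE)
  \<comment> \<open>Orbit points accumulate at \<open>q\<close>, and the field does not vanish at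
    them. So \<open>W d\<close> is not identically 0 near \<open>w0\<close>, and its zeros are
    isolated.\<close>
  have meet: "\<exists>w\<in>ball w0 r. w \<noteq> w0 \<and> chart_inv d w \<in> range G \<and> W d w \<noteq> 0" if r: "0 < r" "ball w0 r \<subseteq> chart_range d" for r
  proof -
    let ?N = "chart_inv d ` ball w0 r"
    have "open ?N" by (rule open_chart_inv_image[OF d(1) open_ball r(2)])
    moreover have "q \<in> ?N" using w0(2) r(1) by (metis centre_in_ball imageI)
    ultimately have "?N \<inter> range G \<noteq> {}"
      using q open_Int_closure_eq_empty[of ?N "range G"] by blast
    then obtain w s where w: "w \<in> ball w0 r" "chart_inv d w = G s" by auto
    have wr: "w \<in> chart_range d" using w(1) r(2) by blast
    have "W d (coord d (G s)) \<noteq> 0"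
      by (rule orbit_nonzero[OF d(1)]) (use chart_inv_in_dom[OF d(1) wr] w(2) in simp)
    then have nz: "W d w \<noteq> 0" using coord_chart_inv[OF d(1) wr] w(2) by simp
    then have "w \<noteq> w0" using zero by (auto simp: w0_def)
    then show ?thesis using w nz by auto
  qed
  have sub1: "ball w0 r1 \<subseteq> chart_range d" using r1(2) by blast
  obtain w1 where w1: "w1 \<in> ball w0 r1" "W d w1 \<noteq> 0" using meet[OF r1(1) sub1] by blast
  obtain r where r: "0 < r" "ball w0 r \<subseteq> ball w0 r1" "\<And>z. z \<in> ball w0 r - {w0} \<Longrightarrow> W d z \<noteq> 0"
    using isolated_zeros[OF holomorphic_on_subset[OF vf_holomorphic[OF d(1)] sub1] open_ball connected_ball _ _ w1] r1(1) zero
    unfolding w0_def by (metis centre_in_ball)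
  let ?D = "ball w0 r - {w0}"
  have Dr: "w \<in> chart_range d" if "w \<in> ?D" for w using that r(2) sub1 by blast
  have D_open: "open ?D" by auto
  have D_conn: "connected ?D" by (rule connected_punctured_ball) simp
  have cont: "continuous_on ?D (chart_inv d)"
    by (rule continuous_on_subset[OF continuous_on_chart_inv[OF d(1)]]) (use Dr in blast)
  let ?T = "chart_inv d -` range G \<inter> ?D" and ?T' = "chart_inv d -` (- closure (range G)) \<inter> ?D"
  have "open ?T" "open ?T'"
    using cont orbit_open D_open by (auto intro!: continuous_on_open_vimage[THEN iffD1, rule_format])
  moreover have "?T \<inter> ?T' \<inter> ?D = {}" using closure_subset[of "range G"] by blast
  moreover have "?D \<subseteq> ?T \<union> ?T'"
  proof
    fix w assume w: "w \<in> ?D"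
    show "w \<in> ?T \<union> ?T'"
    proof (cases "chart_inv d w \<in> closure (range G)")
      case True
      have "W d (coord d (chart_inv d w)) \<noteq> 0" using r(3)[OF w] coord_chart_inv[OF d(1) Dr[OF w]] by simp
      then have "chart_inv d w \<in> range G"
        by (rule orbit_closure_regular[OF True d(1) chart_inv_in_dom[OF d(1) Dr[OF w]]])
      then show ?thesis using w by blast
    next
      case False
      then show ?thesis using w by blast
    qed
  qed
  ultimately have "?T \<inter> ?D = {} \<or> ?T' \<inter> ?D = {}" using connectedD[OF D_conn] by metis
  moreover have "?T \<inter> ?D \<noteq> {}" using meet[OF r(1)] r(2) sub1 by blast
  ultimately have "?D \<subseteq> ?T" using \<open>?D \<subseteq> ?T \<union> ?T'\<close> by blast
  then have inG: "chart_inv d w \<in> range G" if "w \<in> ?D" for w using that by blast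
  show ?thesis
  proof (rule that[OF r(1), folded w0_def])
    show "ball w0 r \<subseteq> chart_range d" using r(2) sub1 by blast
    show "chart_inv d ` ball w0 r \<subseteq> U" using r(2) r1(2) by blast
    show "chart_inv d w \<in> range G" if "w \<in> ball w0 r - {w0}" for w using inG[OF that] .
  qed
qed

text \<open>The closure only adds zeros to the open orbit, and each of them comes with a full disc
  by \<open>orbit_punctured\<close>. Being open, closed and connected, the closure is a
  component.\<close>

lemma orbit_closure_open: "open (closure (range G))"
proof (rule open_subopen[THEN iffD2], rule ballI)
  fix q assume q: "q \<in> closure (range G)"
  obtain d where d: "d \<in> A" "q \<in> chart_dom d" by (rule ex_chart)
  show "\<exists>T. open T \<and> q \<in> T \<and> T \<subseteq> closure (range G)"
  proof (cases "W d (coord d q) = 0")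
    case True
    obtain r where r: "0 < r" "ball (coord d q) r \<subseteq> chart_range d"
      "\<And>w. w \<in> ball (coord d q) r - {coord d q} \<Longrightarrow> chart_inv d w \<in> range G"
      by (rule orbit_punctured[OF q d True open_UNIV UNIV_I]) (rule that; assumption)
    let ?N = "chart_inv d ` ball (coord d q) r"
    have "open ?N" by (rule open_chart_inv_image[OF d(1) open_ball r(2)])
    moreover have "q \<in> ?N" using chart_inv_coord[OF d] r(1) by (metis centre_in_ball imageI)
    moreover have "?N \<subseteq> closure (range G)"
    proof
      fix x assume "x \<in> ?N"
      then obtain w where w: "w \<in> ball (coord d q) r" "x = chart_inv d w" by blast
      show "x \<in> closure (range G)"
      proof (cases "w = coord d q")
        case True
        then show ?thesis using w(2) q chart_inv_coord[OF d] by simp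
      next
        case False
        then have "chart_inv d w \<in> range G" by (intro r(3)) (use w(1) in simp)
        then show ?thesis unfolding w(2) by (rule subsetD[OF closure_subset])
      qed
    qed
    ultimately show ?thesis by (rule_tac exI[of _ ?N]) (intro conjI)
  next
    case False
    then have "q \<in> range G" by (rule orbit_closure_regular[OF q d])
    then show ?thesis by (intro exI[of _ "range G"] conjI orbit_open closure_subset)
  qed
qed

lemma orbit_closure_start: "p \<in> closure (range G)"
  unfolding closure_iff_nhds_not_empty
proof (intro allI impI)
  fix X V assume "V \<subseteq> X" "open V" "p \<in> V"
  obtain m where m: "\<And>s. Re s < m \<Longrightarrow> G s \<in> V" by (rule orbit_near_zero[OF \<open>open V\<close> \<open>p \<in> V\<close>]) (rule that; assumption)
  have "G (of_real (m - 1)) \<in> V" by (rule m) simp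
  then show "range G \<inter> X \<noteq> {}" using \<open>V \<subseteq> X\<close> by blast
qed

end

text \<open>Here \<open>f\<close> is the orbit in a chart and \<open>a\<close> the value of the
  field. Locally \<open>h\<close> is \<open>exp (- k)\<close> for the holomorphic inverse
  \<open>k\<close> of \<open>f\<close>, and \<open>a * k' = 1\<close>; so \<open>h\<close> is an
  eigenfunction of the field with eigenvalue \<open>- 1\<close>.\<close>

lemma exp_uminus_inverse_derivative:
  fixes f h :: "complex \<Rightarrow> complex"
  assumes f: "f holomorphic_on ball s e" "inj_on f (ball s e)" and e: "0 < e"
    and a: "(f has_field_derivative a) (at s)" and T: "open T" "f s \<in> T"
    and h: "\<And>t. t \<in> ball s e \<Longrightarrow> f t \<in> T \<Longrightarrow> h (f t) = exp (- t)"
  shows "\<exists>D. (h has_field_derivative D) (at (f s)) \<and> a * D = - h (f s)"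
proof -
  obtain k where k: "k holomorphic_on f ` ball s e" "\<And>z. z \<in> ball s e \<Longrightarrow> deriv f z * deriv k (f z) = 1"
     "\<And>z. z \<in> ball s e \<Longrightarrow> k (f z) = z"
    by (rule holomorphic_has_inverse[OF f(1) open_ball f(2)]) (rule that; assumption)
  have opn: "open (f ` ball s e)" by (rule open_mapping_thm3[OF f(1) open_ball f(2)])
  have s_in: "s \<in> ball s e" using e by simp
  have w_in: "f s \<in> f ` ball s e" by (rule imageI[OF s_in])
  define D where "D = deriv k (f s)"
  have aD: "a * D = 1" using k(2)[OF s_in] DERIV_imp_deriv[OF a] by (simp add: D_def)
  have kD: "(k has_field_derivative D) (at (f s))"
    unfolding D_def by (rule holomorphic_derivI[OF k(1) opn w_in])
  have "((\<lambda>v. exp (- k v)) has_field_derivative exp (- k (f s)) * (- D)) (at (f s))"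
    by (rule DERIV_fun_exp[OF DERIV_minus[OF kD]])
  then have "(h has_field_derivative exp (- k (f s)) * (- D)) (at (f s))"
  proof (rule has_field_derivative_transform_within_open)
    show "open (f ` ball s e \<inter> T)" by (rule open_Int[OF opn T(1)])
    show "f s \<in> f ` ball s e \<inter> T" by (rule IntI[OF w_in T(2)])
    fix v assume v: "v \<in> f ` ball s e \<inter> T"
    then obtain t where t: "t \<in> ball s e" "v = f t" by blast
    then show "exp (- k v) = h v" using h[of t] v k(3)[of t] by simp
  qed
  moreover have "a * (exp (- k (f s)) * (- D)) = - (exp (- s) * (a * D))" using k(3)[OF s_in] by simp
  then have "a * (exp (- k (f s)) * (- D)) = - h (f s)" using aD h[OF s_in T(2)] by simp
  ultimately show ?thesis by blast
qed

context compact_surface_vf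
begin

text \<open>Differentiating the transformation law of \<open>W\<close> produces a term with the
  second derivative of the transition map, multiplied by \<open>W\<close>; it drops out at a
  zero.\<close>

lemma vf_deriv_at_zero:
  assumes c: "c \<in> A" "p \<in> chart_dom c" and d: "d \<in> A" "p \<in> chart_dom d" and zero: "W c (coord c p) = 0"
  shows "deriv (W d) (coord d p) = deriv (W c) (coord c p)"
proof -
  let ?\<phi> = "transition c d" and ?z = "coord c p"
  have z: "?z \<in> overlap c d" by (rule coord_in_overlap[OF c(2) d(2)])
  have \<phi>z: "?\<phi> ?z = coord d p" by (rule transition_coord[OF c])
  have 1: "(W d has_field_derivative deriv (W d) (coord d p)) (at (?\<phi> ?z))"
    unfolding \<phi>z by (rule holomorphic_derivI[OF vf_holomorphic[OF d(1)] open_chart_range[OF d(1)] coord_in_range[OF d(2)]])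
  have "(W d \<circ> ?\<phi> has_field_derivative deriv (W d) (coord d p) * deriv ?\<phi> ?z) (at ?z)"
    by (rule DERIV_chain[OF 1 transition_derivative[OF c(1) d(1) z]])
  then have A1: "((\<lambda>w. deriv ?\<phi> w * W c w) has_field_derivative deriv (W d) (coord d p) * deriv ?\<phi> ?z) (at ?z)"
    by (rule has_field_derivative_transform_within_open[OF _ open_overlap[OF c(1) d(1)] z])
       (simp add: vf_transform[OF c(1) d(1)])
  have "(deriv ?\<phi> has_field_derivative deriv (deriv ?\<phi>) ?z) (at ?z)"
    by (rule holomorphic_derivI[OF holomorphic_deriv[OF transition_holomorphic open_overlap] open_overlap]) (fact c(1) d(1) z)+
  moreover have "(W c has_field_derivative deriv (W c) ?z) (at ?z)"
    by (rule holomorphic_derivI[OF vf_holomorphic[OF c(1)] open_chart_range[OF c(1)] coord_in_range[OF c(2)]])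
  ultimately have "((\<lambda>w. deriv ?\<phi> w * W c w) has_field_derivative
      deriv (deriv ?\<phi>) ?z * W c ?z + deriv (W c) ?z * deriv ?\<phi> ?z) (at ?z)"
    by (rule DERIV_mult)
  from DERIV_unique[OF A1 this] show ?thesis
    using zero transition_deriv_nonzero[OF c(1) d(1) z] by simp
qed

end

context linearized_orbit
begin

text \<open>At \<open>p\<close> itself the derivative is 1. At any other zero it is
  \<open>- 1\<close>, since the orbit arrives there with the local coordinate
  \<open>exp (- s)\<close> instead of \<open>exp s\<close>; only the square is common to
  both.\<close>

lemma orbit_closure_zero:
  assumes one: "W c (coord c p) = 0" "deriv (W c) (coord c p) = 1"
    and q: "q \<in> closure (range G)" and d: "d \<in> A" "q \<in> chart_dom d" and zero: "W d (coord d q) = 0"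
  shows "(deriv (W d) (coord d q))\<^sup>2 = 1"
proof (cases "q = p")
  case True
  then show ?thesis using vf_deriv_at_zero[OF c p d(1)] d(2) one by simp
next
  case False
  then obtain N U where NU: "open N" "open U" "p \<in> N" "q \<in> U" "N \<inter> U = {}" using hausdorff[of p q] by metis
  obtain m where m: "\<And>s. Re s < m \<Longrightarrow> G s \<in> N" by (rule orbit_near_zero[OF NU(1,3)]) (rule that; assumption)
  define w0 where "w0 = coord d q"
  obtain r where r: "0 < r" "ball w0 r \<subseteq> chart_range d" "chart_inv d ` ball w0 r \<subseteq> U"
    "\<And>w. w \<in> ball w0 r - {w0} \<Longrightarrow> chart_inv d w \<in> range G"
    by (rule orbit_punctured[OF q d zero NU(2,4), folded w0_def]) (rule that; assumption)
  let ?B = "ball w0 r"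
  let ?D = "ball w0 r - {w0}"
  have w0B: "w0 \<in> ?B" using r(1) by simp
  have Dr: "w \<in> chart_range d" if "w \<in> ?D" for w using that r(2) by blast
  define \<sigma> where "\<sigma> w = (SOME s. chart_inv d w = G s)" for w
  have \<sigma>: "G (\<sigma> w) = chart_inv d w" if "w \<in> ?D" for w
  proof -
    have "\<exists>s. chart_inv d w = G s" using r(4)[OF that] by blast
    from someI_ex[OF this] show ?thesis by (simp add: \<sigma>_def)
  qed
  \<comment> \<open>The time \<open>\<sigma> w\<close> is chosen arbitrarily among those of the
    point, but \<open>exp (- \<sigma> w)\<close> does not depend on the choice because of
    \<open>orbit_inj\<close>.\<close>
  define h where "h w = exp (- \<sigma> w)" for w
  have h_eq: "h w = exp (- s)" if "w \<in> ?D" "G s = chart_inv d w" for w s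
  proof -
    have "exp (\<sigma> w) = exp s" by (rule orbit_inj) (simp add: \<sigma>[OF that(1)] that(2))
    then show ?thesis by (simp add: h_def exp_minus)
  qed
  \<comment> \<open>Times with real part below \<open>m\<close> lie in \<open>N\<close>, which is
    disjoint from the neighbourhood \<open>U\<close> of \<open>q\<close>. Boundedness then makes the
    singularity of \<open>h\<close> at \<open>w0\<close> removable.\<close>
  have h_bound: "cmod (h w) \<le> exp (- m)" if w: "w \<in> ?D" for w
  proof -
    have "chart_inv d w \<in> U" using w r(3) by blast
    then have "G (\<sigma> w) \<notin> N" using \<sigma>[OF w] NU(5) by auto
    then have "m \<le> Re (\<sigma> w)" using m[of "\<sigma> w"] by (meson not_le)
    then show ?thesis by (simp add: h_def)
  qed
  have h_deriv: "\<exists>D. (h has_field_derivative D) (at w) \<and> W d w * D = - h w" if w: "w \<in> ?D" for w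
  proof -
    let ?s = "\<sigma> w" and ?f = "\<lambda>t. coord d (G t)"
    have Gs: "G ?s = chart_inv d w" by (rule \<sigma>[OF w])
    have Gd: "G ?s \<in> chart_dom d" unfolding Gs by (rule chart_inv_in_dom[OF d(1) Dr[OF w]])
    have fs: "?f ?s = w" unfolding Gs by (rule coord_chart_inv[OF d(1) Dr[OF w]])
    obtain e where e: "0 < e" "G ` ball ?s e \<subseteq> chart_dom d" "inj_on ?f (ball ?s e)" "?f holomorphic_on ball ?s e"
      by (rule integral_curve_open_image[OF curve open_UNIV UNIV_I d(1) Gd orbit_nonzero[OF d(1) Gd]]) (rule that; assumption)
    have der: "(?f has_field_derivative W d (?f ?s)) (at ?s)"
      by (rule integral_curve_at_deriv[OF integral_curveD[OF curve UNIV_I] d(1) Gd])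
    have "\<exists>D. (h has_field_derivative D) (at (?f ?s)) \<and> W d (?f ?s) * D = - h (?f ?s)"
    proof (rule exp_uminus_inverse_derivative[OF e(4,3,1) der])
      show "open ?D" by auto
      show "?f ?s \<in> ?D" unfolding fs by (rule w)
      fix t assume t: "t \<in> ball ?s e" and tD: "coord d (G t) \<in> ?D"
      have "G t = chart_inv d (?f t)"
        by (rule chart_inv_coord[OF d(1), symmetric]) (rule subsetD[OF e(2) imageI[OF t]])
      then show "h (?f t) = exp (- t)" by (rule h_eq[OF tD])
    qed
    then show ?thesis unfolding fs .
  qed
  have D_open: "open ?D" by auto
  have h_hol: "h holomorphic_on ?D"
    unfolding holomorphic_on_open[OF D_open] using h_deriv by blast
  have "\<forall>\<^sub>F w in at w0. cmod (h w) \<le> exp (- m)"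
    unfolding eventually_at using r(1) h_bound by (intro exI[of _ r]) (simp add: dist_commute)
  moreover have "w0 \<in> interior ?B" using r(1) by (simp add: interior_open)
  ultimately obtain k where k: "k holomorphic_on ?B" "\<And>w. w \<in> ?D \<Longrightarrow> k w = h w"
    using holomorphic_on_extend_bounded[OF h_hol] by blast
  have k': "deriv k holomorphic_on ?B" by (rule holomorphic_deriv[OF k(1) open_ball])
  have WB: "W d holomorphic_on ?B" by (rule holomorphic_on_subset[OF vf_holomorphic[OF d(1)] r(2)])
  \<comment> \<open>The eigenvalue equation \<open>W k' = - k\<close> says \<open>E = 0\<close> off
    \<open>w0\<close>, and by continuity also at \<open>w0\<close>. There its value gives
    \<open>k w0 = 0\<close>, and its derivative gives \<open>(W' + 1) * k' = 0\<close>.\<close>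
  define E where "E = (\<lambda>w. W d w * deriv k w + k w)"
  have E_hol: "E holomorphic_on ?B" unfolding E_def by (intro holomorphic_intros WB k(1) k')
  have E_D: "E w = 0" if w: "w \<in> ?D" for w
  proof -
    obtain D where D: "(h has_field_derivative D) (at w)" "W d w * D = - h w" using h_deriv[OF w] by blast
    have "(k has_field_derivative D) (at w)"
      by (rule has_field_derivative_transform_within_open[OF D(1) D_open w]) (simp add: k(2))
    then show ?thesis using D(2) k(2)[OF w] by (simp add: E_def DERIV_imp_deriv)
  qed
  have E_0: "E w0 = 0"
  proof (rule LIM_unique)
    have "isCont E w0"
      using holomorphic_on_imp_continuous_on[OF E_hol] w0B by (simp add: continuous_on_eq_continuous_at)
    then show "E \<midarrow>w0\<rightarrow> E w0" by (simp add: isCont_def)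
    have "\<forall>\<^sub>F w in at w0. E w = 0"
      unfolding eventually_at using r(1) E_D by (intro exI[of _ r]) (simp add: dist_commute)
    then show "E \<midarrow>w0\<rightarrow> 0" by (rule tendsto_eventually)
  qed
  have k0: "k w0 = 0" using E_0 zero by (simp add: E_def w0_def)
  \<comment> \<open>By \<open>orbit_periodic\<close> the value of \<open>exp (- s)\<close>
    determines the orbit point, and an exponential is never 0, so \<open>w0\<close> is not hit twice
    either. Injectivity yields \<open>k' \<noteq> 0\<close> at \<open>w0\<close>.\<close>
  have k_inj: "inj_on k ?B"
  proof (rule inj_onI)
    fix v w assume vw: "v \<in> ?B" "w \<in> ?B" "k v = k w"
    have nz: "k x \<noteq> 0" if "x \<in> ?D" for x using k(2)[OF that] by (simp add: h_def)
    show "v = w"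
    proof (cases "v = w0 \<or> w = w0")
      case True
      then show ?thesis using vw nz k0 by (metis Diff_iff singletonD)
    next
      case False
      then have D: "v \<in> ?D" "w \<in> ?D" using vw by auto
      then have "exp (- \<sigma> v) = exp (- \<sigma> w)" using vw(3) k(2) by (simp add: h_def)
      then have "exp (\<sigma> v) = exp (\<sigma> w)" by (simp add: exp_minus)
      then have "chart_inv d v = chart_inv d w" using orbit_periodic \<sigma>[OF D(1)] \<sigma>[OF D(2)] by metis
      then show ?thesis using coord_chart_inv[OF d(1) Dr[OF D(1)]] coord_chart_inv[OF d(1) Dr[OF D(2)]] by metis
    qed
  qed
  have k'0: "deriv k w0 \<noteq> 0" by (rule holomorphic_injective_imp_regular[OF k(1) open_ball k_inj w0B])
  have "(E has_field_derivative (deriv (W d) w0 * deriv k w0 + deriv (deriv k) w0 * W d w0 + deriv k w0)) (at w0)"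
    unfolding E_def
    by (intro DERIV_add DERIV_mult holomorphic_derivI[OF WB open_ball w0B] holomorphic_derivI[OF k' open_ball w0B] holomorphic_derivI[OF k(1) open_ball w0B])
  moreover have "(E has_field_derivative 0) (at w0)"
  proof (rule has_field_derivative_transform_within_open[OF DERIV_const open_ball w0B])
    show "0 = E w" if "w \<in> ?B" for w using E_0 E_D[of w] that by (cases "w = w0") auto
  qed
  ultimately have "deriv (W d) w0 * deriv k w0 + deriv (deriv k) w0 * W d w0 + deriv k w0 = 0"
    by (rule DERIV_unique)
  then have "(deriv (W d) w0 + 1) * deriv k w0 = 0" using zero by (simp add: w0_def algebra_simps)
  then have "deriv (W d) w0 = - 1" using k'0 by (simp add: add_eq_0_iff2)
  then show ?thesis by (simp add: w0_def)
qed

end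

section \<open>Comparing the zeros in one component\<close>

context compact_surface_vf
begin

text \<open>Dividing the field by \<open>a\<close> normalizes the derivative at \<open>p\<close> to
  1. The component \<open>K\<close> is the closure of the orbit from \<open>p\<close>, and undoing
  the normalization turns 1 into \<open>a\<^sup>2\<close>.\<close>

lemma simple_zero_component:
  assumes c: "c \<in> A" "p \<in> chart_dom c" and zero: "W c (coord c p) = 0" and a: "deriv (W c) (coord c p) = a" "a \<noteq> 0"
  shows "\<exists>K. open K \<and> closed K \<and> connected K \<and> p \<in> K \<and>
    (\<forall>d\<in>A. \<forall>q\<in>chart_dom d. q \<in> K \<longrightarrow> W d (coord d q) = 0 \<longrightarrow> (deriv (W d) (coord d q))\<^sup>2 = a\<^sup>2)"
proof -
  define W' where "W' = (\<lambda>d z. W d z / a)"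
  have "holomorphic_vector_field A W'"
    unfolding holomorphic_vector_field_def W'_def
    by (auto intro!: holomorphic_intros vf_holomorphic a(2) simp: vf_transform)
  then interpret S: compact_surface_vf A W' by unfold_locales
  have dW': "deriv (W' d) z = deriv (W d) z / a" if "d \<in> A" "z \<in> chart_range d" for d z
    unfolding W'_def
    by (rule DERIV_imp_deriv[OF DERIV_cdivide[OF holomorphic_derivI[OF vf_holomorphic open_chart_range]]]) (fact that)+
  have z': "W' c (coord c p) = 0" using zero by (simp add: W'_def)
  have d': "deriv (W' c) (coord c p) = 1" using dW'[OF c(1) coord_in_range[OF c(2)]] a by simp
  obtain G \<psi> R where "linearized_orbit A W' c p G \<psi> R" using S.linearized_orbit_exists[OF c z' d'] by blast
  then interpret L: linearized_orbit A W' c p G \<psi> R .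
  let ?K = "closure (range G)"
  have "connected (range G)"
    by (rule connected_continuous_image[OF S.integral_curve_continuous_on[OF L.curve] connected_UNIV])
  then have "connected ?K" by (rule connected_imp_connected_closure)
  moreover have "(deriv (W d) (coord d q))\<^sup>2 = a\<^sup>2" if "d \<in> A" "q \<in> chart_dom d" "q \<in> ?K" "W d (coord d q) = 0" for d q
  proof -
    have "(deriv (W' d) (coord d q))\<^sup>2 = 1"
      by (rule L.orbit_closure_zero[OF z' d' that(3,1,2)]) (simp add: W'_def that(4))
    then show ?thesis using dW'[OF that(1) coord_in_range[OF that(2)]] a(2) by (simp add: power_divide field_simps)
  qed
  ultimately show ?thesis using L.orbit_closure_open L.orbit_closure_start by (intro exI[of _ ?K]) auto
qed

lemma connected_subset_clopen:
  assumes "open K" "closed K" "connected T" "x \<in> T" "x \<in> K" shows "T \<subseteq> K"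
proof -
  have "K \<inter> T = {} \<or> - K \<inter> T = {}"
    by (rule connectedD[OF assms(3)]) (use assms(1,2) in auto)
  then show ?thesis using assms(4,5) by blast
qed

text \<open>By \<open>simple_zero_component\<close>, \<open>W'\<^sup>2\<close> takes the same value at all zeros of \<open>W\<close> in a component.\<close>

lemma locally_constant_square:
  obtains Q :: "'a \<Rightarrow> complex" where
    "\<And>c z r w. c \<in> A \<Longrightarrow> ball z r \<subseteq> chart_range c \<Longrightarrow> w \<in> ball z r \<Longrightarrow> Q (chart_inv c w) = Q (chart_inv c z)"
    "\<And>c z. c \<in> A \<Longrightarrow> z \<in> chart_range c \<Longrightarrow> W c z = 0 \<Longrightarrow> Q (chart_inv c z) = (deriv (W c) z)\<^sup>2"
proof -
  \<comment> \<open>Such a \<open>K\<close> is a component containing a zero, and \<open>b\<close>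
    is the common value of \<open>W'\<^sup>2\<close> at its zeros; the existence of a zero makes
    \<open>b\<close> unique.\<close>
  define good where "good K b \<longleftrightarrow> open K \<and> closed K \<and> connected K \<and>
      (\<exists>d\<in>A. \<exists>q\<in>chart_dom d. q \<in> K \<and> W d (coord d q) = 0) \<and>
      (\<forall>d\<in>A. \<forall>q\<in>chart_dom d. q \<in> K \<longrightarrow> W d (coord d q) = 0 \<longrightarrow> (deriv (W d) (coord d q))\<^sup>2 = b)" for K :: "'a set" and b
  have uniq: "b = b'" if K: "good K b" "x \<in> K" and K': "good K' b'" "x \<in> K'" for K K' b b' x
  proof -
    have "K \<subseteq> K'" by (rule connected_subset_clopen[OF _ _ _ K(2) K'(2)]) (use K(1) K'(1) in \<open>auto simp: good_def\<close>)
    moreover obtain d q where dq: "d \<in> A" "q \<in> chart_dom d" "q \<in> K" "W d (coord d q) = 0" using K(1) unfolding good_def by blast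
    ultimately have "q \<in> K'" by blast
    then have "(deriv (W d) (coord d q))\<^sup>2 = b'" using K'(1) dq unfolding good_def by blast
    moreover have "(deriv (W d) (coord d q))\<^sup>2 = b" using K(1) dq unfolding good_def by blast
    ultimately show ?thesis by simp
  qed
  \<comment> \<open>The default 0 is correct at zeros outside all good sets: a simple zero would
    make its component good by \<open>simple_zero_component\<close>, so \<open>W' = 0\<close> at
    such a zero.\<close>
  define Q where "Q x = (if \<exists>K b. good K b \<and> x \<in> K then (SOME b. \<exists>K. good K b \<and> x \<in> K) else 0)" for x
  have Q_good: "Q x = b" if K: "good K b" "x \<in> K" for K b x
  proof -
    have ex: "\<exists>b. \<exists>K. good K b \<and> x \<in> K" using K by blast
    obtain K' where K': "good K' (SOME b. \<exists>K. good K b \<and> x \<in> K)" "x \<in> K'" using someI_ex[OF ex] by blast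
    have "Q x = (SOME b. \<exists>K. good K b \<and> x \<in> K)" unfolding Q_def using K by auto
    then show ?thesis using uniq[OF K' K] by simp
  qed
  have Q_none: "Q x = 0" if "\<not> (\<exists>K b. good K b \<and> x \<in> K)" for x
    unfolding Q_def using that by (rule if_not_P)
  show ?thesis
  proof (rule that[of Q])
    fix c z r w assume c: "c \<in> A" and B: "ball z r \<subseteq> chart_range c" and w: "w \<in> ball z r"
    have z: "z \<in> ball z r" using w unfolding mem_ball by (simp add: order_le_less_trans[OF zero_le_dist])
    have conn: "connected (chart_inv c ` ball z r)"
      by (rule connected_continuous_image[OF continuous_on_subset[OF continuous_on_chart_inv[OF c] B] connected_ball])
    have iff: "chart_inv c w \<in> K \<longleftrightarrow> chart_inv c z \<in> K" if "good K b" for K b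
    proof -
      have K: "open K" "closed K" using that by (auto simp: good_def)
      show ?thesis
        using connected_subset_clopen[OF K conn imageI[OF w]] connected_subset_clopen[OF K conn imageI[OF z]] w z by blast
    qed
    show "Q (chart_inv c w) = Q (chart_inv c z)"
    proof (cases "\<exists>K b. good K b \<and> chart_inv c w \<in> K")
      case True
      then obtain K b where K: "good K b" "chart_inv c w \<in> K" by blast
      then show ?thesis using Q_good[OF K] Q_good[OF K(1)] iff[OF K(1)] by simp
    next
      case False
      then have "\<not> (\<exists>K b. good K b \<and> chart_inv c z \<in> K)" using iff by blast
      then show ?thesis using Q_none False by simp
    qed
  next
    fix c z assume c: "c \<in> A" and z: "z \<in> chart_range c" and zero: "W c z = 0"
    let ?p = "chart_inv c z"
    have p: "?p \<in> chart_dom c" "coord c ?p = z" by (rule chart_inv_in_dom[OF c z], rule coord_chart_inv[OF c z])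
    have Wp: "W c (coord c ?p) = 0" using zero p(2) by simp
    show "Q ?p = (deriv (W c) z)\<^sup>2"
    proof (cases "deriv (W c) z = 0")
      case False
      have "W c (coord c ?p) = 0" "deriv (W c) (coord c ?p) = deriv (W c) z" using zero p(2) by simp_all
      from simple_zero_component[OF c p(1) this False]
      obtain K where "open K" "closed K" "connected K" "?p \<in> K"
        "\<forall>d\<in>A. \<forall>q\<in>chart_dom d. q \<in> K \<longrightarrow> W d (coord d q) = 0 \<longrightarrow> (deriv (W d) (coord d q))\<^sup>2 = (deriv (W c) z)\<^sup>2"
        by blast
      moreover from this have "good K ((deriv (W c) z)\<^sup>2)"
        unfolding good_def using c p(1) Wp by blast
      ultimately show ?thesis using Q_good by blast
    next
      case True
      show ?thesis
      proof (cases "\<exists>K b. good K b \<and> ?p \<in> K")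
        case ex: True
        then obtain K b where K: "good K b" "?p \<in> K" by blast
        then have "(deriv (W c) (coord c ?p))\<^sup>2 = b" unfolding good_def using c p(1) Wp by blast
        then show ?thesis using Q_good[OF K] p(2) by simp
      next
        case False
        then show ?thesis using Q_none True by simp
      qed
    qed
  qed
qed

end

section \<open>The Futaki invariant\<close>

lemma has_wirtinger_real_valued:
  assumes "has_wirtinger f a b z" "\<And>w. cnj (f w) = f w"
  shows "b = cnj a"
proof -
  have "has_wirtinger f (cnj b) (cnj a) z"
    using has_wirtinger_cnj[OF assms(1)] assms(2) by simp
  then show ?thesis using has_wirtinger_dzbar[OF assms(1)] has_wirtinger_dzbar by metis
qed

text \<open>Near a positive number the real logarithm is the restriction of the holomorphic
  \<open>Ln\<close>, so the holomorphic chain rule applies.\<close>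

lemma has_wirtinger_of_real_ln:
  assumes "has_wirtinger (\<lambda>w. complex_of_real (g w)) a b z" "open S" "z \<in> S" "\<And>w. w \<in> S \<Longrightarrow> 0 < g w"
  shows "has_wirtinger (\<lambda>w. complex_of_real (ln (g w))) (a / of_real (g z)) (b / of_real (g z)) z"
proof -
  have pos: "0 < g z" using assms(3,4) by simp
  then have "complex_of_real (g z) \<notin> \<real>\<^sub>\<le>\<^sub>0" by simp
  from has_wirtinger_compose_holomorphic[OF assms(1) has_field_derivative_Ln[OF this]]
  have "has_wirtinger (\<lambda>w. Ln (complex_of_real (g w))) (a / of_real (g z)) (b / of_real (g z)) z"
    by (simp add: field_simps)
  then show ?thesis
  proof (rule has_wirtinger_transform[OF _ assms(2,3)])
    show "Ln (complex_of_real (g w)) = complex_of_real (ln (g w))" if "w \<in> S" for w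
      using assms(4)[OF that] by (simp add: Ln_of_real)
  qed
qed

text \<open>\<open>(V'\<^sup>2 - K) / (2 V)\<close> has only removable singularities if \<open>K = V'\<^sup>2\<close> at the zeros of \<open>V\<close>: at a
  simple zero the numerator vanishes, at a zero of order \<open>n \<ge> 2\<close> we have \<open>K = 0\<close> and the numerator
  vanishes of order \<open>2 n - 2 \<ge> n\<close>.\<close>

lemma removable_quotient:
  assumes V: "V holomorphic_on ball z0 R" and R: "0 < R"
    and K: "\<And>w. w \<in> ball z0 R \<Longrightarrow> V w = 0 \<Longrightarrow> K = (deriv V w)\<^sup>2"
  obtains r H where "0 < r" "r \<le> R" "H holomorphic_on ball z0 r"
    "\<And>w. w \<in> ball z0 r - {z0} \<Longrightarrow>
      if V w = 0 then deriv V w = 0 \<and> H w = 0 else H w = ((deriv V w)\<^sup>2 - K) / (2 * V w)"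
proof -
  have V': "deriv V holomorphic_on ball z0 R" by (rule holomorphic_deriv[OF V open_ball])
  have z0: "z0 \<in> ball z0 R" using R by simp
  show ?thesis
  proof (cases "V constant_on ball z0 R")
    \<comment> \<open>The factorization at a zero requires a nonconstant function. For
      \<open>V\<close> identically 0 the choice \<open>H = 0\<close> agrees with the convention
      \<open>x / 0 = 0\<close>, which also governs \<open>raw_form\<close>.\<close>
    case True
    then obtain k where k: "\<And>w. w \<in> ball z0 R \<Longrightarrow> V w = k" unfolding constant_on_def by blast
    have dV: "deriv V w = 0" if w: "w \<in> ball z0 R" for w
      by (rule DERIV_imp_deriv, rule has_field_derivative_transform_within_open[OF DERIV_const open_ball w]) (rule k[symmetric])
    show ?thesis
    proof (cases "k = 0")
      case True
      show ?thesis
        by (rule that[OF R order_refl holomorphic_on_const[of 0]]) (use True k dV in auto)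
    next
      case False
      show ?thesis
        by (rule that[OF R order_refl holomorphic_on_const[of "- K / (2 * k)"]]) (use False k dV in auto)
    qed
  next
    case nonconst: False
    show ?thesis
    proof (cases "V z0 = 0")
      case False
      have "isCont V z0"
        using holomorphic_on_imp_continuous_on[OF V] z0 by (simp add: continuous_on_eq_continuous_at)
      then obtain e where e: "0 < e" "\<And>w. dist z0 w < e \<Longrightarrow> V w \<noteq> 0"
        using continuous_at_avoid[of z0 V 0] False by blast
      define r where "r = min e R"
      have sub: "ball z0 r \<subseteq> ball z0 R" by (simp add: r_def subset_ball)
      have nz: "V w \<noteq> 0" if "w \<in> ball z0 r" for w using e(2)[of w] that by (simp add: r_def)
      show ?thesis
      proof (rule that)
        show "0 < r" "r \<le> R" using e(1) R by (simp_all add: r_def)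
        show "(\<lambda>w. ((deriv V w)\<^sup>2 - K) / (2 * V w)) holomorphic_on ball z0 r"
          by (intro holomorphic_on_divide holomorphic_on_diff holomorphic_on_power holomorphic_on_mult holomorphic_on_const
              holomorphic_on_subset[OF V sub] holomorphic_on_subset[OF V' sub]) (simp add: nz)
      qed (simp add: nz)
    next
      case True
      obtain g r n where g: "0 < n" "0 < r" "ball z0 r \<subseteq> ball z0 R" "g holomorphic_on ball z0 r"
        "\<And>w. w \<in> ball z0 r \<Longrightarrow> V w = (w - z0) ^ n * g w" "\<And>w. w \<in> ball z0 r \<Longrightarrow> g w \<noteq> 0"
        by (rule holomorphic_factor_zero_nonconstant[OF V open_ball connected_ball z0 True nonconst]) (rule that; assumption)
      have rR: "r \<le> R" using g(2,3) by (simp add: ball_subset_ball_iff)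
      have z0r: "z0 \<in> ball z0 r" using g(2) by simp
      have nz: "V w \<noteq> 0" if "w \<in> ball z0 r - {z0}" for w using g(5,6) that by simp
      have dV: "deriv V w = of_nat n * (w - z0) ^ (n - 1) * g w + (w - z0) ^ n * deriv g w" if w: "w \<in> ball z0 r" for w
      proof (rule DERIV_imp_deriv, rule has_field_derivative_transform_within_open[OF _ open_ball w])
        have "((\<lambda>w. (w - z0) ^ n) has_field_derivative of_nat n * (w - z0) ^ (n - 1)) (at w)"
          by (auto intro!: derivative_eq_intros)
        from DERIV_mult[OF this holomorphic_derivI[OF g(4) open_ball w]]
        show "((\<lambda>w. (w - z0) ^ n * g w) has_field_derivative of_nat n * (w - z0) ^ (n - 1) * g w + (w - z0) ^ n * deriv g w) (at w)"
          by (simp add: algebra_simps)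
      qed (simp add: g(5))
      have Kz: "K = (deriv V z0)\<^sup>2" by (rule K[OF z0 True])
      have g': "deriv g holomorphic_on ball z0 r" by (rule holomorphic_deriv[OF g(4) open_ball])
      show ?thesis
      proof (cases "n = 1")
        case True
        define N where "N w = (deriv V w)\<^sup>2 - K" for w
        define N1 where "N1 w = (if w = z0 then deriv N z0 else (N w - N z0) / (w - z0))" for w
        have "N holomorphic_on ball z0 r" unfolding N_def[abs_def]
          by (intro holomorphic_on_diff holomorphic_on_power holomorphic_on_const holomorphic_on_subset[OF V' g(3)])
        then have N1: "N1 holomorphic_on ball z0 r" unfolding N1_def[abs_def] by (rule pole_lemma_open) simp
        have N0: "N z0 = 0" by (simp add: N_def Kz)
        show ?thesis
        proof (rule that[OF g(2) rR])
          show "(\<lambda>w. N1 w / (2 * g w)) holomorphic_on ball z0 r"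
            by (intro holomorphic_on_divide holomorphic_on_mult holomorphic_on_const N1 g(4)) (simp add: g(6))
          fix w assume w: "w \<in> ball z0 r - {z0}"
          then have "V w = (w - z0) * g w" "N1 w = N w / (w - z0)" using g(5)[of w] True N0 by (simp_all add: N1_def)
          then have "N1 w / (2 * g w) = N w / (2 * V w)" by (simp add: mult.left_commute)
          then show "if V w = 0 then deriv V w = 0 \<and> N1 w / (2 * g w) = 0
              else N1 w / (2 * g w) = ((deriv V w)\<^sup>2 - K) / (2 * V w)"
            using nz[OF w] by (simp add: N_def)
        qed
      next
        case False
        \<comment> \<open>With a zero of order \<open>n\<close>, the square of \<open>V'\<close> has
          order \<open>2 * (n - 1)\<close>, and dividing by \<open>V\<close> leaves
          \<open>n - 2\<close>.\<close>
        define m where "m = n - 2"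
        have m: "n = Suc (Suc m)" "n - 1 = Suc m" using False g(1) by (simp_all add: m_def)
        have K0: "K = 0" unfolding Kz dV[OF z0r] m by simp
        let ?H = "\<lambda>w. (w - z0) ^ m * (of_nat n * g w + (w - z0) * deriv g w)\<^sup>2 / (2 * g w)"
        show ?thesis
        proof (rule that[OF g(2) rR])
          show "?H holomorphic_on ball z0 r"
            by (intro holomorphic_on_divide holomorphic_on_mult holomorphic_on_add holomorphic_on_power holomorphic_on_diff
                holomorphic_on_ident holomorphic_on_const g(4) g') (simp add: g(6))
          fix w assume w: "w \<in> ball z0 r - {z0}"
          have dVw: "deriv V w = (w - z0) ^ Suc m * (of_nat n * g w + (w - z0) * deriv g w)"
          proof -
            have "k * x ^ Suc m * a + x ^ Suc (Suc m) * b = x ^ Suc m * (k * a + x * b)" for k x a b :: complex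
              by (simp add: algebra_simps)
            moreover have "deriv V w = of_nat n * (w - z0) ^ Suc m * g w + (w - z0) ^ Suc (Suc m) * deriv g w"
              using dV[of w] w m by simp
            ultimately show ?thesis by (simp only:)
          qed
          have Vw: "V w = (w - z0) ^ Suc (Suc m) * g w" using g(5)[of w] w m by simp
          have alg: "(x ^ Suc m * y)\<^sup>2 / (2 * (x ^ Suc (Suc m) * u)) = x ^ m * y\<^sup>2 / (2 * u)"
            if "x \<noteq> 0" "u \<noteq> 0" for x y u :: complex
          proof -
            have a: "(x ^ Suc m * y)\<^sup>2 = x ^ Suc (Suc m) * (x ^ m * y\<^sup>2)"
              by (simp add: power2_eq_square mult_ac)
            have b: "2 * (x ^ Suc (Suc m) * u) = x ^ Suc (Suc m) * (2 * u)" by (simp only: mult.left_commute)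
            have "x ^ Suc (Suc m) \<noteq> 0" using that(1) by simp
            then show ?thesis unfolding a b by (rule mult_divide_mult_cancel_left)
          qed
          have "w - z0 \<noteq> 0" "g w \<noteq> 0" using w g(6)[of w] by simp_all
          then have "((deriv V w)\<^sup>2 - K) / (2 * V w) = ?H w"
            unfolding dVw Vw K0 diff_zero by (rule alg)
          then show "if V w = 0 then deriv V w = 0 \<and> ?H w = 0 else ?H w = ((deriv V w)\<^sup>2 - K) / (2 * V w)"
            using nz[OF w] by simp
        qed
      qed
    qed
  qed
qed

section \<open>Global forms with the required dbar\<close>

locale futaki_setup = metric_surface A g + compact_surface_vf A V
  for A :: "'a::{t2_space, second_countable_topology} chart set" and g V +
  fixes u :: "'a \<Rightarrow> real"
  assumes potential: "ricci_potential A g u"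
begin

definition u_chart :: "'a chart \<Rightarrow> complex \<Rightarrow> complex" where
  "u_chart c = (\<lambda>w. of_real (u (chart_inv c w)))"

definition g_chart :: "'a chart \<Rightarrow> complex \<Rightarrow> complex" where
  "g_chart c = (\<lambda>w. of_real (g c w))"

definition ln_chart :: "'a chart \<Rightarrow> complex \<Rightarrow> complex" where
  "ln_chart c = (\<lambda>w. of_real (ln (g c w)))"

text \<open>The \<open>p\<close> of the overview. As \<open>g\<close> depends on the chart, so does
  \<open>u - log g\<close>, and its derivative does not transform as a form; see
  \<open>dpot_transform\<close>.\<close>

definition dpot :: "'a chart \<Rightarrow> complex \<Rightarrow> complex" where
  "dpot c z = dz (u_chart c) z - dz (ln_chart c) z"

lemma u_C1: assumes "c \<in> A" shows "C1_on (u_chart c) (chart_range c)" "C1_on (dz (u_chart c)) (chart_range c)"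
proof -
  have "smooth_on (\<lambda>w. u (chart_inv c w)) (chart_range c)"
    using potential assms unfolding ricci_potential_def smooth_function_def o_def by blast
  from smooth_on_of_real[OF open_chart_range[OF assms] this]
  show "C1_on (u_chart c) (chart_range c)" "C1_on (dz (u_chart c)) (chart_range c)" unfolding u_chart_def by auto
qed

lemma g_C1: assumes "c \<in> A" shows "C1_on (g_chart c) (chart_range c)" "C1_on (dz (g_chart c)) (chart_range c)"
  using smooth_on_C1_on[OF open_chart_range metric_smooth] smooth_on_C1_on_dz[OF open_chart_range metric_smooth] assms
  unfolding g_chart_def by auto

lemma g_chart_nonzero: "c \<in> A \<Longrightarrow> z \<in> chart_range c \<Longrightarrow> g_chart c z \<noteq> 0"
  using metric_pos[of c z] by (auto simp: g_chart_def)

lemma ln_wirtinger: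
  assumes c: "c \<in> A" and z: "z \<in> chart_range c"
  shows "has_wirtinger (ln_chart c) (dz (g_chart c) z / g_chart c z) (dzbar (g_chart c) z / g_chart c z) z"
  unfolding ln_chart_def g_chart_def
  by (rule has_wirtinger_of_real_ln[OF C1_on_has_wirtinger[OF g_C1(1)[OF c, unfolded g_chart_def] z] open_chart_range[OF c] z metric_pos[OF c]])

lemma dz_ln: "c \<in> A \<Longrightarrow> z \<in> chart_range c \<Longrightarrow> dz (ln_chart c) z = dz (g_chart c) z / g_chart c z"
  by (rule has_wirtinger_dz[OF ln_wirtinger])

lemma ln_C1:
  assumes c: "c \<in> A" shows "C1_on (dz (ln_chart c)) (chart_range c)"
  by (rule C1_on_transform[OF C1_on_divide[OF g_C1(2)[OF c] g_C1(1)[OF c] g_chart_nonzero[OF c]] open_chart_range[OF c]])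
     (assumption, rule dz_ln[OF c, symmetric])

lemma dpot_C1: "c \<in> A \<Longrightarrow> C1_on (dpot c) (chart_range c)"
  unfolding dpot_def[abs_def] by (intro C1_on_diff u_C1(2) ln_C1)

text \<open>For a real function \<open>dzbar f = cnj (dz f)\<close>. This exchanges the two
  derivatives up to conjugation, without appeal to the symmetry of second derivatives; the
  conjugation disappears in \<open>dzbar_dpot\<close> because \<open>g\<close> is real.\<close>

lemma dz_dzbar_real:
  assumes c: "c \<in> A" and z: "z \<in> chart_range c" and f: "\<And>w. w \<in> chart_range c \<Longrightarrow> has_wirtinger f (a w) (b w) w" "\<And>w. cnj (f w) = f w"
    and dzf: "C1_on (dz f) (chart_range c)"
  shows "dz (dzbar f) z = cnj (dzbar (dz f) z)"
proof -
  have "dz (dzbar f) z = dz (\<lambda>w. cnj (dz f w)) z"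
  proof (rule dz_cong[OF open_chart_range[OF c] z])
    show "dzbar f w = cnj (dz f w)" if "w \<in> chart_range c" for w
      using has_wirtinger_real_valued[OF f(1)[OF that] f(2)] has_wirtinger_dz[OF f(1)[OF that]] has_wirtinger_dzbar[OF f(1)[OF that]] by simp
  qed
  also have "\<dots> = cnj (dzbar (dz f) z)"
    by (rule has_wirtinger_dz[OF has_wirtinger_cnj[OF C1_on_has_wirtinger[OF dzf z]]])
  finally show ?thesis .
qed

lemma dzbar_dpot:
  assumes c: "c \<in> A" and z: "z \<in> chart_range c"
  shows "dzbar (dpot c) z = g_chart c z"
proof -
  have 1: "dz (dzbar (u_chart c)) z = cnj (dzbar (dz (u_chart c)) z)"
    by (rule dz_dzbar_real[OF c z C1_on_has_wirtinger[OF u_C1(1)[OF c]] _ u_C1(2)[OF c]]) (simp_all add: u_chart_def)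
  have 2: "dz (dzbar (ln_chart c)) z = cnj (dzbar (dz (ln_chart c)) z)"
    by (rule dz_dzbar_real[OF c z ln_wirtinger[OF c] _ ln_C1[OF c]]) (simp_all add: ln_chart_def)
  have "of_real (g c z) - ricci g c z = dz (dzbar (\<lambda>w. of_real (u (chart_inv c w)))) z"
    using potential c z unfolding ricci_potential_def by blast
  then have "g_chart c z = dz (dzbar (u_chart c)) z - dz (dzbar (ln_chart c)) z"
    unfolding ricci_def g_chart_def u_chart_def ln_chart_def by (simp add: algebra_simps)
  then have "cnj (g_chart c z) = dzbar (dz (u_chart c)) z - dzbar (dz (ln_chart c)) z" unfolding 1 2 by simp
  moreover have "cnj (g_chart c z) = g_chart c z" by (simp add: g_chart_def)
  moreover have "dzbar (dpot c) z = dzbar (dz (u_chart c)) z - dzbar (dz (ln_chart c)) z"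
    unfolding dpot_def[abs_def]
    by (rule has_wirtinger_dzbar[OF has_wirtinger_diff[OF C1_on_has_wirtinger[OF u_C1(2)[OF c] z] C1_on_has_wirtinger[OF ln_C1[OF c] z]]])
  ultimately show ?thesis by simp
qed

text \<open>The local metrics differ by the factor \<open>\<phi>' * cnj \<phi>'\<close>. In the
  logarithmic derivative \<open>dz\<close> kills the antiholomorphic factor, and the other
  contributes \<open>\<phi>'' / \<phi>'\<close>. Working with \<open>dz g / g\<close> avoids
  choosing a branch of the logarithm of \<open>\<phi>'\<close>.\<close>

lemma dpot_transform:
  assumes c: "c \<in> A" and d: "d \<in> A" and z: "z \<in> overlap c d"
  defines "\<phi> \<equiv> transition c d"
  shows "dpot c z = dpot d (\<phi> z) * deriv \<phi> z - deriv (deriv \<phi>) z / deriv \<phi> z"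
proof -
  have zr: "z \<in> chart_range c" by (rule subsetD[OF overlap_subset z])
  have wr: "\<phi> z \<in> chart_range d" unfolding \<phi>_def by (rule subsetD[OF overlap_subset transition_in_overlap[OF c d z]])
  have \<phi>': "(\<phi> has_field_derivative deriv \<phi> z) (at z)" unfolding \<phi>_def by (rule transition_derivative[OF c d z])
  have nz: "deriv \<phi> z \<noteq> 0" unfolding \<phi>_def by (rule transition_deriv_nonzero[OF c d z])
  have \<phi>'': "(deriv \<phi> has_field_derivative deriv (deriv \<phi>) z) (at z)"
    unfolding \<phi>_def by (rule holomorphic_derivI[OF holomorphic_deriv[OF transition_holomorphic open_overlap] open_overlap]) (fact c d z)+
  have "has_wirtinger (u_chart c) (dz (u_chart d) (\<phi> z) * deriv \<phi> z) (dzbar (u_chart d) (\<phi> z) * cnj (deriv \<phi> z)) z"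
    by (rule has_wirtinger_transform[OF has_wirtinger_holomorphic_compose[OF \<phi>' C1_on_has_wirtinger[OF u_C1(1)[OF d] wr]] open_overlap[OF c d] z])
       (simp add: u_chart_def \<phi>_def chart_inv_transition[OF c d])
  then have u: "dz (u_chart c) z = dz (u_chart d) (\<phi> z) * deriv \<phi> z" by (rule has_wirtinger_dz)
  note W1 = has_wirtinger_holomorphic_compose[OF \<phi>' C1_on_has_wirtinger[OF g_C1(1)[OF d] wr]]
  note W2 = has_wirtinger_mult[OF W1 has_wirtinger_holomorphic[OF \<phi>'']]
  note W3 = has_wirtinger_mult[OF W2 has_wirtinger_cnj[OF has_wirtinger_holomorphic[OF \<phi>'']]]
  have g_eq: "g_chart d (\<phi> w) * deriv \<phi> w * cnj (deriv \<phi> w) = g_chart c w" if "w \<in> overlap c d" for w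
    using metric_transform[OF c d that] unfolding g_chart_def \<phi>_def
    by (simp add: complex_norm_square[symmetric] mult.assoc del: of_real_power)
  from has_wirtinger_dz[OF has_wirtinger_transform[OF W3 open_overlap[OF c d] z g_eq]]
  have "dz (g_chart c) z = (dz (g_chart d) (\<phi> z) * deriv \<phi> z * deriv \<phi> z + g_chart d (\<phi> z) * deriv (deriv \<phi>) z) * cnj (deriv \<phi> z)"
    by simp
  moreover have gc: "g_chart c z = g_chart d (\<phi> z) * deriv \<phi> z * cnj (deriv \<phi> z)" by (rule g_eq[OF z, symmetric])
  moreover have "(p * q * q + x * y) * v / (x * q * v) = p / x * q + y / q" if "q \<noteq> 0" "x \<noteq> 0" "v \<noteq> 0" for p q x y v :: complex
    using that by (simp add: field_simps)
  ultimately have "dz (ln_chart c) z = dz (ln_chart d) (\<phi> z) * deriv \<phi> z + deriv (deriv \<phi>) z / deriv \<phi> z"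
    using dz_ln[OF c zr] dz_ln[OF d wr] nz g_chart_nonzero[OF d wr] by simp
  then show ?thesis unfolding dpot_def u by (simp add: algebra_simps)
qed

definition raw_form :: "('a \<Rightarrow> complex) \<Rightarrow> 'a chart \<Rightarrow> complex \<Rightarrow> complex" where
  "raw_form Q c z = ((V c z * dpot c z - deriv (V c) z)\<^sup>2 - Q (chart_inv c z)) / (2 * V c z)"

text \<open>At zeros of \<open>V\<close> the quotient \<open>raw_form\<close> only has the
  conventional value 0. A punctured limit ignores that value and produces the extension in all
  charts at once, without selecting local extensions.\<close>

definition pot_form :: "('a \<Rightarrow> complex) \<Rightarrow> 'a chart \<Rightarrow> complex \<Rightarrow> complex" where
  "pot_form Q c z = Lim (at z) (raw_form Q c)"

text \<open>The \<open>\<phi>''\<close> terms of \<open>dpot\<close> and of \<open>V'\<close>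
  cancel, so the numerator is a function on the surface; the factor \<open>\<phi>'\<close> of a
  (1,0)-form stems from \<open>V\<close> in the denominator. Zeros of \<open>V\<close> correspond to
  each other, and both sides are 0 there.\<close>

lemma raw_form_transform:
  assumes c: "c \<in> A" and d: "d \<in> A" and z: "z \<in> overlap c d"
  shows "raw_form Q c z = raw_form Q d (transition c d z) * deriv (transition c d) z"
proof -
  let ?\<phi> = "transition c d"
  have zr: "z \<in> chart_range c" by (rule subsetD[OF overlap_subset z])
  have wr: "?\<phi> z \<in> chart_range d" by (rule subsetD[OF overlap_subset transition_in_overlap[OF c d z]])
  have nz: "deriv ?\<phi> z \<noteq> 0" by (rule transition_deriv_nonzero[OF c d z])
  have Vz: "V d (?\<phi> z) = deriv ?\<phi> z * V c z" by (rule vf_transform[OF c d z])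
  have \<phi>'': "(deriv ?\<phi> has_field_derivative deriv (deriv ?\<phi>) z) (at z)"
    by (rule holomorphic_derivI[OF holomorphic_deriv[OF transition_holomorphic open_overlap] open_overlap]) (fact c d z)+
  have "(V d \<circ> ?\<phi> has_field_derivative deriv (V d) (?\<phi> z) * deriv ?\<phi> z) (at z)"
    by (rule DERIV_chain[OF holomorphic_derivI[OF vf_holomorphic[OF d] open_chart_range[OF d] wr] transition_derivative[OF c d z]])
  then have 1: "((\<lambda>w. deriv ?\<phi> w * V c w) has_field_derivative deriv (V d) (?\<phi> z) * deriv ?\<phi> z) (at z)"
    by (rule has_field_derivative_transform_within_open[OF _ open_overlap[OF c d] z]) (simp add: vf_transform[OF c d])
  have 2: "((\<lambda>w. deriv ?\<phi> w * V c w) has_field_derivative deriv (deriv ?\<phi>) z * V c z + deriv (V c) z * deriv ?\<phi> z) (at z)"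
    by (rule DERIV_mult[OF \<phi>'' holomorphic_derivI[OF vf_holomorphic[OF c] open_chart_range[OF c] zr]])
  have dV: "deriv (V d) (?\<phi> z) * deriv ?\<phi> z = deriv (deriv ?\<phi>) z * V c z + deriv (V c) z * deriv ?\<phi> z"
    by (rule DERIV_unique[OF 1 2])
  have dp: "dpot c z = dpot d (?\<phi> z) * deriv ?\<phi> z - deriv (deriv ?\<phi>) z / deriv ?\<phi> z" by (rule dpot_transform[OF c d z])
  have alg: "q * v * x - y' = v * (x * q - s / q) - y" if "y' * q = s * v + y * q" "q \<noteq> 0" for q v x y y' s :: complex
  proof -
    have "y' = s * v / q + y" using that by (simp add: field_simps)
    then show ?thesis by (simp add: algebra_simps)
  qed
  have "V d (?\<phi> z) * dpot d (?\<phi> z) - deriv (V d) (?\<phi> z) = V c z * dpot c z - deriv (V c) z"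
    unfolding Vz dp by (rule alg[OF dV nz])
  then show ?thesis unfolding raw_form_def chart_inv_transition[OF c d z] Vz using nz by simp
qed

context
  fixes Q :: "'a \<Rightarrow> complex"
  assumes Q_const: "\<And>c z r w. c \<in> A \<Longrightarrow> ball z r \<subseteq> chart_range c \<Longrightarrow> w \<in> ball z r \<Longrightarrow> Q (chart_inv c w) = Q (chart_inv c z)"
    and Q_zero: "\<And>c z. c \<in> A \<Longrightarrow> z \<in> chart_range c \<Longrightarrow> V c z = 0 \<Longrightarrow> Q (chart_inv c z) = (deriv (V c) z)\<^sup>2"
begin

text \<open>Expanding the square, \<open>((V p - V')\<^sup>2 - K) / (2 V) = V p\<^sup>2 / 2 - p V' +
  (V'\<^sup>2 - K) / (2 V)\<close>. Only the last term is singular; it consists of holomorphic data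
  alone and extends by \<open>removable_quotient\<close>.\<close>

lemma pot_form_local:
  assumes c: "c \<in> A" and z0: "z0 \<in> chart_range c"
  obtains r H where "0 < r" "ball z0 r \<subseteq> chart_range c" "H holomorphic_on ball z0 r"
    "\<And>w. w \<in> ball z0 r \<Longrightarrow> (raw_form Q c \<longlongrightarrow> V c w * (dpot c w)\<^sup>2 / 2 - dpot c w * deriv (V c) w + H w) (at w)"
proof -
  obtain R where R: "0 < R" "ball z0 R \<subseteq> chart_range c" using openE[OF open_chart_range[OF c] z0] by blast
  define K where "K = Q (chart_inv c z0)"
  have QK: "Q (chart_inv c w) = K" if "w \<in> ball z0 R" for w unfolding K_def by (rule Q_const[OF c R(2) that])
  obtain r H where rH: "0 < r" "r \<le> R" "H holomorphic_on ball z0 r"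
    "\<And>w. w \<in> ball z0 r - {z0} \<Longrightarrow>
      if V c w = 0 then deriv (V c) w = 0 \<and> H w = 0 else H w = ((deriv (V c) w)\<^sup>2 - K) / (2 * V c w)"
  proof (rule removable_quotient[OF holomorphic_on_subset[OF vf_holomorphic[OF c] R(2)] R(1)])
    show "K = (deriv (V c) w)\<^sup>2" if "w \<in> ball z0 R" "V c w = 0" for w
      using Q_zero[OF c subsetD[OF R(2) that(1)] that(2)] QK[OF that(1)] by simp
  qed (rule that; assumption)
  define E where "E = (\<lambda>w. V c w * (dpot c w)\<^sup>2 / 2 - dpot c w * deriv (V c) w + H w)"
  have sub: "ball z0 r \<subseteq> ball z0 R" using rH(2) by (simp add: subset_ball)
  have rc: "ball z0 r \<subseteq> chart_range c" by (rule subset_trans[OF sub R(2)])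
  have raw: "raw_form Q c w = E w" if w: "w \<in> ball z0 r - {z0}" for w
  proof -
    have wR: "w \<in> ball z0 R" using w sub by blast
    have alg: "((v * p - y)\<^sup>2 - k) / (2 * v) = v * p\<^sup>2 / 2 - p * y + (y\<^sup>2 - k) / (2 * v)" if "v \<noteq> 0" for v p y k :: complex
      using that by (simp add: field_simps power2_eq_square)
    show ?thesis
    proof (cases "V c w = 0")
      case True
      then show ?thesis using rH(4)[OF w] by (simp add: raw_form_def E_def)
    next
      case False
      then have "H w = ((deriv (V c) w)\<^sup>2 - K) / (2 * V c w)" using rH(4)[OF w] by simp
      then show ?thesis unfolding raw_form_def E_def QK[OF wR] using alg[OF False] by simp
    qed
  qed
  have "continuous_on (ball z0 r) E" unfolding E_def
    by (intro continuous_on_add continuous_on_diff continuous_on_divide continuous_on_mult continuous_on_power continuous_on_const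
        continuous_on_subset[OF holomorphic_on_imp_continuous_on[OF vf_holomorphic[OF c]] rc]
        continuous_on_subset[OF holomorphic_on_imp_continuous_on[OF holomorphic_deriv[OF vf_holomorphic[OF c] open_chart_range[OF c]]] rc]
        continuous_on_subset[OF C1_on_continuous[OF dpot_C1[OF c]] rc] holomorphic_on_imp_continuous_on[OF rH(3)]) simp
  then have lim: "(E \<longlongrightarrow> E w) (at w)" if "w \<in> ball z0 r" for w
    using that by (simp add: continuous_on_eq_continuous_at isCont_def)
  show ?thesis
  proof (rule that[OF rH(1) rc rH(3)])
    fix w assume w: "w \<in> ball z0 r"
    \<comment> \<open>This set is the whole ball if \<open>w = z0\<close> and omits
      \<open>z0\<close> otherwise. In both cases its points other than \<open>w\<close> avoid
      \<open>z0\<close>, so \<open>raw\<close> applies to them.\<close>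
    have "open (ball z0 r - ({z0} - {w}))" by (intro open_Diff open_ball finite_imp_closed) simp
    moreover have "w \<in> ball z0 r - ({z0} - {w})" using w by simp
    ultimately have "\<forall>\<^sub>F x in at w. x \<in> ball z0 r - ({z0} - {w}) \<and> x \<noteq> w"
      by (intro eventually_conj eventually_at_in_open' eventually_neq_at_within)
    then have "\<forall>\<^sub>F x in at w. E x = raw_form Q c x"
      by (rule eventually_mono) (rule raw[symmetric], auto)
    then have "(raw_form Q c \<longlongrightarrow> E w) (at w)" by (rule Lim_transform_eventually[OF lim[OF w]])
    then show "(raw_form Q c \<longlongrightarrow> V c w * (dpot c w)\<^sup>2 / 2 - dpot c w * deriv (V c) w + H w) (at w)" by (simp add: E_def)
  qed
qed

lemma pot_form_tendsto:
  assumes "c \<in> A" "z \<in> chart_range c" shows "(raw_form Q c \<longlongrightarrow> pot_form Q c z) (at z)"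
proof -
  obtain r H where r: "0 < r" "\<And>w. w \<in> ball z r \<Longrightarrow> (raw_form Q c \<longlongrightarrow> V c w * (dpot c w)\<^sup>2 / 2 - dpot c w * deriv (V c) w + H w) (at w)"
    by (rule pot_form_local[OF assms]) (rule that; assumption)
  have "z \<in> ball z r" using r(1) by simp
  from r(2)[OF this] show ?thesis unfolding pot_form_def using tendsto_Lim[OF trivial_limit_at r(2)[OF \<open>z \<in> ball z r\<close>]] by simp
qed

text \<open>In the local expression only \<open>p\<close> is not holomorphic, and
  \<open>dzbar p = g\<close>; differentiating \<open>V p\<^sup>2 / 2 - p V' + H\<close> gives
  \<open>g * (V p - V')\<close>.\<close>

lemma pot_form_C1:
  assumes c: "c \<in> A"
  shows "C1_on (pot_form Q c) (chart_range c)"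
    and "\<And>z. z \<in> chart_range c \<Longrightarrow> dzbar (pot_form Q c) z = g_chart c z * (V c z * dpot c z - deriv (V c) z)"
proof -
  have "\<exists>T. open T \<and> z0 \<in> T \<and> C1_on (pot_form Q c) T \<and> dzbar (pot_form Q c) z0 = g_chart c z0 * (V c z0 * dpot c z0 - deriv (V c) z0)"
    if z0: "z0 \<in> chart_range c" for z0
  proof -
    obtain r H where r: "0 < r" "ball z0 r \<subseteq> chart_range c" "H holomorphic_on ball z0 r"
      "\<And>w. w \<in> ball z0 r \<Longrightarrow> (raw_form Q c \<longlongrightarrow> V c w * (dpot c w)\<^sup>2 / 2 - dpot c w * deriv (V c) w + H w) (at w)"
      by (rule pot_form_local[OF c z0]) (rule that; assumption)
    let ?E = "\<lambda>w. V c w * (dpot c w * dpot c w) * (1 / 2) - dpot c w * deriv (V c) w + H w"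
    have eq: "?E w = pot_form Q c w" if w: "w \<in> ball z0 r" for w
      unfolding pot_form_def using tendsto_Lim[OF trivial_limit_at r(4)[OF w]] by (simp add: power2_eq_square)
    have V1: "V c holomorphic_on ball z0 r" by (rule holomorphic_on_subset[OF vf_holomorphic[OF c] r(2)])
    have V2: "deriv (V c) holomorphic_on ball z0 r" by (rule holomorphic_deriv[OF V1 open_ball])
    have p: "C1_on (dpot c) (ball z0 r)" by (rule C1_on_subset[OF dpot_C1[OF c] r(2)])
    have "C1_on ?E (ball z0 r)"
      by (rule C1_on_add[OF C1_on_diff[OF C1_on_mult[OF C1_on_mult[OF C1_on_holomorphic[OF V1 open_ball] C1_on_mult[OF p p]] C1_on_const]
           C1_on_mult[OF p C1_on_holomorphic[OF V2 open_ball]]] C1_on_holomorphic[OF r(3) open_ball]])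
    then have C1: "C1_on (pot_form Q c) (ball z0 r)" by (rule C1_on_transform[OF _ open_ball eq])
    have z0r: "z0 \<in> ball z0 r" using r(1) by simp
    have Wp: "has_wirtinger (dpot c) (dz (dpot c) z0) (g_chart c z0) z0"
      using C1_on_has_wirtinger[OF dpot_C1[OF c] z0] dzbar_dpot[OF c z0] by simp
    note W = has_wirtinger_add[OF has_wirtinger_diff[OF
        has_wirtinger_mult[OF has_wirtinger_mult[OF has_wirtinger_holomorphic[OF holomorphic_derivI[OF V1 open_ball z0r]] has_wirtinger_mult[OF Wp Wp]] has_wirtinger_const[of "1 / 2"]]
        has_wirtinger_mult[OF Wp has_wirtinger_holomorphic[OF holomorphic_derivI[OF V2 open_ball z0r]]]]
        has_wirtinger_holomorphic[OF holomorphic_derivI[OF r(3) open_ball z0r]]]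
    have "dzbar (pot_form Q c) z0 = g_chart c z0 * (V c z0 * dpot c z0 - deriv (V c) z0)"
      using has_wirtinger_dzbar[OF has_wirtinger_transform[OF W open_ball z0r eq]] by (simp add: algebra_simps)
    then show ?thesis using C1 z0r by (intro exI[of _ "ball z0 r"]) simp
  qed
  note local = this
  show "C1_on (pot_form Q c) (chart_range c)"
    by (rule C1_on_locally) (use local in blast)
  show "dzbar (pot_form Q c) z = g_chart c z * (V c z * dpot c z - deriv (V c) z)" if "z \<in> chart_range c" for z
    using local[OF that] by blast
qed

text \<open>The law for \<open>raw_form\<close> passes to the limit. Injectivity of the transition
  map keeps \<open>\<phi> w\<close> away from \<open>\<phi> z\<close>, as a punctured limit
  requires.\<close>

lemma pot_form_C1_form: "C1_form (pot_form Q)"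
proof (rule C1_formI[OF pot_form_C1(1)])
  fix c d z assume c: "c \<in> A" and d: "d \<in> A" and z: "z \<in> overlap c d"
  let ?\<phi> = "transition c d"
  have wr: "?\<phi> z \<in> chart_range d" by (rule subsetD[OF overlap_subset transition_in_overlap[OF c d z]])
  have ev: "\<forall>\<^sub>F w in at z. w \<in> overlap c d \<and> w \<noteq> z"
    by (intro eventually_conj eventually_at_in_open' eventually_neq_at_within open_overlap c d z)
  have "isCont ?\<phi> z" by (rule DERIV_isCont[OF transition_derivative[OF c d z]])
  then have "filterlim ?\<phi> (at (?\<phi> z)) (at z)"
  proof (intro filterlim_atI)
    show "\<forall>\<^sub>F w in at z. ?\<phi> w \<noteq> ?\<phi> z"
      by (rule eventually_mono[OF ev]) (use transition_inj[OF c d] z in \<open>auto dest: inj_onD\<close>)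
  qed (simp add: isCont_def)
  from filterlim_compose[OF pot_form_tendsto[OF d wr] this]
  have 1: "((\<lambda>w. raw_form Q d (?\<phi> w)) \<longlongrightarrow> pot_form Q d (?\<phi> z)) (at z)" .
  have "isCont (deriv ?\<phi>) z"
    using holomorphic_on_imp_continuous_on[OF holomorphic_deriv[OF transition_holomorphic[OF c d] open_overlap[OF c d]]] z
    by (simp add: continuous_on_eq_continuous_at open_overlap[OF c d])
  then have "((\<lambda>w. raw_form Q d (?\<phi> w) * deriv ?\<phi> w) \<longlongrightarrow> pot_form Q d (?\<phi> z) * deriv ?\<phi> z) (at z)"
    using tendsto_mult[OF 1] by (simp add: isCont_def)
  then have "(raw_form Q c \<longlongrightarrow> pot_form Q d (?\<phi> z) * deriv ?\<phi> z) (at z)"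
    by (rule Lim_transform_eventually) (rule eventually_mono[OF ev], simp add: raw_form_transform[OF c d])
  then show "pot_form Q c z = pot_form Q d (?\<phi> z) * deriv ?\<phi> z"
    unfolding pot_form_def[of Q c] by (rule tendsto_Lim[OF trivial_limit_at])
qed

end

text \<open>The remaining term \<open>dz (V g)\<close> is the conjugate of the \<open>dzbar\<close>
  of this form, since \<open>g\<close> is real; so Stokes' theorem for (1,0)-forms covers it
  too.\<close>

definition dual_form :: "'a chart \<Rightarrow> complex \<Rightarrow> complex" where
  "dual_form c z = cnj (V c z) * g_chart c z"

lemma dual_form_C1_form: "C1_form dual_form"
proof (rule C1_formI)
  show "C1_on (dual_form c) (chart_range c)" if c: "c \<in> A" for c
    unfolding dual_form_def[abs_def]
    by (rule C1_on_mult[OF C1_on_cnj[OF C1_on_holomorphic[OF vf_holomorphic[OF c] open_chart_range[OF c]]] g_C1(1)[OF c]])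
  fix c d z assume c: "c \<in> A" and d: "d \<in> A" and z: "z \<in> overlap c d"
  have "g_chart c z = g_chart d (transition c d z) * (deriv (transition c d) z * cnj (deriv (transition c d) z))"
    using metric_transform[OF c d z] unfolding g_chart_def complex_norm_square[symmetric] by simp
  then show "dual_form c z = dual_form d (transition c d z) * deriv (transition c d) z"
    unfolding dual_form_def vf_transform[OF c d z] by simp
qed

lemma dzbar_dual_form:
  assumes c: "c \<in> A" and z: "z \<in> chart_range c"
  shows "dzbar (dual_form c) z = cnj (deriv (V c) z * g_chart c z + V c z * dz (g_chart c) z)"
proof -
  have W: "has_wirtinger (g_chart c) (dz (g_chart c) z) (dzbar (g_chart c) z) z" by (rule C1_on_has_wirtinger[OF g_C1(1)[OF c] z])
  have g': "dzbar (g_chart c) z = cnj (dz (g_chart c) z)" by (rule has_wirtinger_real_valued[OF W]) (simp add: g_chart_def)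
  have "has_wirtinger (dual_form c) (cnj 0 * g_chart c z + cnj (V c z) * dz (g_chart c) z)
      (cnj (deriv (V c) z) * g_chart c z + cnj (V c z) * dzbar (g_chart c) z) z"
    unfolding dual_form_def[abs_def]
    by (rule has_wirtinger_mult[OF has_wirtinger_cnj[OF has_wirtinger_holomorphic[OF holomorphic_derivI[OF vf_holomorphic[OF c] open_chart_range[OF c] z]]] W])
  from has_wirtinger_dzbar[OF this] show ?thesis unfolding g' by (simp add: g_chart_def)
qed

text \<open>From \<open>u_z = p + g_z / g\<close> one gets
  \<open>V u_z = (V p - V') + (V' g + V g_z) / g\<close>. The first summand is
  \<open>form_dbar\<close> of \<open>pot_form\<close>, the second the conjugate of
  \<open>form_dbar\<close> of \<open>dual_form\<close>, and both integrals vanish by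
  \<open>stokes\<close>.\<close>

theorem Fut_eq_0: "Fut A g u V = 0"
proof -
  obtain Q :: "'a \<Rightarrow> complex" where
    Q: "\<And>c z r w. c \<in> A \<Longrightarrow> ball z r \<subseteq> chart_range c \<Longrightarrow> w \<in> ball z r \<Longrightarrow> Q (chart_inv c w) = Q (chart_inv c z)"
    "\<And>c z. c \<in> A \<Longrightarrow> z \<in> chart_range c \<Longrightarrow> V c z = 0 \<Longrightarrow> Q (chart_inv c z) = (deriv (V c) z)\<^sup>2"
    by (rule locally_constant_square) (rule that; assumption)
  have pot: "C1_form (pot_form Q)" by (rule pot_form_C1_form[OF Q])
  have "vf_apply A V u x = form_dbar g (pot_form Q) x + cnj (form_dbar g dual_form x)" for x
  proof -
    define e where "e = (SOME c. c \<in> A \<and> x \<in> chart_dom c)"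
    have e: "e \<in> A" "x \<in> chart_dom e" using some_chart[of x] unfolding e_def by blast+
    let ?z = "coord e x"
    have z: "?z \<in> chart_range e" by (rule coord_in_range[OF e(2)])
    have nz: "g_chart e ?z \<noteq> 0" by (rule g_chart_nonzero[OF e(1) z])
    have G: "of_real (g e ?z) = g_chart e ?z" "cnj (g_chart e ?z) = g_chart e ?z" by (simp_all add: g_chart_def)
    have a1: "form_dbar g (pot_form Q) x = V e ?z * dpot e ?z - deriv (V e) ?z"
    proof -
      have "dzbar (pot_form Q e) ?z = g_chart e ?z * (V e ?z * dpot e ?z - deriv (V e) ?z)"
        by (rule pot_form_C1(2)[OF Q e(1) z])
      then show ?thesis unfolding form_dbar_eq[OF pot e] G(1) using nz by simp
    qed
    have a2: "cnj (form_dbar g dual_form x) = (deriv (V e) ?z * g_chart e ?z + V e ?z * dz (g_chart e) ?z) / g_chart e ?z"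
      unfolding form_dbar_eq[OF dual_form_C1_form e] dzbar_dual_form[OF e(1) z] G(1)
      by (simp only: complex_cnj_divide complex_cnj_cnj G(2))
    have a3: "vf_apply A V u x = V e ?z * dz (u_chart e) ?z"
      unfolding vf_apply_def Let_def e_def[symmetric] u_chart_def ..
    have a4: "dz (u_chart e) ?z = dpot e ?z + dz (g_chart e) ?z / g_chart e ?z"
      unfolding dpot_def dz_ln[OF e(1) z] by simp
    have alg: "v * (y + b / a) = (v * y - x) + (x * a + v * b) / a" if "a \<noteq> 0" for v x y a b :: complex
      using that by (simp add: field_simps)
    show ?thesis unfolding a1 a2 a3 a4 by (rule alg[OF nz])
  qed
  then have eq: "vf_apply A V u = (\<lambda>x. form_dbar g (pot_form Q) x + cnj (form_dbar g dual_form x))" by (rule ext)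
  have "integral\<^sup>L vol (vf_apply A V u) = 0"
  proof -
    have "integrable vol (\<lambda>x. cnj (form_dbar g dual_form x))"
      using stokes(1)[OF dual_form_C1_form] by (simp only: integrable_cnj)
    from Bochner_Integration.integral_add[OF stokes(1)[OF pot] this]
    have "integral\<^sup>L vol (vf_apply A V u) = integral\<^sup>L vol (form_dbar g (pot_form Q))
      + cnj (integral\<^sup>L vol (form_dbar g dual_form))"
      unfolding eq by (simp only: Bochner_Integration.integral_cnj)
    then show ?thesis unfolding stokes(2)[OF pot] stokes(2)[OF dual_form_C1_form] by simp
  qed
  then show ?thesis unfolding Fut_def by simp
qed

end

theorem proposition1:
  fixes \<A> :: "'a::{t2_space, second_countable_topology} chart set"
  assumes "compact_kaehler_curve \<A>"
    and "c1_positive \<A>"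
  shows "futaki_invariant_vanishes \<A>"
  unfolding futaki_invariant_vanishes_def
proof (intro allI impI)
  fix g u V
  assume g: "kaehler_metric \<A> g" and u: "ricci_potential \<A> g u" and V: "holomorphic_vector_field \<A> V"
  have A: "complex_atlas \<A>" "compact (UNIV :: 'a set)"
    using assms(1) unfolding compact_kaehler_curve_def by simp_all
  interpret futaki_setup \<A> g V u
    by unfold_locales (fact A g u V)+
  show "Fut \<A> g u V = 0" by (rule Fut_eq_0)
qed

end
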